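(* Let $E$ be an admissible compact set, $F\in\mathcal H(E)$ and $\mu\in\mathcal S(E)$. Let $F_n=\langle F,p_n\rangle_\mu$. If $$\lim_{n\to\infty}\frac{F_n}{F_{n+1}}=\tau$$ for some (finite) $\tau\in\mathbb C$, then $\Psi(\tau)$ is a singularity of $F$ and $\rho_0(F)=|\tau|$.
   Context: Admissible compact set: an infinite compact set $E\subset\mathbb C$ such that $\overline{\mathbb C}\setminus E$ is simply connected and such that, with $\Phi$ the unique conformal map of $\overline{\mathbb C}\setminus E$ onto $\overline{\mathbb C}\setminus\{w:|w|\le 1\}$ satisfying $\Phi(\infty)=\infty$, $\Phi'(\infty)>0$, the inverse $\Psi=\Phi^{-1}$ extends continuously to $\overline{\mathbb C}\setminus\{w:|w|<1\}$. $\mathcal M(E)$ is the set of finite positive Borel measures $\mu$ with infinite support contained in $E$; $\langle g,h\rangle_\mu=\int g\,\overline h\,d\mu$; $p_n(z)=\kappa_n z^n+\cdots$, $\kappa_n>0$, are the orthonormal polynomials with respect to $\mu$. $\mathcal S(E)$ is the set of $\mu\in\mathcal M(E)$ for which there exist positive constants $c_n$ and a holomorphic non-vanishing function $S$ on $\overline{\mathbb C}\setminus E$ such that $\lim_{n\to\infty}p_n(z)/(c_n\Phi^n(z))=S(z)$ uniformly on compact subsets of $\overline{\mathbb C}\setminus E$ and $\lim_{n\to\infty}c_n/c_{n+1}=1$. $\mathcal H(E)$ is the space of functions holomorphic in some neighborhood of $E$. For $\rho>1$, $\Gamma_\rho=\{z:|\Phi(z)|=\rho\}$, and $D_\rho$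 (a canonical domain) is the bounded connected component of the complement of $\Gamma_\rho$. $\rho_0(F)$ is the index $\rho>1$ of the largest canonical domain $D_\rho$ to which $F$ extends as a holomorphic function. A point $z_0$ of the boundary of $D_{\rho_0(F)}$ is a singularity of $F$ if $F$ (extended to $D_{\rho_0(F)}$) has no holomorphic extension to a neighborhood of $z_0$. *)

theory Defs
  imports "HOL-Complex_Analysis.Complex_Analysis"
begin

(* The Riemann sphere is the one-point compactification of the plane; None is the point at
   infinity, and for E in the plane the set "- Some ` E" is the complement of E in the sphere. *)

definition riemann_sphere :: "complex option topology" where
  "riemann_sphere = Alexandroff_compactification (euclidean :: complex topology)"

definition chart_at_infinity :: "complex \<Rightarrow> complex option" where
  "chart_at_infinity w = (if w = 0 then None else Some (inverse w))"

text \<open>Holomorphy of a complex-valued function on an open subset of the sphere, expressed in the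
  two standard charts.\<close>

definition sphere_holomorphic_on :: "(complex option \<Rightarrow> complex) \<Rightarrow> complex option set \<Rightarrow> bool" where
  "sphere_holomorphic_on f U \<longleftrightarrow>
     (f \<circ> Some) holomorphic_on (Some -` U) \<and>
     (f \<circ> chart_at_infinity) holomorphic_on (chart_at_infinity -` U)"

definition extend_to_infinity :: "(complex \<Rightarrow> complex) \<Rightarrow> complex option \<Rightarrow> complex" where
  "extend_to_infinity f x = (case x of None \<Rightarrow> Lim at_infinity f | Some z \<Rightarrow> f z)"

definition simply_connected_space :: "'a topology \<Rightarrow> bool" where
  "simply_connected_space X \<longleftrightarrow>
     path_connected_space X \<and>
     (\<forall>\<gamma>. continuous_map (top_of_set (sphere (0::complex) 1)) X \<gamma> \<longrightarrow>
        (\<exists>a. homotopic_with (\<lambda>_. True) (top_of_set (sphere (0::complex) 1)) X \<gamma> (\<lambda>_. a)))"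

(* A conformal map of the sphere minus E onto the sphere minus the closed unit disc that fixes
   infinity takes finite values at finite points, so it is given by its restriction to the plane
   minus E. In the coordinate 1/z its difference quotient at infinity is z / Phi(z), so the limit
   of Phi(z) / z is Phi'(infinity); that this limit is finite and nonzero contains both
   Phi(infinity) = infinity and holomorphy at infinity. *)

definition exterior_conformal_map :: "complex set \<Rightarrow> (complex \<Rightarrow> complex) \<Rightarrow> bool" where
  "exterior_conformal_map E \<Phi> \<longleftrightarrow>
     \<Phi> holomorphic_on (- E) \<and>
     bij_betw \<Phi> (- E) {w. 1 < norm w} \<and>
     (\<exists>a::real. 0 < a \<and> ((\<lambda>z. \<Phi> z / z) \<longlongrightarrow> complex_of_real a) at_infinity)"

(* \<Psi> is the continuous extension of the inverse of \<Phi> to the closed exterior of the unit disc;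
   its continuity at infinity is automatic. Values of \<Phi> on E and of \<Psi> in the open unit
   disc are irrelevant. *)

definition admissible :: "complex set \<Rightarrow> (complex \<Rightarrow> complex) \<Rightarrow> (complex \<Rightarrow> complex) \<Rightarrow> bool" where
  "admissible E \<Phi> \<Psi> \<longleftrightarrow>
     compact E \<and> infinite E \<and>
     simply_connected_space (subtopology riemann_sphere (- Some ` E)) \<and>
     exterior_conformal_map E \<Phi> \<and>
     (\<forall>z\<in>- E. \<Psi> (\<Phi> z) = z) \<and>
     continuous_on {w. 1 \<le> norm w} \<Psi>"

definition measure_support :: "complex measure \<Rightarrow> complex set" where
  "measure_support \<mu> = {z. \<forall>U. open U \<longrightarrow> z \<in> U \<longrightarrow> 0 < emeasure \<mu> U}"

definition measures_on :: "complex set \<Rightarrow> complex measure set" where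
  "measures_on E = {\<mu>. sets \<mu> = sets borel \<and> finite_measure \<mu> \<and>
     infinite (measure_support \<mu>) \<and> measure_support \<mu> \<subseteq> E}"

(* Restricting the integral to E, which carries \<mu>, keeps the values that a function analytic on E
   takes elsewhere from mattering, in particular for measurability. *)

definition inner_product :: "complex set \<Rightarrow> complex measure \<Rightarrow> (complex \<Rightarrow> complex) \<Rightarrow> (complex \<Rightarrow> complex) \<Rightarrow> complex" where
  "inner_product E \<mu> g h = (LINT z:E|\<mu>. g z * cnj (h z))"

definition orthonormal_polynomials :: "complex set \<Rightarrow> complex measure \<Rightarrow> (nat \<Rightarrow> complex poly) \<Rightarrow> bool" where
  "orthonormal_polynomials E \<mu> p \<longleftrightarrow>
     (\<forall>n. degree (p n) = n \<and> (\<exists>\<kappa>::real. 0 < \<kappa> \<and> lead_coeff (p n) = complex_of_real \<kappa>)) \<and>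
     (\<forall>m n. inner_product E \<mu> (poly (p m)) (poly (p n)) = (if m = n then 1 else 0))"

definition szego_class :: "complex set \<Rightarrow> (complex \<Rightarrow> complex) \<Rightarrow> complex measure set" where
  "szego_class E \<Phi> = {\<mu> \<in> measures_on E. \<exists>p (c :: nat \<Rightarrow> real) S.
     orthonormal_polynomials E \<mu> p \<and>
     (\<forall>n. 0 < c n) \<and>
     sphere_holomorphic_on S (- Some ` E) \<and>
     (\<forall>x \<in> - Some ` E. S x \<noteq> 0) \<and>
     (\<forall>K. compactin riemann_sphere K \<and> K \<subseteq> - Some ` E \<longrightarrow>
        uniform_limit K
          (\<lambda>n. extend_to_infinity (\<lambda>z. poly (p n) z / (complex_of_real (c n) * \<Phi> z ^ n)))
          S sequentially) \<and>
     (\<lambda>n. c n / c (Suc n)) \<longlonglongrightarrow> 1}"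

definition level_curve :: "complex set \<Rightarrow> (complex \<Rightarrow> complex) \<Rightarrow> real \<Rightarrow> complex set" where
  "level_curve E \<Phi> \<rho> = {z \<in> - E. norm (\<Phi> z) = \<rho>}"

(* inside is the union of the bounded components of the complement; here there is only one. *)

definition canonical_domain :: "complex set \<Rightarrow> (complex \<Rightarrow> complex) \<Rightarrow> real \<Rightarrow> complex set" where
  "canonical_domain E \<Phi> \<rho> = inside (level_curve E \<Phi> \<rho>)"

definition holomorphic_extension :: "complex set \<Rightarrow> (complex \<Rightarrow> complex) \<Rightarrow> complex set \<Rightarrow> (complex \<Rightarrow> complex) \<Rightarrow> bool" where
  "holomorphic_extension E F D G \<longleftrightarrow>
     G holomorphic_on D \<and> (\<exists>U. open U \<and> E \<subseteq> U \<and> (\<forall>z\<in>U. G z = F z))"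

(* The value is \<infinity> exactly when F extends to every canonical domain. *)

definition rho0 :: "complex set \<Rightarrow> (complex \<Rightarrow> complex) \<Rightarrow> (complex \<Rightarrow> complex) \<Rightarrow> ereal" where
  "rho0 E \<Phi> F =
     Sup {ereal \<rho> | \<rho>. 1 < \<rho> \<and> (\<exists>G. holomorphic_extension E F (canonical_domain E \<Phi> \<rho>) G)}"

definition singularity :: "complex set \<Rightarrow> (complex \<Rightarrow> complex) \<Rightarrow> (complex \<Rightarrow> complex) \<Rightarrow> complex \<Rightarrow> bool" where
  "singularity E \<Phi> F z0 \<longleftrightarrow>
     (\<exists>\<rho>. rho0 E \<Phi> F = ereal \<rho> \<and> 1 < \<rho> \<and>
        z0 \<in> frontier (canonical_domain E \<Phi> \<rho>) \<and>
        (\<exists>G. holomorphic_extension E F (canonical_domain E \<Phi> \<rho>) G \<and>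
          \<not> (\<exists>U H. open U \<and> z0 \<in> U \<and> H holomorphic_on U \<and>
                (\<forall>z \<in> U \<inter> canonical_domain E \<Phi> \<rho>. H z = G z))))"

end

theory Submission
  imports Defs
begin

text \<open>
  Write \<open>a\<^sub>n = c\<^sub>n F\<^sub>n\<close>, so that \<open>a\<^sub>n / a\<^sub>n\<^sub>+\<^sub>1\<close> also tends to \<open>\<tau>\<close>, and transport the expansion of \<open>F\<close> in the \<open>p\<^sub>n\<close>
  to the exterior of the unit disc: \<open>f = (F \<circ> \<Psi>) / (S \<circ> \<Psi>)\<close> is the sum of the \<open>a\<^sub>n P\<^sub>n\<close>, where
  \<open>P\<^sub>n(w) = p\<^sub>n(\<Psi>(w)) / (c\<^sub>n S(\<Psi>(w)))\<close> has a Laurent expansion in descending powers from \<open>w\<^sup>n\<close> on and satisfies \<open>P\<^sub>n(w) \<sim> w\<^sup>n\<close>.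
  Since \<open>a\<^sub>n\<close> decays at the precise rate \<open>1 / \<bar>\<tau>\<bar>\<close>, the Laurent coefficients \<open>b\<^sub>m\<close> of \<open>f\<close> with \<open>m \<ge> 0\<close> satisfy
  \<open>b\<^sub>m / a\<^sub>m \<longlonglongrightarrow> 1\<close>. Hence \<open>b\<^sub>m / b\<^sub>m\<^sub>+\<^sub>1 \<longlonglongrightarrow> \<tau>\<close>, and Fabry's quotient theorem for ordinary power series shows
  that \<open>\<tau>\<close> is a singularity of \<open>f\<close>.

  For Fabry's theorem with \<open>\<tau> = 1\<close>, suppose that the sum \<open>h\<close> is holomorphic near 1. The derivatives
  \<open>h\<^sup>(\<^sup>j\<^sup>) / j!\<close> grow at most like \<open>(4/\<delta>)\<^sup>j\<close> near 1, whereas the maximal term of their power series at radius \<open>R < 1\<close>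
  grows much faster if \<open>R\<close> is close to 1. The remainders of these series from the maximal term on, divided by that
  term, are therefore bounded by a multiple of \<open>1 / \<bar>\<bar>z\<bar> - R\<bar>\<close> near \<open>R\<close>. Multiplying by a quadratic
  polynomial that removes this blow-up on a circle around \<open>R\<close>, the maximum principle bounds them near \<open>R\<close>. But
  they converge to \<open>1 / (1 - z/R)\<close> for \<open>\<bar>z\<bar> < R\<close>, which is unbounded near \<open>R\<close>.
\<close>

section \<open>Fabry's quotient theorem\<close>

text \<open>Eventually \<open>cmod (a n) \<le> q * cmod (a (Suc n))\<close>, so
  \<open>cmod (a n) * q ^ n\<close> stops decreasing. Nonvanishing has to be assumed: division by
  zero gives 0, so a small quotient alone says nothing when its denominator vanishes.\<close>

lemma ratio_limit_lower_bound:
  fixes a :: "nat \<Rightarrow> complex"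
  assumes nz: "\<forall>\<^sub>F n in sequentially. a n \<noteq> 0"
    and lim: "(\<lambda>n. a n / a (Suc n)) \<longlonglongrightarrow> \<tau>" and q: "cmod \<tau> < q"
  obtains c where "0 < c" "\<forall>\<^sub>F n in sequentially. c \<le> cmod (a n) * q ^ n"
proof -
  have "\<forall>\<^sub>F n in sequentially. cmod (a n / a (Suc n)) < q"
    using tendsto_norm[OF lim] q by (rule order_tendstoD)
  then obtain N where N: "\<And>n. n \<ge> N \<Longrightarrow> a n \<noteq> 0 \<and> cmod (a n / a (Suc n)) < q"
    using nz unfolding eventually_sequentially by (metis nat_le_linear order_trans)
  have q0: "q > 0" using q norm_ge_zero[of \<tau>] by linarith
  have "cmod (a N) * q ^ N \<le> cmod (a n) * q ^ n" if "n \<ge> N" for n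
    using that
  proof (induction n rule: dec_induct)
    case (step n)
    have "cmod (a n) \<le> q * cmod (a (Suc n))"
      using N[of n] N[of "Suc n"] step by (simp add: norm_divide divide_simps mult.commute)
    then have "cmod (a n) * q ^ n \<le> cmod (a (Suc n)) * q ^ Suc n"
      using mult_right_mono[of "cmod (a n)" "q * cmod (a (Suc n))" "q ^ n"] q0 by (simp add: algebra_simps)
    with step show ?case by linarith
  qed simp
  moreover have "0 < cmod (a N) * q ^ N" using N[of N] q0 by simp
  ultimately show ?thesis using that unfolding eventually_sequentially by blast
qed

text \<open>The mirror image: \<open>cmod (a n) * q ^ n\<close> eventually stops increasing. A
  quotient of modulus above \<open>q\<close> already forces a nonzero denominator.\<close>

lemma ratio_limit_upper_bound:
  fixes a :: "nat \<Rightarrow> complex"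
  assumes lim: "(\<lambda>n. a n / a (Suc n)) \<longlonglongrightarrow> \<tau>" and q: "0 \<le> q" "q < cmod \<tau>"
  obtains C where "\<And>n. cmod (a n) * q ^ n \<le> C"
proof -
  have "\<forall>\<^sub>F n in sequentially. q < cmod (a n / a (Suc n))"
    using tendsto_norm[OF lim] q(2) by (rule order_tendstoD)
  then obtain N where N: "\<And>n. n \<ge> N \<Longrightarrow> q < cmod (a n / a (Suc n))"
    unfolding eventually_sequentially by blast
  have dec: "cmod (a n) * q ^ n \<le> cmod (a N) * q ^ N" if "n \<ge> N" for n
    using that
  proof (induction n rule: dec_induct)
    case (step n)
    have "q * cmod (a (Suc n)) \<le> cmod (a n)"
      using N[of n] step by (cases "a (Suc n) = 0") (auto simp: norm_divide divide_simps mult.commute split: if_splits)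
    then have "cmod (a (Suc n)) * q ^ Suc n \<le> cmod (a n) * q ^ n"
      using mult_right_mono[of "q * cmod (a (Suc n))" "cmod (a n)" "q ^ n"] q by (simp add: algebra_simps)
    with step show ?case by linarith
  qed simp
  have le: "cmod (a n) * q ^ n \<le> (\<Sum>k\<le>N. cmod (a k) * q ^ k)" if "n \<le> N" for n
    using that q by (intro member_le_sum) auto
  have "cmod (a n) * q ^ n \<le> (\<Sum>k\<le>N. cmod (a k) * q ^ k)" for n
    using le[of n] le[of N] dec[of n] by (cases "n \<le> N") auto
  then show ?thesis using that by blast
qed

lemma ratio_limit_summable:
  fixes a :: "nat \<Rightarrow> complex"
  assumes lim: "(\<lambda>n. a n / a (Suc n)) \<longlonglongrightarrow> \<tau>" and z: "cmod z < cmod \<tau>"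
  shows "summable (\<lambda>n. a n * z ^ n)"
proof -
  obtain q where q: "cmod z < q" "q < cmod \<tau>" using dense[OF z] by blast
  have q0: "0 < q" using q norm_ge_zero[of z] by linarith
  obtain C where C: "\<And>n. cmod (a n) * q ^ n \<le> C"
    using ratio_limit_upper_bound[OF lim less_imp_le[OF q0] q(2)] by blast
  show ?thesis
  proof (rule summable_comparison_test')
    show "summable (\<lambda>n. C * (cmod z / q) ^ n)"
      using q q0 by (intro summable_mult summable_geometric) auto
    show "norm (a n * z ^ n) \<le> C * (cmod z / q) ^ n" for n
      using mult_right_mono[OF C[of n], of "(cmod z / q) ^ n"] q0
      by (simp add: norm_mult norm_power power_divide)
  qed
qed

section \<open>Taylor coefficients of derivatives and their maximal terms\<close>

lemma higher_deriv_power_series_sums: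
  fixes a :: "nat \<Rightarrow> complex"
  assumes sums: "\<And>z. cmod z < r \<Longrightarrow> (\<lambda>n. a n * z ^ n) sums f z" and z: "cmod z < r"
  shows "(\<lambda>n. of_nat ((n + j) choose j) * a (n + j) * z ^ n) sums ((deriv ^^ j) f z / fact j)"
proof -
  have hol: "f holomorphic_on ball 0 r"
    by (rule power_series_holomorphic[where a = a]) (use sums in auto)
  have 1: "\<And>z. cmod z < r \<Longrightarrow> (\<lambda>n. (diffs ^^ j) a n * z ^ n) sums (deriv ^^ j) f z" for j
  proof (induction j)
    case (Suc j)
    have "((deriv ^^ j) f has_field_derivative (deriv ^^ Suc j) f z) (at z)"
      using Suc.prems by (intro has_field_derivative_higher_deriv[OF hol]) auto
    from termdiffs_sums_strong[OF Suc.IH this Suc.prems] show ?case by simp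
  qed (use sums in auto)
  have 2: "(diffs ^^ j) a n = fact (n + j) / fact n * a (n + j)" for n
  proof (induction j arbitrary: n)
    case (Suc j)
    have "(diffs ^^ Suc j) a n = of_nat (Suc n) * (fact (Suc n + j) / fact (Suc n) * a (Suc n + j))"
      by (simp only: funpow.simps o_apply diffs_def[of "(diffs ^^ j) a"] Suc.IH)
    also have "\<dots> = fact (n + Suc j) / fact n * a (n + Suc j)"
      by (simp add: fact_Suc[of n] field_simps del: of_nat_Suc fact_Suc)
    finally show ?case .
  qed simp
  have 3: "of_nat ((n + j) choose j) * a (n + j) * z ^ n = (diffs ^^ j) a n * z ^ n / fact j" for n
    by (simp add: 2 binomial_fact)
  show ?thesis unfolding 3 by (intro sums_divide 1 z)
qed

text \<open>Supplies the maximal term of a convergent power series at a fixed radius.\<close>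

lemma nonneg_tendsto_0_attains_max:
  fixes x :: "nat \<Rightarrow> real"
  assumes "\<And>n. 0 \<le> x n" and "x \<longlonglongrightarrow> 0"
  shows "\<exists>m. \<forall>n. x n \<le> x m"
proof (cases "\<exists>m. x m > 0")
  case True
  then obtain m where m: "x m > 0" by blast
  obtain N where N: "\<And>n. n \<ge> N \<Longrightarrow> x n < x m"
    using order_tendstoD(2)[OF assms(2) m] unfolding eventually_sequentially by blast
  define M where "M = Max (x ` {..max N m})"
  have "M \<in> x ` {..max N m}" unfolding M_def by (intro Max_in) auto
  then obtain k where k: "M = x k" by blast
  have "x n \<le> M" if "n \<le> max N m" for n unfolding M_def using that by (intro Max_ge) auto
  then show ?thesis using N k by (metis less_eq_real_def max.cobounded1 max.cobounded2 nat_le_linear order_trans)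
next
  case False
  then show ?thesis using assms by (metis linorder_not_le order_antisym)
qed

text \<open>The quotient \<open>B j (Suc i) / B j i\<close> is \<open>1 + j / (i + 1)\<close> times
  a factor tending to 1. Comparing the maximal term with both neighbours forces
  \<open>1 + j / (\<iota> j + 1)\<close> to tend to \<open>1 / R\<close>. Since
  \<open>\<iota> j\<close> tends to infinity, shifting the index by a fixed \<open>k\<close> does
  not change this limit, so each of the \<open>k\<close> steps contributes a factor
  \<open>1 / R\<close>.\<close>

lemma maximal_term_ratio:
  fixes a :: "nat \<Rightarrow> complex" and \<iota> :: "nat \<Rightarrow> nat"
  defines "B \<equiv> (\<lambda>j i. of_nat ((i + j) choose j) * a (i + j))"
  assumes nz: "\<forall>\<^sub>F n in sequentially. a n \<noteq> 0"
    and lim: "(\<lambda>n. a n / a (Suc n)) \<longlonglongrightarrow> 1" and R: "0 < R" "R < 1"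
    and max: "\<And>j i. cmod (B j i) * R ^ i \<le> cmod (B j (\<iota> j)) * R ^ \<iota> j"
  shows "(\<lambda>j. B j (\<iota> j + k) / B j (\<iota> j)) \<longlonglongrightarrow> of_real ((1 / R) ^ k)"
proof -
  define \<alpha> where "\<alpha> n = a (Suc n) / a n" for n
  have \<alpha>: "\<alpha> \<longlonglongrightarrow> 1"
    using tendsto_inverse[OF lim] by (simp add: \<alpha>_def[abs_def] inverse_eq_divide)
  obtain N where N: "\<And>n. n \<ge> N \<Longrightarrow> a n \<noteq> 0"
    using nz unfolding eventually_sequentially by blast
  have B0: "B j i \<noteq> 0" if "j \<ge> N" for i j using N[of "i + j"] that by (simp add: B_def)
  have ratio: "B j (Suc i) = of_real (1 + real j / real (Suc i)) * \<alpha> (i + j) * B j i" if "j \<ge> N" for i j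
  proof -
    have "Suc i * (Suc (i + j) choose j) = Suc (i + j) * ((i + j) choose j)"
      using binomial_absorb_comp[of "Suc (i + j)" j] by (simp add: Suc_diff_le)
    then have "of_nat (Suc i) * of_nat (Suc (i + j) choose j) = (of_nat (Suc (i + j)) * of_nat ((i + j) choose j) :: complex)"
      by (metis of_nat_mult)
    then have "of_nat (Suc (i + j) choose j) = of_nat (Suc (i + j)) / of_nat (Suc i) * (of_nat ((i + j) choose j) :: complex)"
      by (simp add: field_simps del: of_nat_Suc)
    also have "of_nat (Suc (i + j)) / of_nat (Suc i) = (of_real (1 + real j / real (Suc i)) :: complex)"
      by (simp add: divide_simps del: of_nat_Suc) simp
    finally show ?thesis using N[of "i + j"] that by (simp add: B_def \<alpha>_def)
  qed
  define x where "x j = real j / real (Suc (\<iota> j))" for j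
  define \<beta> where "\<beta> j = cmod (\<alpha> (\<iota> j + j))" for j
  \<comment> \<open>Truncated subtraction turns the index into \<open>j\<close> when
    \<open>\<iota> j = 0\<close>. The index still tends to infinity, and the left neighbour is only
    consulted for positive \<open>\<iota> j\<close>.\<close>
  define \<beta>' where "\<beta>' j = cmod (\<alpha> (\<iota> j - 1 + j))" for j
  have shift: "(\<lambda>j. \<alpha> (m j + j)) \<longlonglongrightarrow> 1" for m :: "nat \<Rightarrow> nat"
    by (rule filterlim_compose[OF \<alpha>])
       (rule filterlim_at_top_mono[OF filterlim_ident], simp)
  have \<beta>: "\<beta> \<longlonglongrightarrow> 1" "\<beta>' \<longlonglongrightarrow> 1"
    using tendsto_norm[OF shift[of \<iota>]] tendsto_norm[OF shift[of "\<lambda>j. \<iota> j - 1"]]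
    by (simp_all add: \<beta>_def[abs_def] \<beta>'_def[abs_def])
  have \<beta>pos: "\<beta> j > 0" "\<beta>' j > 0" if "j \<ge> N" for j
    using N that by (auto simp: \<beta>_def \<beta>'_def \<alpha>_def)
  define U where "U j = 1 / (R * \<beta> j) - 1" for j
  define L where "L j = 1 / (R * \<beta>' j) - 1" for j
  have U: "U \<longlonglongrightarrow> 1 / R - 1" and L: "L \<longlonglongrightarrow> 1 / R - 1"
    unfolding U_def[abs_def] L_def[abs_def] using R
    by (auto intro!: tendsto_eq_intros \<beta>)
  \<comment> \<open>Maximality against the right neighbour.\<close>
  have xU: "x j \<le> U j" if j: "j \<ge> N" for j
  proof -
    have "cmod (B j (Suc (\<iota> j))) * R \<le> cmod (B j (\<iota> j))"
      using max[of j "Suc (\<iota> j)"] R by (simp add: mult.assoc[symmetric])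
    moreover have "cmod (B j (Suc (\<iota> j))) = (1 + x j) * \<beta> j * cmod (B j (\<iota> j))"
      unfolding ratio[OF j] \<beta>_def x_def norm_mult norm_of_real by (simp del: of_nat_Suc)
    ultimately have "((1 + x j) * \<beta> j * R) * cmod (B j (\<iota> j)) \<le> 1 * cmod (B j (\<iota> j))"
      by (simp add: algebra_simps)
    then have "(1 + x j) * \<beta> j * R \<le> 1" using B0[OF j] by (subst (asm) mult_le_cancel_right) auto
    then show ?thesis using \<beta>pos[OF j] R by (simp add: U_def field_simps)
  qed
  \<comment> \<open>The upper bound on \<open>j / (\<iota> j + 1)\<close> makes
    \<open>\<iota> j\<close> grow at least linearly in \<open>j\<close>.\<close>
  have \<iota>_inf: "filterlim \<iota> at_top sequentially"
  proof -
    have "\<forall>\<^sub>F j in sequentially. U j < 1 / R" using U by (rule order_tendstoD) simp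
    then have "\<forall>\<^sub>F j in sequentially. R * real j - 1 \<le> real (\<iota> j)"
      using eventually_ge_at_top[of N]
    proof eventually_elim
      case (elim j)
      then have "x j \<le> 1 / R" using xU[of j] by linarith
      then show ?case using R by (simp add: x_def divide_simps split: if_splits) (simp add: algebra_simps)
    qed
    moreover have "filterlim (\<lambda>j. R * real j - 1) at_top sequentially"
      using R by real_asymp
    ultimately have "filterlim (\<lambda>j. real (\<iota> j)) at_top sequentially"
      by (rule filterlim_at_top_mono[rotated])
    then show ?thesis using filterlim_sequentially_iff_filterlim_real by blast
  qed
  have quot: "(\<lambda>j. (real (\<iota> j) + c) / (real (\<iota> j) + d)) \<longlonglongrightarrow> 1" for c d :: real
    by (rule filterlim_compose[OF _ \<iota>_inf, of "\<lambda>n. (real n + c) / (real n + d)"]) real_asymp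
  \<comment> \<open>Maximality against the left neighbour bounds \<open>j / \<iota> j\<close> from
    below. The extra factor replaces the denominator by \<open>\<iota> j + 1\<close> and makes the
    bound trivial when there is no left neighbour.\<close>
  have xL: "L j * ((real (\<iota> j) + 0) / (real (\<iota> j) + 1)) \<le> x j" if j: "j \<ge> N" for j
  proof (cases "\<iota> j")
    case (Suc i)
    have "cmod (B j i) \<le> cmod (B j (Suc i)) * R"
      using max[of j i] R Suc by (simp add: mult.assoc[symmetric])
    moreover have "cmod (B j (Suc i)) = (1 + real j / real (Suc i)) * \<beta>' j * cmod (B j i)"
      unfolding ratio[OF j] \<beta>'_def norm_mult norm_of_real Suc by (simp del: of_nat_Suc)
    ultimately have "1 * cmod (B j i) \<le> ((1 + real j / real (Suc i)) * \<beta>' j * R) * cmod (B j i)"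
      by (simp add: algebra_simps)
    then have "1 \<le> (1 + real j / real (Suc i)) * \<beta>' j * R"
      using B0[OF j] by (subst (asm) mult_le_cancel_right) auto
    then have "L j \<le> real j / real (Suc i)"
      using \<beta>pos[OF j] R by (simp add: L_def field_simps del: of_nat_Suc)
    then have "L j * real (\<iota> j) \<le> real j" using Suc by (simp add: field_simps)
    from divide_right_mono[OF this, of "real (\<iota> j) + 1"] show ?thesis by (simp add: x_def add.commute)
  qed (simp add: x_def)
  have x: "x \<longlonglongrightarrow> 1 / R - 1"
  proof (rule tendsto_sandwich[OF _ _ _ U])
    show "(\<lambda>j. L j * ((real (\<iota> j) + 0) / (real (\<iota> j) + 1))) \<longlonglongrightarrow> 1 / R - 1"
      using tendsto_mult[OF L quot[of 0 1]] by simp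
  qed (use xU xL eventually_sequentially in blast)+
  show ?thesis
  proof (induction k)
    case 0
    have "\<forall>\<^sub>F j in sequentially. 1 = B j (\<iota> j + 0) / B j (\<iota> j)"
      using eventually_ge_at_top[of N] by eventually_elim (use B0 in simp)
    then show ?case by (simp add: tendsto_eventually eventually_mono)
  next
    case (Suc k)
    have e: "1 + x j * ((real (\<iota> j) + 1) / (real (\<iota> j) + (real k + 1))) = 1 + real j / real (Suc (\<iota> j + k))" for j
      by (simp add: x_def add_ac)
    have "(\<lambda>j. 1 + x j * ((real (\<iota> j) + 1) / (real (\<iota> j) + (real k + 1)))) \<longlonglongrightarrow> 1 + (1 / R - 1) * 1"
      by (intro tendsto_intros x quot)
    then have y: "(\<lambda>j. 1 + real j / real (Suc (\<iota> j + k))) \<longlonglongrightarrow> 1 / R" unfolding e by simp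
    have "(\<lambda>j. of_real (1 + real j / real (Suc (\<iota> j + k))) * \<alpha> ((\<iota> j + k) + j) * (B j (\<iota> j + k) / B j (\<iota> j)))
            \<longlonglongrightarrow> of_real (1 / R) * 1 * of_real ((1 / R) ^ k)"
      by (intro tendsto_mult Suc.IH tendsto_of_real y shift[of "\<lambda>j. \<iota> j + k"])
    moreover have "\<forall>\<^sub>F j in sequentially. of_real (1 + real j / real (Suc (\<iota> j + k))) * \<alpha> ((\<iota> j + k) + j) * (B j (\<iota> j + k) / B j (\<iota> j))
       = B j (\<iota> j + Suc k) / B j (\<iota> j)"
      using eventually_ge_at_top[of N]
    proof eventually_elim
      case (elim j)
      show ?case using ratio[OF elim, of "\<iota> j + k"] by simp
    qed
    ultimately show ?case by (subst (asm) tendsto_cong) simp_all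
  qed
qed

lemma fabry_quotient_unit:
  fixes a :: "nat \<Rightarrow> complex"
  assumes nz: "\<forall>\<^sub>F n in sequentially. a n \<noteq> 0"
    and lim: "(\<lambda>n. a n / a (Suc n)) \<longlonglongrightarrow> 1"
    and \<delta>: "0 < \<delta>" "\<delta> \<le> 1" and hol: "h holomorphic_on ball 1 \<delta>"
    and sums: "\<And>z. z \<in> ball 1 \<delta> \<Longrightarrow> cmod z < 1 \<Longrightarrow> (\<lambda>n. a n * z ^ n) sums h z"
  shows False
proof -
  \<comment> \<open>\<open>s\<close> is both the radius of the disc around \<open>R\<close> for the
    maximum principle and the radius in Cauchy's inequality at its points. Two such radii together
    with \<open>1 - R\<close> stay below \<open>3 * \<delta> / 4\<close>.\<close>
  define s where "s = \<delta> / 4"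
  \<comment> \<open>\<open>L\<close> has to be a large multiple of \<open>1 / \<delta>\<close>: the
    distance \<open>1 - R = 1 / L\<close> must be small against \<open>\<delta>\<close>, and the
    maximal terms, which grow at least like \<open>(L / 6) ^ j\<close>, must dominate the Cauchy
    bound \<open>(4 / \<delta>) ^ j\<close>.\<close>
  obtain L0 :: nat where L0: "128 / \<delta> < real L0" using reals_Archimedean2 by blast
  define L where "L = Suc L0"
  have L: "128 / \<delta> < real L" "2 \<le> L"
  proof -
    have "128 / \<delta> < real L" using L0 by (simp add: L_def)
    then show "128 / \<delta> < real L" .
    have "1 \<le> 128 / \<delta>" using \<delta> by simp
    then show "2 \<le> L" using L0 unfolding L_def by linarith
  qed
  define R where "R = 1 - 1 / real L"
  have s: "0 < s" "s \<le> 1 / 4" using \<delta> by (auto simp: s_def)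
  have L\<delta>: "1 / real L < \<delta> / 128" using L \<delta> by (simp add: field_simps)
  have R: "0 < R" "R < 1" "1 / 2 \<le> R" "1 - R < \<delta> / 128" "cmod (of_real R - 1) < \<delta> / 128"
    using L L\<delta> \<delta> by (auto simp: R_def norm_minus_commute norm_divide)
  have summable: "summable (\<lambda>n. a n * z ^ n)" if "cmod z < 1" for z
    using ratio_limit_summable[OF lim] that by simp
  define f where "f z = (\<Sum>n. a n * z ^ n)" for z
  have f: "(\<lambda>n. a n * z ^ n) sums f z" if "cmod z < 1" for z
    using summable[OF that] by (simp add: f_def summable_sums)
  have holf: "f holomorphic_on ball 0 1"
    by (rule power_series_holomorphic[where a = a]) (use f in auto)
  define u where "u j z = (deriv ^^ j) h z / fact j" for j z
  define B where "B j i = of_nat ((i + j) choose j) * a (i + j)" for j i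
  have Bsums: "(\<lambda>n. B j n * z ^ n) sums ((deriv ^^ j) f z / fact j)" if "cmod z < 1" for j z
    unfolding B_def by (rule higher_deriv_power_series_sums[OF f that])
  have usums: "(\<lambda>n. B j n * z ^ n) sums u j z" if z: "cmod z < 1" "z \<in> ball 1 \<delta>" for j z
  proof -
    have "(deriv ^^ j) f z = (deriv ^^ j) h z"
    proof (rule higher_deriv_transform_within_open)
      show "f holomorphic_on ball 0 1 \<inter> ball 1 \<delta>" "h holomorphic_on ball 0 1 \<inter> ball 1 \<delta>"
        using holf hol by (auto intro: holomorphic_on_subset)
      show "f w = h w" if "w \<in> ball 0 1 \<inter> ball 1 \<delta>" for w
        using f[of w] sums[of w] that sums_unique2 by auto
    qed (use z in auto)
    then show ?thesis using Bsums[OF z(1), of j] by (simp add: u_def)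
  qed
  have "\<exists>m. \<forall>i. cmod (B j i) * R ^ i \<le> cmod (B j m) * R ^ m" for j
  proof (rule nonneg_tendsto_0_attains_max)
    show "(\<lambda>n. cmod (B j n) * R ^ n) \<longlonglongrightarrow> 0"
      using tendsto_norm_zero[OF summable_LIMSEQ_zero[OF sums_summable[OF Bsums[of "of_real R" j]]]] R
      by (simp add: norm_mult norm_power)
  qed (use R in auto)
  then obtain \<iota> where \<iota>: "\<And>j i. cmod (B j i) * R ^ i \<le> cmod (B j (\<iota> j)) * R ^ \<iota> j" by metis
  define V where "V j = cmod (B j (\<iota> j)) * R ^ \<iota> j" for j
  obtain M where M: "\<And>z. z \<in> cball 1 (3 * \<delta> / 4) \<Longrightarrow> cmod (h z) \<le> M" "0 < M"
  proof -
    have "bounded (h ` cball 1 (3 * \<delta> / 4))"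
      by (intro compact_imp_bounded compact_continuous_image holomorphic_on_imp_continuous_on
          holomorphic_on_subset[OF hol]) (use \<delta> in auto)
    then show ?thesis using that unfolding bounded_pos by blast
  qed
  have ball: "z \<in> ball 1 \<delta>" "cmod z \<le> 2" "cball z s \<subseteq> cball 1 (3 * \<delta> / 4)" if "z \<in> cball (of_real R) s" for z
  proof -
    have "cmod (z - 1) \<le> cmod (z - of_real R) + cmod (of_real R - 1)" by (metis diff_add_cancel add_diff_eq norm_triangle_ineq)
    then have z: "cmod (z - 1) \<le> s + \<delta> / 128" using that R by (auto simp: dist_norm norm_minus_commute)
    then show "z \<in> ball 1 \<delta>" using \<delta> by (auto simp: dist_norm norm_minus_commute s_def)
    have "cmod z \<le> cmod (z - 1) + 1" by (metis diff_add_cancel norm_one norm_triangle_ineq)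
    then show "cmod z \<le> 2" using z \<delta> by (auto simp: s_def)
    show "cball z s \<subseteq> cball 1 (3 * \<delta> / 4)"
      using z \<delta> by (auto simp: cball_subset_cball_iff dist_norm s_def)
  qed
  have uM: "cmod (u j z) \<le> M / s ^ j" if z: "z \<in> cball (of_real R) s" for j z
  proof -
    have "cmod ((deriv ^^ j) h z) \<le> fact j * M / s ^ j"
    proof (rule Cauchy_inequality)
      have "cball z s \<subseteq> ball 1 \<delta>"
        by (rule order_trans[OF ball(3)[OF z]]) (use \<delta> in \<open>auto simp: cball_subset_ball_iff\<close>)
      then have *: "h holomorphic_on cball z s" using hol holomorphic_on_subset by blast
      show "h holomorphic_on ball z s" "continuous_on (cball z s) h"
        using * holomorphic_on_subset ball_subset_cball holomorphic_on_imp_continuous_on by blast+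
      show "cmod (h x) \<le> M" if "cmod (z - x) = s" for x
        using M(1)[of x] ball(3)[OF z] that by (auto simp: dist_norm)
    qed (use s in auto)
    then have "cmod ((deriv ^^ j) h z) / fact j \<le> fact j * M / s ^ j / fact j"
      by (rule divide_right_mono) simp
    then show ?thesis by (simp add: u_def norm_divide)
  qed
  \<comment> \<open>The base \<open>root L 2\<close> exceeds 1, as the lower bound requires, yet
    costs only \<open>2 ^ j\<close> at the index \<open>j * L\<close>.\<close>
  obtain c where c: "0 < c" "\<forall>\<^sub>F n in sequentially. c \<le> cmod (a n) * (root L 2) ^ n"
    using ratio_limit_lower_bound[OF nz lim, of "root L 2"] L by auto
  \<comment> \<open>The term of index \<open>j * (L - 1)\<close> bounds the maximal term from below:
    its binomial coefficient contributes \<open>L ^ j\<close>, while \<open>a (j * L)\<close> loses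
    a factor \<open>2 ^ j\<close> and the power of \<open>R\<close> a factor
    \<open>3 ^ j\<close>.\<close>
  have V: "\<forall>\<^sub>F j in sequentially. c * (real L / 6) ^ j \<le> V j"
  proof -
    have Linf: "filterlim (\<lambda>j. j * L) at_top sequentially"
      by (rule filterlim_at_top_mono[OF filterlim_ident]) (use L in simp)
    have "\<forall>\<^sub>F j in sequentially. c \<le> cmod (a (j * L)) * (root L 2) ^ (j * L)"
      using filterlim_iff[THEN iffD1, OF Linf] c(2) by blast
    then show ?thesis using eventually_gt_at_top[of 0]
    proof eventually_elim
      case (elim j)
      have "(root L 2) ^ (j * L) = (2::real) ^ j"
        using L by (simp add: mult.commute[of j] power_mult real_root_pow_pos2)
      with elim have 1: "c / 2 ^ j \<le> cmod (a (j * L))" by (simp add: field_simps)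
      have 2: "real L ^ j \<le> real ((j * L) choose j)"
        using binomial_ge_n_over_k_pow_k[of j "j * L", where 'a = real] elim L by simp
      have 3: "(1 / 3) ^ j \<le> R ^ (j * (L - 1))"
      proof -
        \<comment> \<open>As \<open>1 / R = 1 + 1 / (L - 1)\<close>, this is the classical estimate
          by Euler's number, which is at most 3.\<close>
        have "(1 / R) ^ (L - 1) \<le> exp (1 / real (L - 1)) ^ (L - 1)"
        proof (rule power_mono)
          have "1 / R = 1 + 1 / real (L - 1)" using L by (simp add: R_def field_simps)
          then show "1 / R \<le> exp (1 / real (L - 1))" using exp_ge_add_one_self by simp
        qed (use R in auto)
        also have "\<dots> = exp 1" using L by (simp flip: exp_of_nat_mult)
        finally have "(1 / R) ^ (L - 1) \<le> 3" using exp_le by linarith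
        then have "1 / 3 \<le> R ^ (L - 1)" using R by (simp add: power_divide field_simps)
        then have "(1 / 3) ^ j \<le> (R ^ (L - 1)) ^ j" by (intro power_mono) auto
        then show ?thesis by (simp add: power_mult[symmetric] mult.commute)
      qed
      have idx: "j * (L - 1) + j = j * L" using L by (cases L) auto
      have "c * (real L / 6) ^ j = real L ^ j * (c / 2 ^ j) * (1 / 3) ^ j"
        by (simp add: power_divide field_simps flip: power_mult_distrib)
      also have "\<dots> \<le> real ((j * L) choose j) * cmod (a (j * L)) * R ^ (j * (L - 1))"
        using c by (intro mult_mono 1 2 3 mult_nonneg_nonneg) auto
      also have "\<dots> = cmod (B j (j * (L - 1))) * R ^ (j * (L - 1))"
        by (simp only: B_def idx norm_mult norm_of_nat)
      also have "\<dots> \<le> V j" unfolding V_def by (rule \<iota>)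
      finally show ?case .
    qed
  qed
  define D where "D = M / c"
  have D: "D > 0" using M c by (simp add: D_def)
  have uV: "\<forall>\<^sub>F j in sequentially. 0 < V j \<and> (\<forall>z \<in> cball (of_real R) s. cmod (u j z) \<le> D * V j)"
    using V
  proof eventually_elim
    case (elim j)
    have "1 / s ^ j \<le> (real L / 6) ^ j"
    proof -
      have "1 / s \<le> real L / 6" using L \<delta> by (simp add: s_def field_simps)
      then have "(1 / s) ^ j \<le> (real L / 6) ^ j" using s by (intro power_mono) auto
      then show ?thesis by (simp add: power_divide)
    qed
    then have "M / s ^ j \<le> D * (c * (real L / 6) ^ j)"
      using mult_left_mono[of "1 / s ^ j" "(real L / 6) ^ j" M] M c by (simp add: D_def)
    also have "\<dots> \<le> D * V j" using elim D by simp
    finally have "cmod (u j z) \<le> D * V j" if "z \<in> cball (of_real R) s" for z using uM[OF that, of j] by linarith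
    moreover have "0 < c * (real L / 6) ^ j" using c L by simp
    ultimately show ?case using elim by auto
  qed
  \<comment> \<open>The normalised remainder from the maximal term on. Defined through
    \<open>u j\<close> and not as a series, it is available on the whole disc around
    \<open>R\<close>, which reaches beyond the unit circle.\<close>
  define g where "g j z = (u j z - (\<Sum>m<\<iota> j. B j m * z ^ m)) / (B j (\<iota> j) * z ^ \<iota> j)" for j z
  have tail: "(\<lambda>k. B j (\<iota> j + k) / B j (\<iota> j) * z ^ k) sums g j z"
    if "B j (\<iota> j) \<noteq> 0" "z \<in> cball (of_real R) s" "cmod z < R" "z \<noteq> 0" for j z
  proof -
    have "(\<lambda>m. B j m * z ^ m) sums u j z" using that ball(1) R by (intro usums) auto
    from sums_split_initial_segment[OF this, of "\<iota> j"]
    have "(\<lambda>k. B j (k + \<iota> j) * z ^ (k + \<iota> j) / (B j (\<iota> j) * z ^ \<iota> j)) sums g j z"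
      unfolding g_def by (rule sums_divide)
    then show ?thesis using that by (simp add: power_add add.commute)
  qed
  have coeff: "cmod (B j (\<iota> j + k) / B j (\<iota> j) * z ^ k) \<le> (cmod z / R) ^ k" if "B j (\<iota> j) \<noteq> 0" for j k z
  proof -
    have "cmod (B j (\<iota> j + k)) * R ^ k \<le> cmod (B j (\<iota> j))"
      using \<iota>[of j "\<iota> j + k"] R by (simp add: power_add mult.assoc[symmetric] mult.commute[of "R ^ \<iota> j"])
    then have "cmod (B j (\<iota> j + k)) / cmod (B j (\<iota> j)) \<le> 1 / R ^ k"
      using that R by (simp add: field_simps)
    from mult_right_mono[OF this, of "cmod z ^ k"] show ?thesis
      by (simp add: norm_mult norm_divide norm_power power_divide)
  qed
  define Q where "Q z = (z - of_real R)\<^sup>2 + of_real (s\<^sup>2 / R) * (z - of_real R) + of_real (s\<^sup>2)" for z :: complex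
  \<comment> \<open>\<open>Q\<close> is the monic quadratic whose zeros are the two points of the circle with \<open>\<bar>z\<bar> = R\<close>.\<close>
  have Q: "cmod (Q z) = s / R * \<bar>(cmod z)\<^sup>2 - R\<^sup>2\<bar>" if "cmod (z - of_real R) = s" for z
  proof -
    define v where "v = z - of_real R"
    have vv: "v * cnj v = of_real (s\<^sup>2)" using that complex_norm_square[of v] by (simp add: v_def)
    have zz: "complex_of_real ((cmod z)\<^sup>2) = z * cnj z" by (rule complex_norm_square)
    \<comment> \<open>On the circle \<open>s\<^sup>2 = v * cnj v\<close>, so \<open>v\<close>
      factors out of \<open>Q z\<close>. The remaining factor is real and equals
      \<open>((cmod z)\<^sup>2 - R\<^sup>2) / R\<close>.\<close>
    have "Q z = v * (v + of_real (s\<^sup>2 / R) + cnj v)"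
      unfolding Q_def v_def[symmetric] vv[symmetric] by (simp add: algebra_simps power2_eq_square)
    also have "v + of_real (s\<^sup>2 / R) + cnj v = of_real (1 / R) * of_real ((cmod z)\<^sup>2 - R\<^sup>2)"
    proof -
      have "z * cnj z - of_real (R\<^sup>2) = v * cnj v + of_real R * (v + cnj v)"
        by (simp add: v_def algebra_simps power2_eq_square)
      also have "\<dots> = of_real R * (v + of_real (s\<^sup>2 / R) + cnj v)"
        using R unfolding vv by (simp add: field_simps)
      finally show ?thesis using R unfolding of_real_diff zz by simp
    qed
    finally show ?thesis using that R by (simp add: norm_mult v_def norm_divide del: of_real_power of_real_diff)
  qed
  \<comment> \<open>Four times the bound \<open>3 * D + 3 / 4\<close> reached on the outer part of
    the circle, which is the largest of the three cases below.\<close>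
  define C where "C = 12 * D + 3"
  have C: "C > 0" using D by (simp add: C_def)
  have zpos: "z \<noteq> 0" if "z \<in> cball (of_real R) s" for z :: complex using that R s by (auto simp: dist_norm)
  have bound: "cmod (Q z * g j z) \<le> C"
    if j: "0 < V j" "\<And>z. z \<in> cball (of_real R) s \<Longrightarrow> cmod (u j z) \<le> D * V j"
      and z: "cmod (z - of_real R) = s" for j z
  proof -
    have zb: "z \<in> cball (of_real R) s" using z by (simp add: dist_norm norm_minus_commute)
    have z2: "cmod z \<le> 2" using ball(2)[OF zb] .
    have Bn: "B j (\<iota> j) \<noteq> 0" using j(1) by (auto simp: V_def)
    have fac: "(cmod z)\<^sup>2 - R\<^sup>2 = (cmod z - R) * (cmod z + R)" by (simp add: algebra_simps power2_eq_square)
    have sz: "s * (R + cmod z) \<le> 3 / 4" using mult_mono[of s "1/4" "R + cmod z" 3] s R z2 by simp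
    consider "cmod z < R" | "cmod z = R" | "R < cmod z" by linarith
    then show ?thesis
    proof cases
      case 1
      have y: "norm (cmod z / R) < 1" using 1 R by simp
      \<comment> \<open>Inside, maximality dominates the series by a geometric one, whose sum
        \<open>R / (R - cmod z)\<close> is absorbed by \<open>Q\<close>.\<close>
      have "cmod (g j z) \<le> (\<Sum>k. (cmod z / R) ^ k)"
        unfolding sums_unique[OF tail[OF Bn zb 1 zpos[OF zb]]]
        by (intro norm_suminf_le summable_geometric y coeff Bn)
      also have "\<dots> = R / (R - cmod z)" using suminf_geometric[OF y] R 1 by (simp add: field_simps)
      finally have "cmod (Q z * g j z) \<le> s / R * ((R - cmod z) * (R + cmod z)) * (R / (R - cmod z))"
        unfolding norm_mult Q[OF z] fac using 1 R s
        by (intro mult_mono) (auto simp: abs_mult)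
      also have "\<dots> = s * (R + cmod z)" using 1 R by (simp add: field_simps)
      finally show ?thesis using sz D by (simp add: C_def)
    next
      case 2
      then show ?thesis using C by (simp add: norm_mult Q[OF z])
    next
      case 3
      define y where "y = cmod z / R"
      have y: "y > 1" using 3 R by (simp add: y_def)
      have den: "cmod (B j (\<iota> j) * z ^ \<iota> j) = V j * y ^ \<iota> j"
        using R by (simp add: V_def y_def norm_mult norm_power power_divide)
      \<comment> \<open>Outside, the terms before the maximal one are dominated by a geometric sum
        with ratio \<open>y\<close>. This again blows up like \<open>1 / (cmod z - R)\<close>, while
        \<open>u j\<close> itself stays below \<open>D * V j\<close>.\<close>
      have "cmod (\<Sum>m<\<iota> j. B j m * z ^ m) \<le> (\<Sum>m<\<iota> j. V j * y ^ m)"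
      proof (rule sum_norm_le)
        fix m
        have "cmod (B j m) \<le> V j / R ^ m" using \<iota>[of j m] R by (simp add: V_def field_simps)
        from mult_right_mono[OF this, of "cmod z ^ m"]
        show "cmod (B j m * z ^ m) \<le> V j * y ^ m" by (simp add: norm_mult norm_power y_def power_divide)
      qed
      also have "\<dots> = V j * ((y ^ \<iota> j - 1) / (y - 1))"
        using y by (simp add: sum_distrib_left[symmetric] geometric_sum)
      also have "\<dots> \<le> V j * (y ^ \<iota> j / (y - 1))" using y j(1) by (intro mult_left_mono divide_right_mono) auto
      finally have 1: "cmod (\<Sum>m<\<iota> j. B j m * z ^ m) \<le> V j * y ^ \<iota> j * (1 / (y - 1))" by simp
      have 2: "cmod (u j z) \<le> V j * y ^ \<iota> j * D"
    proof -
      have "D * V j * 1 \<le> D * V j * y ^ \<iota> j" using j(1) D y by (intro mult_left_mono one_le_power) auto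
      with j(2)[OF zb] show ?thesis by (simp add: mult_ac)
    qed
      have "cmod (u j z - (\<Sum>m<\<iota> j. B j m * z ^ m)) \<le> (V j * y ^ \<iota> j) * (D + 1 / (y - 1))"
        using 1 2 norm_triangle_ineq4[of "u j z" "\<Sum>m<\<iota> j. B j m * z ^ m"] by (simp add: algebra_simps)
      then have "cmod (g j z) \<le> D + 1 / (y - 1)"
        unfolding g_def norm_divide den using j(1) y by (simp add: pos_divide_le_eq mult.commute)
      also have "1 / (y - 1) = R / (cmod z - R)" using R 3 by (simp add: y_def field_simps)
      finally have "cmod (Q z * g j z) \<le> s / R * ((cmod z - R) * (cmod z + R)) * (D + R / (cmod z - R))"
        unfolding norm_mult Q[OF z] fac using 3 R s
        by (intro mult_mono) (auto simp: abs_mult)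
      also have "\<dots> = s * (cmod z + R) * ((cmod z - R) / R) * D + s * (R + cmod z)"
        using 3 R by (simp add: field_simps)
      also have "s * (cmod z + R) * ((cmod z - R) / R) * D \<le> 3 / 4 * 4 * D"
        using sz 3 R D z2 s by (intro mult_mono mult_nonneg_nonneg) (auto simp: divide_simps add.commute)
      finally show ?thesis using sz D by (simp add: C_def)
    qed
  qed
  have interior: "cmod (Q z * g j z) \<le> C"
    if j: "0 < V j" "\<And>z. z \<in> cball (of_real R) s \<Longrightarrow> cmod (u j z) \<le> D * V j"
      and z: "z \<in> ball (of_real R) s" for j z
  proof (rule maximum_modulus_frontier[of "\<lambda>z. Q z * g j z" "cball (of_real R) s"])
    have Bn: "B j (\<iota> j) \<noteq> 0" using j(1) by (auto simp: V_def)
    have "(deriv ^^ j) h holomorphic_on ball 1 \<delta>" using hol by (intro holomorphic_higher_deriv) auto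
    then have "(deriv ^^ j) h holomorphic_on cball (of_real R) s"
      using ball(1) by (meson holomorphic_on_subset subsetI)
    then have *: "(\<lambda>z. Q z * g j z) holomorphic_on cball (of_real R) s"
      unfolding Q_def g_def u_def
      by (intro holomorphic_on_mult holomorphic_on_add holomorphic_on_diff holomorphic_on_divide holomorphic_on_power
          holomorphic_on_sum holomorphic_on_const holomorphic_on_ident) (use zpos Bn in auto)
    then show "(\<lambda>z. Q z * g j z) holomorphic_on interior (cball (of_real R) s)"
      using interior_subset holomorphic_on_subset by blast
    show "continuous_on (closure (cball (of_real R) s)) (\<lambda>z. Q z * g j z)"
      using holomorphic_on_imp_continuous_on[OF *] by simp
    show "cmod (Q z * g j z) \<le> C" if "z \<in> frontier (cball (of_real R) s)" for z
      using that bound[OF j, of z] s by (auto simp: dist_norm norm_minus_commute)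
  qed (use z in auto)
  \<comment> \<open>At the point \<open>R - t\<close> the functions \<open>g j\<close> tend to
    \<open>R / t\<close>, which this choice makes at least \<open>4 * C / s\<^sup>2\<close>, twice
    the bound obtained from the maximum principle. The bound \<open>t \<le> s / 2\<close> keeps
    \<open>cmod (Q x)\<close> above \<open>s\<^sup>2 / 2\<close>.\<close>
  define t where "t = min (s / 2) (R * s\<^sup>2 / (4 * C))"
  have t: "0 < t" "t \<le> s / 2" "t \<le> 1 / 8" "t \<le> R * s\<^sup>2 / (4 * C)" using s R C by (auto simp: t_def)
  define x where "x = R - t"
  have x: "0 < x" "x < R" "complex_of_real x \<in> ball (of_real R) s"
    using t R s by (auto simp: x_def dist_norm)
  have Qx: "s\<^sup>2 / 2 \<le> cmod (Q (of_real x))"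
  proof -
    have "Q (of_real x) = of_real (t\<^sup>2 - s\<^sup>2 / R * t + s\<^sup>2)" by (simp add: Q_def x_def)
    moreover have "s\<^sup>2 / R * t \<le> s\<^sup>2 / 2"
    proof -
      have "t / R \<le> 1 / 2" using t R by (simp add: field_simps)
      from mult_left_mono[OF this, of "s\<^sup>2"] show ?thesis by simp
    qed
    moreover have "t\<^sup>2 \<ge> 0" by simp
    ultimately show ?thesis by (simp only: norm_of_real)
  qed
  have evg: "\<forall>\<^sub>F j in sequentially. cmod (g j (of_real x)) \<le> 2 * C / s\<^sup>2"
    using uV
  proof eventually_elim
    case (elim j)
    have "s\<^sup>2 / 2 * cmod (g j (of_real x)) \<le> cmod (Q (of_real x)) * cmod (g j (of_real x))"
      by (intro mult_right_mono Qx) auto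
    also have "\<dots> \<le> C" using interior[of j "of_real x"] elim x(3) by (simp add: norm_mult)
    finally show ?case using s by (simp add: field_simps)
  qed
  have y: "norm (x / R) < 1" using x R by simp
  \<comment> \<open>The coefficients converge one by one, and maximality gives a geometric majorant
    independent of \<open>j\<close>, so the limit may be taken term by term.\<close>
  have "(\<lambda>j. \<Sum>k. B j (\<iota> j + k) / B j (\<iota> j) * of_real x ^ k) \<longlonglongrightarrow> (\<Sum>k. of_real ((1 / R) ^ k) * of_real x ^ k :: complex)"
  proof (rule tannerys_theorem[THEN conjunct2, THEN conjunct2])
    show "(\<lambda>j. B j (\<iota> j + k) / B j (\<iota> j) * of_real x ^ k) \<longlonglongrightarrow> of_real ((1 / R) ^ k) * of_real x ^ k" for k
      by (intro tendsto_mult_right maximal_term_ratio[OF nz lim R(1,2), folded B_def] tendsto_const \<iota>)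
    show "summable (\<lambda>k. (x / R) ^ k)" using y by (rule summable_geometric)
    have "\<forall>\<^sub>F j in sequentially. \<forall>k. norm (B j (\<iota> j + k) / B j (\<iota> j) * of_real x ^ k) \<le> (x / R) ^ k"
      using uV
    proof eventually_elim
      case (elim j)
      then have "B j (\<iota> j) \<noteq> 0" by (auto simp: V_def)
      from coeff[OF this, of _ "of_real x"] show ?case using x by simp
    qed
    then show "\<forall>\<^sub>F (k, j) in sequentially \<times>\<^sub>F sequentially. norm (B j (\<iota> j + k) / B j (\<iota> j) * of_real x ^ k) \<le> (x / R) ^ k"
      by (subst eventually_prod_filter) (intro exI[of _ "\<lambda>_. True"] exI conjI, auto)
  qed auto
  also have "(\<Sum>k. of_real ((1 / R) ^ k) * of_real x ^ k) = complex_of_real (R / t)"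
  proof -
    have "(\<lambda>k. (x / R) ^ k) sums (1 / (1 - x / R))" using y by (rule geometric_sums)
    also have "1 / (1 - x / R) = R / t" using R by (simp add: x_def field_simps)
    finally have "(\<lambda>k. complex_of_real ((x / R) ^ k)) sums of_real (R / t)" by (simp only: sums_of_real_iff)
    then show ?thesis by (simp add: sums_iff power_divide)
  qed
  finally have lim1: "(\<lambda>j. \<Sum>k. B j (\<iota> j + k) / B j (\<iota> j) * of_real x ^ k) \<longlonglongrightarrow> complex_of_real (R / t)" .
  have "\<forall>\<^sub>F j in sequentially. (\<Sum>k. B j (\<iota> j + k) / B j (\<iota> j) * of_real x ^ k) = g j (of_real x)"
    using uV
  proof eventually_elim
    case (elim j)
    have "of_real x \<in> cball (complex_of_real R) s" using x(3) by (simp only: mem_ball mem_cball less_imp_le)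
    moreover have "B j (\<iota> j) \<noteq> 0" using elim by (auto simp: V_def)
    ultimately have "(\<lambda>k. B j (\<iota> j + k) / B j (\<iota> j) * of_real x ^ k) sums g j (of_real x)"
      using x by (intro tail) auto
    then show ?case by (rule sums_unique[symmetric])
  qed
  with lim1 have "(\<lambda>j. g j (of_real x)) \<longlonglongrightarrow> complex_of_real (R / t)" by (subst (asm) tendsto_cong)
  from tendsto_upperbound[OF tendsto_norm[OF this] evg] have "R / t \<le> 2 * C / s\<^sup>2"
    using R t by (simp only: norm_of_real) simp
  moreover have "R / t \<ge> 4 * C / s\<^sup>2" using t s R C by (simp add: field_simps)
  ultimately show False using C s by (simp add: field_simps)
qed

text \<open>Rescaling the variable by \<open>\<tau>\<close> turns the coefficients into
  \<open>a n * \<tau> ^ n\<close> and the limit into 1.\<close>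

theorem fabry_quotient:
  fixes a :: "nat \<Rightarrow> complex"
  assumes nz: "\<forall>\<^sub>F n in sequentially. a n \<noteq> 0"
    and lim: "(\<lambda>n. a n / a (Suc n)) \<longlonglongrightarrow> \<tau>" and \<tau>: "\<tau> \<noteq> 0"
    and \<epsilon>: "0 < \<epsilon>" and hol: "h holomorphic_on ball \<tau> \<epsilon>"
    and sums: "\<And>z. z \<in> ball \<tau> \<epsilon> \<Longrightarrow> cmod z < cmod \<tau> \<Longrightarrow> (\<lambda>n. a n * z ^ n) sums h z"
  shows False
proof (rule fabry_quotient_unit)
  define \<delta> where "\<delta> = min 1 (\<epsilon> / cmod \<tau>)"
  show \<delta>: "0 < \<delta>" "\<delta> \<le> 1" using \<epsilon> \<tau> by (auto simp: \<delta>_def)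
  have b: "\<tau> * z \<in> ball \<tau> \<epsilon>" if "z \<in> ball 1 \<delta>" for z
  proof -
    have "cmod (\<tau> - \<tau> * z) = cmod \<tau> * cmod (1 - z)"
      by (simp add: norm_mult[symmetric] algebra_simps)
    moreover have "cmod (1 - z) < \<epsilon> / cmod \<tau>" using that by (auto simp: dist_norm \<delta>_def)
    ultimately show ?thesis using \<tau> by (simp add: dist_norm field_simps)
  qed
  show "(\<lambda>z. h (\<tau> * z)) holomorphic_on ball 1 \<delta>"
    by (rule holomorphic_on_compose_gen[OF _ hol, of "\<lambda>z. \<tau> * z", unfolded o_def])
       (auto intro!: holomorphic_intros b)
  show "\<forall>\<^sub>F n in sequentially. a n * \<tau> ^ n \<noteq> 0" using nz \<tau> by simp
  show "(\<lambda>n. a n * \<tau> ^ n * z ^ n) sums h (\<tau> * z)" if "z \<in> ball 1 \<delta>" "cmod z < 1" for z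
    using sums[OF b[OF that(1)]] that \<tau> by (simp add: norm_mult power_mult_distrib mult.assoc)
  show "(\<lambda>n. a n * \<tau> ^ n / (a (Suc n) * \<tau> ^ Suc n)) \<longlonglongrightarrow> 1"
    using tendsto_divide[OF lim tendsto_const[of \<tau>]] \<tau> by (simp add: field_simps)
qed

section \<open>Exterior conformal maps and canonical domains\<close>

lemma open_exterior_disc: "open {w :: complex. r < cmod w}"
  by (intro open_Collect_less continuous_intros)

lemma connected_exterior_disc: "connected {w :: complex. r < cmod w}"
proof -
  have "{w :: complex. r < cmod w} = - cball 0 r" by auto
  then show ?thesis using connected_complement_bounded_convex[of "cball (0 :: complex) r"] by simp
qed

locale exterior_map =
  fixes E :: "complex set" and \<Phi> \<Psi> :: "complex \<Rightarrow> complex"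
  assumes compact_E: "compact E"
    and ext_map: "exterior_conformal_map E \<Phi>"
    and \<Psi>_\<Phi>: "\<And>z. z \<notin> E \<Longrightarrow> \<Psi> (\<Phi> z) = z"
begin

text \<open>A description of the canonical domain by values of \<open>\<Phi>\<close>, easier to
  handle than bounded components. \<open>E\<close> is added separately because the values of
  \<open>\<Phi>\<close> there are arbitrary.\<close>

definition dom :: "real \<Rightarrow> complex set" where
  "dom \<rho> = E \<union> {z. z \<notin> E \<and> cmod (\<Phi> z) < \<rho>}"

lemma open_Compl_E: "open (- E)"
  using compact_E by (simp add: compact_imp_closed open_Compl)

lemma holomorphic_\<Phi>: "\<Phi> holomorphic_on (- E)"
  and bij_\<Phi>: "bij_betw \<Phi> (- E) {w. 1 < cmod w}"
  using ext_map by (auto simp: exterior_conformal_map_def)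

lemma cmod_\<Phi>_gt_1: "z \<notin> E \<Longrightarrow> 1 < cmod (\<Phi> z)"
  using bij_\<Phi> by (auto simp: bij_betw_def)

lemma \<Psi>_notin_E [simp]: "1 < cmod w \<Longrightarrow> \<Psi> w \<notin> E"
  and \<Phi>_\<Psi> [simp]: "1 < cmod w \<Longrightarrow> \<Phi> (\<Psi> w) = w"
proof -
  assume "1 < cmod w"
  then obtain z where "z \<notin> E" "w = \<Phi> z" using bij_\<Phi> by (auto simp: bij_betw_def)
  then show "\<Psi> w \<notin> E" "\<Phi> (\<Psi> w) = w" by (simp_all add: \<Psi>_\<Phi>)
qed

lemma holomorphic_\<Psi>: "\<Psi> holomorphic_on {w. 1 < cmod w}"
proof -
  obtain g where g: "g holomorphic_on (\<Phi> ` (- E))" "\<And>z. z \<in> - E \<Longrightarrow> g (\<Phi> z) = z"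
    using holomorphic_has_inverse[OF holomorphic_\<Phi> open_Compl_E] bij_\<Phi> by (metis bij_betw_imp_inj_on)
  have "\<Phi> ` (- E) = {w. 1 < cmod w}" using bij_\<Phi> by (auto simp: bij_betw_def)
  with g(1) have "g holomorphic_on {w. 1 < cmod w}" by simp
  then show ?thesis
    by (rule holomorphic_transform) (use g(2) in \<open>metis ComplI \<Phi>_\<Psi> \<Psi>_notin_E mem_Collect_eq\<close>)
qed

lemma filterlim_\<Phi>: "filterlim \<Phi> at_infinity at_infinity"
proof -
  obtain a :: real where a: "0 < a" "((\<lambda>z. \<Phi> z / z) \<longlongrightarrow> complex_of_real a) at_infinity"
    using ext_map by (auto simp: exterior_conformal_map_def)
  have "filterlim (\<lambda>z. \<Phi> z / z * z) at_infinity at_infinity"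
    by (rule tendsto_mult_filterlim_at_infinity[OF a(2)]) (use a in \<open>auto simp: filterlim_ident\<close>)
  moreover have "\<forall>\<^sub>F z in at_infinity. \<Phi> z / z * z = \<Phi> z"
    using eventually_not_equal_at_infinity[of 0] by eventually_elim simp
  ultimately show ?thesis by (subst (asm) filterlim_cong[OF refl refl])
qed

text \<open>A connectedness argument. A circle \<open>cmod z = M\<close> around \<open>E\<close> has
  compact image under \<open>\<Phi>\<close>, inside some ball of radius \<open>B\<close>. Hence
  \<open>\<Psi>\<close> maps the connected set \<open>B < cmod w\<close> off that circle. Some point
  of this set is mapped outside the circle because \<open>\<Phi>\<close> tends to infinity, so all
  of them are.\<close>

lemma filterlim_\<Psi>: "filterlim \<Psi> at_infinity at_infinity"
  unfolding filterlim_at_infinity[OF order_refl]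
proof (intro allI impI)
  fix M0 :: real assume "0 < M0"
  obtain M1 where M1: "E \<subseteq> ball 0 M1" using bounded_subset_ballD[OF compact_imp_bounded[OF compact_E]] by blast
  define M where "M = max M0 M1"
  have M: "E \<subseteq> ball 0 M" "0 < M" using M1 \<open>0 < M0\<close> by (auto simp: M_def)
  have "compact (\<Phi> ` sphere 0 M)"
    using M by (intro compact_continuous_image holomorphic_on_imp_continuous_on
        holomorphic_on_subset[OF holomorphic_\<Phi>]) auto
  then obtain B where B: "\<Phi> ` sphere 0 M \<subseteq> ball 0 B" "1 < B"
  proof -
    obtain B0 where "\<Phi> ` sphere 0 M \<subseteq> ball 0 B0"
      using bounded_subset_ballD[OF compact_imp_bounded[OF \<open>compact (\<Phi> ` sphere 0 M)\<close>]] by blast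
    then show ?thesis using that[of "max 2 B0"] by (meson less_le_trans max.cobounded1 max.cobounded2 one_less_numeral_iff
        order_trans semiring_norm(76) subset_ball)
  qed
  define X where "X = {w. B < cmod w}"
  have X1: "1 < cmod w" if "w \<in> X" for w using that B by (auto simp: X_def)
  have "X \<inter> \<Psi> -` {z. M < cmod z} \<noteq> {}"
  proof -
    have "\<forall>\<^sub>F z in at_infinity. B < cmod (\<Phi> z) \<and> M < cmod z"
      using filterlim_at_infinity_imp_norm_at_top[OF filterlim_\<Phi>]
        filterlim_at_infinity_imp_norm_at_top[OF filterlim_ident]
      by (auto simp: filterlim_at_top_dense intro: eventually_conj)
    then obtain z where "B < cmod (\<Phi> z)" "M < cmod z"
      using eventually_happens'[OF trivial_limit_at_infinity] by blast
    then have "\<Phi> z \<in> X \<inter> \<Psi> -` {z. M < cmod z}"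
    proof -
      have "z \<notin> E" using M(1) \<open>M < cmod z\<close> by auto
      with \<open>B < cmod (\<Phi> z)\<close> \<open>M < cmod z\<close> show ?thesis by (simp add: X_def \<Psi>_\<Phi>)
    qed
    then show ?thesis by blast
  qed
  moreover have "X \<subseteq> \<Psi> -` {z. M < cmod z} \<union> \<Psi> -` {z. cmod z < M}"
  proof
    fix w assume w: "w \<in> X"
    have "cmod (\<Psi> w) \<noteq> M"
    proof
      assume "cmod (\<Psi> w) = M"
      then have "\<Phi> (\<Psi> w) \<in> ball 0 B" using B(1) by (auto simp: image_subset_iff)
      then show False using w X1[OF w] by (simp add: X_def)
    qed
    then show "w \<in> \<Psi> -` {z. M < cmod z} \<union> \<Psi> -` {z. cmod z < M}" by auto
  qed
  moreover have op: "open (X \<inter> \<Psi> -` T)" if "open T" for T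
  proof -
    have "continuous_on X \<Psi>"
      by (intro holomorphic_on_imp_continuous_on holomorphic_on_subset[OF holomorphic_\<Psi>]) (use X1 in auto)
    then show ?thesis using that open_exterior_disc[of B] unfolding X_def
      by (simp add: continuous_open_preimage)
  qed
  moreover have "open {z. M < cmod z}" "open {z :: complex. cmod z < M}"
    by (intro open_Collect_less continuous_intros)+
  moreover have "connected X" unfolding X_def by (rule connected_exterior_disc)
  moreover have "(X \<inter> \<Psi> -` {z. M < cmod z}) \<inter> (X \<inter> \<Psi> -` {z. cmod z < M}) \<inter> X = {}" by auto
  ultimately have "(X \<inter> \<Psi> -` {z. M < cmod z}) \<inter> X = {} \<or> (X \<inter> \<Psi> -` {z. cmod z < M}) \<inter> X = {}"
    by (intro connectedD op) (assumption | blast)+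
  with \<open>X \<inter> \<Psi> -` {z. M < cmod z} \<noteq> {}\<close> have "X \<inter> \<Psi> -` {z. cmod z < M} = {}" by blast
  then have "M0 \<le> cmod (\<Psi> w)" if "B + 1 \<le> cmod w" for w
  proof -
    have "w \<in> X" using that by (simp add: X_def)
    with \<open>X \<inter> \<Psi> -` {z. cmod z < M} = {}\<close> have "\<not> cmod (\<Psi> w) < M" by blast
    then show ?thesis by (simp add: M_def)
  qed
  then show "\<forall>\<^sub>F w in at_infinity. M0 \<le> cmod (\<Psi> w)"
    unfolding eventually_at_infinity by blast
qed

lemma \<Psi>_over_ident: "\<exists>b::real. 0 < b \<and> ((\<lambda>w. \<Psi> w / w) \<longlongrightarrow> of_real b) at_infinity"
proof -
  obtain a :: real where a: "0 < a" "((\<lambda>z. \<Phi> z / z) \<longlongrightarrow> complex_of_real a) at_infinity"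
    using ext_map by (auto simp: exterior_conformal_map_def)
  have "((\<lambda>w. \<Phi> (\<Psi> w) / \<Psi> w) \<longlongrightarrow> complex_of_real a) at_infinity"
    by (rule filterlim_compose[OF a(2) filterlim_\<Psi>])
  from tendsto_inverse[OF this] have "((\<lambda>w. \<Psi> w / \<Phi> (\<Psi> w)) \<longlongrightarrow> inverse (complex_of_real a)) at_infinity"
    using a by (simp add: inverse_eq_divide)
  moreover have "\<forall>\<^sub>F w in at_infinity. \<Psi> w / \<Phi> (\<Psi> w) = \<Psi> w / w"
    unfolding eventually_at_infinity by (rule exI[of _ 2]) auto
  ultimately have "((\<lambda>w. \<Psi> w / w) \<longlongrightarrow> inverse (complex_of_real a)) at_infinity"
    by (subst (asm) tendsto_cong)
  then show ?thesis using a by (intro exI[of _ "inverse a"]) auto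
qed

lemma in_dom_iff: "z \<notin> E \<Longrightarrow> z \<in> dom \<rho> \<longleftrightarrow> cmod (\<Phi> z) < \<rho>"
  by (auto simp: dom_def)

lemma E_subset_dom: "E \<subseteq> dom \<rho>" by (auto simp: dom_def)

lemma dom_mono: "\<rho> \<le> \<rho>' \<Longrightarrow> dom \<rho> \<subseteq> dom \<rho>'"
  by (auto simp: dom_def)

lemma \<Psi>_in_dom_iff: "1 < cmod w \<Longrightarrow> \<Psi> w \<in> dom \<rho> \<longleftrightarrow> cmod w < \<rho>"
  by (simp add: in_dom_iff)

text \<open>\<open>\<Phi>\<close> need not extend continuously to \<open>E\<close>, so compactness
  does not bound it on a bounded set. Instead, a large value \<open>\<Phi> z\<close> forces a large
  \<open>z = \<Psi> (\<Phi> z)\<close>.\<close>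

lemma bounded_cmod_\<Phi>: "\<exists>B. \<forall>z. z \<notin> E \<longrightarrow> cmod z \<le> M \<longrightarrow> cmod (\<Phi> z) \<le> B"
proof -
  have "0 < max 1 (M + 1)" by simp
  then have "\<forall>\<^sub>F w in at_infinity. max 1 (M + 1) \<le> cmod (\<Psi> w)"
    using filterlim_\<Psi> unfolding filterlim_at_infinity[OF order_refl] by blast
  then obtain B where "\<And>w. B \<le> cmod w \<Longrightarrow> M + 1 \<le> cmod (\<Psi> w)" unfolding eventually_at_infinity by auto
  then show ?thesis by (intro exI[of _ B]) (metis \<Psi>_\<Phi> add_le_same_cancel1 linorder_linear not_one_le_zero order_trans)
qed

text \<open>The point is that the complement does not accumulate at \<open>E\<close>. Its part in a
  ball lies in the image under \<open>\<Psi>\<close> of a compact annulus that keeps away from the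
  unit circle, and is therefore compact.\<close>

lemma closed_Compl_dom:
  assumes "1 < \<rho>" shows "closed (- dom \<rho>)"
proof -
  have "compact (- dom \<rho> \<inter> cball 0 M)" for M
  proof -
    obtain B where B: "\<And>z. z \<notin> E \<Longrightarrow> cmod z \<le> M \<Longrightarrow> cmod (\<Phi> z) \<le> B" using bounded_cmod_\<Phi> by blast
    define A where "A = cball (0 :: complex) B - ball 0 \<rho>"
    have A: "compact A" by (simp add: A_def compact_diff)
    have "A \<subseteq> {w. 1 < cmod w}" using assms by (auto simp: A_def)
    then have "compact (\<Psi> ` A)"
      using A by (intro compact_continuous_image holomorphic_on_imp_continuous_on holomorphic_on_subset[OF holomorphic_\<Psi>])
    moreover have "- dom \<rho> \<inter> cball 0 M = \<Psi> ` A \<inter> cball 0 M"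
    proof (intro set_eqI iffI)
      fix z assume z: "z \<in> - dom \<rho> \<inter> cball 0 M"
      then have "z \<notin> E" "\<rho> \<le> cmod (\<Phi> z)" "cmod z \<le> M" by (auto simp: dom_def)
      then have "\<Phi> z \<in> A" using B by (auto simp: A_def)
      then show "z \<in> \<Psi> ` A \<inter> cball 0 M" using z \<Psi>_\<Phi>[OF \<open>z \<notin> E\<close>] by force
    next
      fix z assume z: "z \<in> \<Psi> ` A \<inter> cball 0 M"
      then obtain w where "z = \<Psi> w" "\<rho> \<le> cmod w" by (auto simp: A_def)
      then show "z \<in> - dom \<rho> \<inter> cball 0 M" using z assms by (auto simp: \<Psi>_in_dom_iff)
    qed
    ultimately show ?thesis by (simp add: compact_Int_closed)
  qed
  then have "open (ball 0 M - (- dom \<rho> \<inter> cball 0 M))" for M by (intro open_Diff compact_imp_closed) auto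
  then have "open (\<Union>M. ball 0 M - (- dom \<rho> \<inter> cball 0 M))" by blast
  also have "(\<Union>M. ball 0 M - (- dom \<rho> \<inter> cball 0 M)) = dom \<rho>"
    by (auto intro: gt_ex)
  finally show ?thesis by (simp add: closed_Compl)
qed

lemma open_dom: "1 < \<rho> \<Longrightarrow> open (dom \<rho>)"
  using closed_Compl_dom by (simp add: closed_def)

lemma bounded_dom: "bounded (dom \<rho>)"
proof -
  have "\<forall>\<^sub>F z in at_infinity. max 1 \<rho> \<le> cmod (\<Phi> z)"
    using filterlim_\<Phi> unfolding filterlim_at_infinity[OF order_refl] by (metis less_numeral_extra(1) max.strict_coboundedI1)
  then obtain B where B: "\<And>z. B \<le> cmod z \<Longrightarrow> \<rho> \<le> cmod (\<Phi> z)" unfolding eventually_at_infinity by auto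
  have "dom \<rho> \<subseteq> E \<union> ball 0 B" using B by (force simp: dom_def not_le[symmetric])
  then show ?thesis using compact_imp_bounded[OF compact_E] bounded_subset bounded_Un bounded_ball by metis
qed

text \<open>The image under \<open>\<Psi>\<close> of the exterior of a disc is connected and
  unbounded; avoiding \<open>S\<close>, it lies in a single component.\<close>

lemma unbounded_component:
  assumes w: "1 \<le> r" "r < cmod w" and S: "\<And>v. r < cmod v \<Longrightarrow> \<Psi> v \<notin> S"
  shows "\<not> bounded (connected_component_set (- S) (\<Psi> w))"
proof
  assume b: "bounded (connected_component_set (- S) (\<Psi> w))"
  have "\<Psi> ` {v. r < cmod v} \<subseteq> connected_component_set (- S) (\<Psi> w)"
  proof (rule connected_component_maximal)
    show "connected (\<Psi> ` {v. r < cmod v})"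
      by (intro connected_continuous_image connected_exterior_disc holomorphic_on_imp_continuous_on
          holomorphic_on_subset[OF holomorphic_\<Psi>]) (use w in auto)
  qed (use w S in auto)
  then obtain B where B: "\<And>v. r < cmod v \<Longrightarrow> cmod (\<Psi> v) \<le> B" "0 < B"
    using bounded_subset[OF b] unfolding bounded_pos by blast
  have "\<forall>\<^sub>F v in at_infinity. B + 1 \<le> cmod (\<Psi> v)"
    using filterlim_\<Psi> B(2) unfolding filterlim_at_infinity[OF order_refl] by auto
  moreover have "\<forall>\<^sub>F v :: complex in at_infinity. r < cmod v"
    unfolding eventually_at_infinity by (intro exI[of _ "r + 1"]) auto
  ultimately have "\<forall>\<^sub>F v :: complex in at_infinity. False"
    by eventually_elim (use B(1) in fastforce)
  then have "\<exists>v::complex. False" by (rule eventually_happens'[OF trivial_limit_at_infinity])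
  then show False by simp
qed

lemma open_exterior_level: "open {z \<in> - E. r < cmod (\<Phi> z)}"
proof -
  have "open ((- E) \<inter> \<Phi> -` {w. r < cmod w})"
    by (rule continuous_open_preimage[OF holomorphic_on_imp_continuous_on[OF holomorphic_\<Phi>] open_Compl_E open_exterior_disc])
  also have "(- E) \<inter> \<Phi> -` {w. r < cmod w} = {z \<in> - E. r < cmod (\<Phi> z)}" by auto
  finally show ?thesis .
qed

text \<open>The level curve separates the plane into the disjoint open sets
  \<open>dom \<rho>\<close> and \<open>\<rho> < cmod (\<Phi> z)\<close>. A component meeting the
  first stays in that bounded set, and every point of the second lies in an unbounded
  component.\<close>

lemma canonical_domain_eq_dom:
  assumes "1 < \<rho>" shows "canonical_domain E \<Phi> \<rho> = dom \<rho>"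
proof -
  define L where "L = level_curve E \<Phi> \<rho>"
  have 1: "z \<in> dom \<rho>" if z: "z \<notin> L" "bounded (connected_component_set (- L) z)" for z
  proof (rule ccontr)
    assume "z \<notin> dom \<rho>"
    then have "z \<notin> E" "\<rho> < cmod (\<Phi> z)" using z(1) by (auto simp: dom_def L_def level_curve_def)
    moreover have "\<Psi> v \<notin> L" if "\<rho> < cmod v" for v using that assms by (auto simp: L_def level_curve_def)
    ultimately show False using unbounded_component[of \<rho> "\<Phi> z" L] assms z(2) by (simp add: \<Psi>_\<Phi>)
  qed
  have 2: "z \<notin> L \<and> bounded (connected_component_set (- L) z)" if z: "z \<in> dom \<rho>" for z
  proof -
    define C where "C = connected_component_set (- L) z"
    define X where "X = {z \<in> - E. \<rho> < cmod (\<Phi> z)}"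
    have zL: "z \<notin> L" using z by (auto simp: dom_def L_def level_curve_def)
    have "open X" unfolding X_def by (rule open_exterior_level)
    moreover have "C \<subseteq> - L" unfolding C_def by (rule connected_component_subset)
    moreover have "connected C" unfolding C_def by (rule connected_connected_component)
    moreover have *: "- L \<subseteq> dom \<rho> \<union> X" "dom \<rho> \<inter> X = {}" by (auto simp: dom_def L_def level_curve_def X_def)
    ultimately have "dom \<rho> \<inter> C = {} \<or> X \<inter> C = {}"
      using connectedD[of C "dom \<rho>" X] open_dom[OF assms] by blast
    moreover have "z \<in> C" using zL by (simp add: C_def connected_component_refl)
    ultimately have "C \<inter> X = {}" using z by blast
    then have "C \<subseteq> dom \<rho>" using \<open>C \<subseteq> - L\<close> *(1) by blast
    then show ?thesis
      using zL bounded_subset[OF bounded_dom] unfolding C_def by blast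
  qed
  show ?thesis using 1 2 unfolding canonical_domain_def inside_def L_def[symmetric] by blast
qed

text \<open>Provides a first canonical domain on which \<open>F\<close> is holomorphic. On the
  compact part of a large ball outside \<open>U\<close> the function
  \<open>cmod \<circ> \<Phi>\<close> attains a minimum, and this minimum exceeds 1.\<close>

lemma dom_subset_nbhd:
  assumes "open U" "E \<subseteq> U"
  shows "\<exists>\<rho>>1. dom \<rho> \<subseteq> U"
proof -
  obtain B where B: "dom 2 \<subseteq> cball 0 B" using bounded_subset_ballD[OF bounded_dom[of 2]] ball_subset_cball by blast
  define K where "K = cball 0 B - U"
  have K: "compact K" unfolding K_def using assms by (intro compact_diff) auto
  have KE: "z \<notin> E" if "z \<in> K" for z using that assms by (auto simp: K_def)
  show ?thesis
  proof (cases "K = {}")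
    case True
    then show ?thesis using B by (intro exI[of _ 2]) (auto simp: K_def)
  next
    case False
    have "continuous_on K (\<lambda>z. cmod (\<Phi> z))"
      by (intro continuous_on_norm holomorphic_on_imp_continuous_on holomorphic_on_subset[OF holomorphic_\<Phi>])
         (use KE in auto)
    then obtain z0 where z0: "z0 \<in> K" "\<And>z. z \<in> K \<Longrightarrow> cmod (\<Phi> z0) \<le> cmod (\<Phi> z)"
      using continuous_attains_inf[OF K False] by blast
    define \<rho> where "\<rho> = min 2 (cmod (\<Phi> z0))"
    have "dom \<rho> \<subseteq> U"
    proof
      fix z assume z: "z \<in> dom \<rho>"
      show "z \<in> U"
      proof (rule ccontr)
        assume "z \<notin> U"
        moreover have "z \<in> cball 0 B" using z dom_mono[of \<rho> 2] B by (auto simp: \<rho>_def)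
        ultimately have "z \<in> K" by (simp add: K_def)
        then show False using z z0(2)[of z] KE[of z] by (auto simp: in_dom_iff \<rho>_def)
      qed
    qed
    moreover have "\<rho> > 1" using cmod_\<Phi>_gt_1[OF KE[OF z0(1)]] by (simp add: \<rho>_def)
    ultimately show ?thesis by blast
  qed
qed

end

section \<open>Level curves as contours: winding numbers and Cauchy's formula\<close>

lemma homotopic_loops_circlepath:
  assumes "0 < r" "r \<le> R" "cball 0 R - ball 0 r \<subseteq> S"
  shows "homotopic_loops S (circlepath 0 r) (circlepath 0 R)"
proof (rule homotopic_loops_linear)
  fix t :: real assume "t \<in> {0..1}"
  show "closed_segment (circlepath 0 r t) (circlepath 0 R t) \<subseteq> S"
  proof
    fix z assume "z \<in> closed_segment (circlepath 0 r t) (circlepath 0 R t)"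
    then obtain u where u: "0 \<le> u" "u \<le> 1" "z = (1 - u) *\<^sub>R circlepath 0 r t + u *\<^sub>R circlepath 0 R t"
      by (auto simp: in_segment)
    define q where "q = (1 - u) * r + u * R"
    have "z = of_real q * exp (2 * of_real pi * \<i> * of_real t)"
      by (simp add: u(3) circlepath scaleR_conv_of_real q_def algebra_simps)
    then have "cmod z = \<bar>q\<bar>" by (simp add: norm_mult)
    moreover have "r \<le> q" "q \<le> R"
      using u(1,2) assms mult_left_mono[of r R u] mult_left_mono[of r R "1 - u"] by (auto simp: q_def algebra_simps)
    ultimately show "z \<in> S" using assms by auto
  qed
qed auto

context exterior_map
begin

lemma continuous_on_\<Psi>: "1 < r \<Longrightarrow> continuous_on {w. r \<le> cmod w} \<Psi>"
  by (intro holomorphic_on_imp_continuous_on holomorphic_on_subset[OF holomorphic_\<Psi>]) auto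

lemma valid_path_\<Psi>_circlepath:
  assumes "1 < r"
  shows "valid_path (\<Psi> \<circ> circlepath 0 r)"
    and "pathfinish (\<Psi> \<circ> circlepath 0 r) = pathstart (\<Psi> \<circ> circlepath 0 r)"
    and "path_image (\<Psi> \<circ> circlepath 0 r) = \<Psi> ` sphere 0 r"
proof -
  show "valid_path (\<Psi> \<circ> circlepath 0 r)"
    by (rule valid_path_compose_holomorphic[OF _ holomorphic_\<Psi> open_exterior_disc]) (use assms in auto)
  show "path_image (\<Psi> \<circ> circlepath 0 r) = \<Psi> ` sphere 0 r"
    using assms by (simp add: path_image_compose)
qed (simp add: pathfinish_compose pathstart_compose)

text \<open>Enlarging the circle is a homotopy in the complement of \<open>z\<close>. For a large
  radius \<open>R\<close> the curve is so close to the circle of radius \<open>b * R\<close> that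
  the winding numbers agree.\<close>

lemma winding_number_\<Psi>_circlepath_eq_1:
  assumes r: "1 < r" and z: "z \<in> dom r"
  shows "winding_number (\<Psi> \<circ> circlepath 0 r) z = 1"
proof -
  obtain b :: real where b: "0 < b" "((\<lambda>w. \<Psi> w / w) \<longlongrightarrow> of_real b) at_infinity" using \<Psi>_over_ident by blast
  have "\<forall>\<^sub>F w in at_infinity. dist (\<Psi> w / w) (of_real b) < b / 2"
    using tendstoD[OF b(2), of "b / 2"] b by simp
  then obtain B where B: "\<And>w. B \<le> cmod w \<Longrightarrow> dist (\<Psi> w / w) (of_real b) < b / 2"
    unfolding eventually_at_infinity by auto
  \<comment> \<open>The last entry gives \<open>2 * cmod z < b * R\<close>, so the deviation from
    \<open>of_real b * w\<close>, which is below \<open>b * R / 2\<close>, is smaller than the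
    distance of \<open>of_real b * w\<close> from \<open>z\<close>.\<close>
  define R where "R = max (max r B) (2 * cmod z / b + 1)"
  have R: "r \<le> R" "B \<le> R" "2 * cmod z / b < R" "0 < R" using r by (auto simp: R_def)
  have zR: "2 * cmod z < b * R" using R(3) b by (simp add: field_simps)
  then have zR': "cmod z < b * R" using norm_ge_zero[of z] by linarith
  have "winding_number (\<Psi> \<circ> circlepath 0 r) z = winding_number (\<Psi> \<circ> circlepath 0 R) z"
  proof (rule winding_number_homotopic_loops, rule homotopic_loops_continuous_image)
    show "homotopic_loops {w. r \<le> cmod w} (circlepath 0 r) (circlepath 0 R)"
      by (rule homotopic_loops_circlepath) (use r R in auto)
    show "\<Psi> \<in> {w. r \<le> cmod w} \<rightarrow> - {z}" using z r \<Psi>_in_dom_iff by force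
  qed (rule continuous_on_\<Psi>[OF r])
  also have "\<dots> = winding_number (circlepath 0 (b * R)) z"
  proof (rule winding_number_nearby_loops_eq)
    fix t :: real assume "t \<in> {0..1}"
    define w where "w = circlepath 0 R t"
    have w: "cmod w = R" using R by (simp add: w_def circlepath norm_mult)
    have bw: "circlepath 0 (b * R) t = of_real b * w" by (simp add: w_def circlepath)
    have "w \<noteq> 0" using w R by auto
    have "\<Psi> w - of_real b * w = (\<Psi> w / w - of_real b) * w" using \<open>w \<noteq> 0\<close> by (simp add: field_simps)
    then have "cmod (\<Psi> w - of_real b * w) = cmod (\<Psi> w / w - of_real b) * R" by (simp add: norm_mult w)
    also have "\<dots> < b / 2 * R" using B[of w] R by (simp add: dist_norm w)
    also have "\<dots> < b * R - cmod z" using zR by (simp add: field_simps)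
    also have "\<dots> \<le> cmod (of_real b * w - z)" using norm_triangle_ineq2[of "of_real b * w" z] b by (simp add: norm_mult w)
    finally show "cmod ((\<Psi> \<circ> circlepath 0 R) t - circlepath 0 (b * R) t) < cmod (circlepath 0 (b * R) t - z)"
      by (simp add: bw w_def)
  qed (use valid_path_\<Psi>_circlepath[of R] r R in \<open>auto intro: valid_path_imp_path\<close>)
  also have "\<dots> = 1" by (rule winding_number_circlepath) (use zR' in simp)
  finally show ?thesis .
qed

text \<open>Such a point is connected to infinity through values of \<open>\<Psi>\<close> at
  arguments of modulus above \<open>r\<close>, which injectivity keeps off the curve.\<close>

lemma winding_number_\<Psi>_circlepath_eq_0:
  assumes r: "1 < r" and z: "z \<notin> dom \<rho>" "r < \<rho>"
  shows "winding_number (\<Psi> \<circ> circlepath 0 r) z = 0"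
proof (rule winding_number_zero_in_outside)
  have zE: "z \<notin> E" "\<rho> \<le> cmod (\<Phi> z)" using z by (auto simp: dom_def)
  have "\<Psi> v \<notin> \<Psi> ` sphere 0 r" if "r < cmod v" for v
  proof
    assume "\<Psi> v \<in> \<Psi> ` sphere 0 r"
    then obtain v' where "\<Psi> v = \<Psi> v'" "v' \<in> sphere 0 r" by (rule imageE)
    then have "cmod v' = r" by simp
    have "1 < cmod v" "1 < cmod v'" using that r \<open>cmod v' = r\<close> by linarith+
    then have "v = v'" using \<Phi>_\<Psi> \<open>\<Psi> v = \<Psi> v'\<close> by metis
    then show False using that \<open>cmod v' = r\<close> by simp
  qed
  then have "\<not> bounded (connected_component_set (- \<Psi> ` sphere 0 r) (\<Psi> (\<Phi> z)))"
    by (intro unbounded_component[of r]) (use r zE z(2) in auto)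
  moreover have "z \<notin> \<Psi> ` sphere 0 r" using zE z(2) r by auto
  ultimately show "z \<in> outside (path_image (\<Psi> \<circ> circlepath 0 r))"
    using zE by (simp add: outside_def valid_path_\<Psi>_circlepath(3)[OF r] \<Psi>_\<Phi>)
qed (use valid_path_\<Psi>_circlepath[OF r] in \<open>auto intro: valid_path_imp_path\<close>)

lemma Cauchy_formula_dom:
  assumes g: "g holomorphic_on dom \<rho>" and r: "1 < r" "r < \<rho>" and z: "z \<in> dom r"
  shows "((\<lambda>t. g t / (t - z)) has_contour_integral 2 * pi * \<i> * g z) (\<Psi> \<circ> circlepath 0 r)"
proof -
  have "((\<lambda>t. g t / (t - z)) has_contour_integral
      2 * pi * \<i> * winding_number (\<Psi> \<circ> circlepath 0 r) z * g z) (\<Psi> \<circ> circlepath 0 r)"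
  proof (rule Cauchy_integral_formula_global[OF _ g])
    show "open (dom \<rho>)" using r by (intro open_dom) simp
    show "z \<in> dom \<rho>" using z dom_mono[of r \<rho>] r by auto
    show "path_image (\<Psi> \<circ> circlepath 0 r) \<subseteq> dom \<rho> - {z}"
      using r z by (auto simp: valid_path_\<Psi>_circlepath \<Psi>_in_dom_iff)
  qed (use r winding_number_\<Psi>_circlepath_eq_0 valid_path_\<Psi>_circlepath in auto)
  then show ?thesis using winding_number_\<Psi>_circlepath_eq_1[OF r(1) z] by simp
qed

end

section \<open>Orthonormal polynomials\<close>

locale compact_carrier_measure =
  fixes E :: "complex set" and \<mu> :: "complex measure"
  assumes compact_carrier: "compact E" and sets_\<mu>: "sets \<mu> = sets borel" and finite_\<mu>: "finite_measure \<mu>"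
begin

lemma set_integrable_continuous:
  fixes f :: "complex \<Rightarrow> 'a :: {banach, second_countable_topology}"
  assumes f: "continuous_on E f"
  shows "set_integrable \<mu> E f"
proof -
  interpret finite_measure \<mu> by (rule finite_\<mu>)
  obtain B where B: "\<And>z. z \<in> E \<Longrightarrow> norm (f z) \<le> B"
    using compact_imp_bounded[OF compact_continuous_image[OF f compact_carrier]] unfolding bounded_iff by auto
  have "(\<lambda>x. indicator E x *\<^sub>R f x) \<in> borel_measurable borel"
    by (rule borel_measurable_continuous_on_indicator[OF borel_compact[OF compact_carrier] f])
  then have m: "(\<lambda>x. indicator E x *\<^sub>R f x) \<in> borel_measurable \<mu>"
    using sets_\<mu> by (simp cong: measurable_cong_sets)
  show ?thesis unfolding set_integrable_def
  proof (rule integrable_const_bound[OF _ m])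
    show "AE x in \<mu>. norm (indicator E x *\<^sub>R f x) \<le> max B 0"
      using B by (intro AE_I2) (auto simp: indicator_def le_max_iff_disj)
  qed
qed

lemma inner_product_sum_left:
  assumes "finite A" "\<And>i. i \<in> A \<Longrightarrow> continuous_on E (g i)" "continuous_on E h"
  shows "inner_product E \<mu> (\<lambda>z. \<Sum>i\<in>A. b i * g i z) h = (\<Sum>i\<in>A. b i * inner_product E \<mu> (g i) h)"
proof -
  have int: "set_integrable \<mu> E (\<lambda>z. b i * (g i z * cnj (h z)))" if "i \<in> A" for i
    using that assms by (intro set_integrable_continuous continuous_intros) auto
  have "inner_product E \<mu> (\<lambda>z. \<Sum>i\<in>A. b i * g i z) h = (LINT z:E|\<mu>. \<Sum>i\<in>A. b i * (g i z * cnj (h z)))"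
    by (simp add: inner_product_def sum_distrib_right mult.assoc)
  also have "\<dots> = (\<Sum>i\<in>A. LINT z:E|\<mu>. b i * (g i z * cnj (h z)))"
    using int unfolding set_lebesgue_integral_def set_integrable_def scaleR_sum_right
    by (rule Bochner_Integration.integral_sum)
  finally show ?thesis by (simp add: inner_product_def)
qed

lemma inner_product_diff_left:
  assumes "continuous_on E f" "continuous_on E g" "continuous_on E h"
  shows "inner_product E \<mu> (\<lambda>z. f z - g z) h = inner_product E \<mu> f h - inner_product E \<mu> g h"
  unfolding inner_product_def left_diff_distrib
  by (intro set_integral_diff set_integrable_continuous continuous_intros assms)

lemma inner_product_cong:
  "(\<And>z. z \<in> E \<Longrightarrow> f z = g z) \<Longrightarrow> inner_product E \<mu> f h = inner_product E \<mu> g h"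
  unfolding inner_product_def set_lebesgue_integral_def
  by (intro Bochner_Integration.integral_cong) (auto simp: indicator_def)

lemma inner_product_commute:
  "inner_product E \<mu> h g = cnj (inner_product E \<mu> g h)"
proof -
  have "cnj (inner_product E \<mu> g h) = integral\<^sup>L \<mu> (\<lambda>z. cnj (indicator E z *\<^sub>R (g z * cnj (h z))))"
    unfolding inner_product_def set_lebesgue_integral_def by (rule Bochner_Integration.integral_cnj[symmetric])
  also have "\<dots> = inner_product E \<mu> h g"
    unfolding inner_product_def set_lebesgue_integral_def
    by (intro Bochner_Integration.integral_cong) (auto simp: indicator_def)
  finally show ?thesis by simp
qed

end

locale orthonormal_system = compact_carrier_measure +
  fixes p :: "nat \<Rightarrow> complex poly"
  assumes orthonormal: "orthonormal_polynomials E \<mu> p"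
begin

lemma degree_p: "degree (p n) = n"
  and lead_coeff_p: "\<exists>\<kappa>::real. 0 < \<kappa> \<and> lead_coeff (p n) = of_real \<kappa>"
  and inner_product_p: "inner_product E \<mu> (poly (p m)) (poly (p n)) = (if m = n then 1 else 0)"
  using orthonormal unfolding orthonormal_polynomials_def by blast+

text \<open>Eliminating leading coefficients gives some expansion in the \<open>p k\<close>;
  orthonormality then identifies its coefficients.\<close>

lemma poly_expansion:
  assumes "degree q < n"
  shows "q = (\<Sum>k<n. smult (inner_product E \<mu> (poly q) (poly (p k))) (p k))"
proof -
  have ex: "\<exists>b. q = (\<Sum>k<n. smult (b k) (p k))" if "degree q < n" for n and q :: "complex poly"
    using that
  proof (induction n arbitrary: q)
    case (Suc n)
    define r where "r = q - smult (coeff q n / lead_coeff (p n)) (p n)"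
    have ln: "lead_coeff (p n) \<noteq> 0" using lead_coeff_p[of n] by auto
    have "coeff r i = 0" if "i \<ge> n" for i
    proof (cases "i = n")
      case True
      then show ?thesis using ln by (simp add: r_def degree_p)
    next
      case False
      then have "degree q < i" "degree (p n) < i" using that Suc.prems by (auto simp: degree_p)
      then show ?thesis by (simp add: r_def coeff_eq_0)
    qed
    then have "r = 0 \<or> degree r < n" by (metis leading_coeff_0_iff linorder_not_le)
    then have "\<exists>b. r = (\<Sum>k<n. smult (b k) (p k))"
    proof
      assume "r = 0"
      then show ?thesis by (intro exI[of _ "\<lambda>_. 0"]) simp
    qed (rule Suc.IH)
    then obtain b where b: "r = (\<Sum>k<n. smult (b k) (p k))" by blast
    have "q = r + smult (coeff q n / lead_coeff (p n)) (p n)" by (simp add: r_def)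
    also have "\<dots> = (\<Sum>k<Suc n. smult ((b(n := coeff q n / lead_coeff (p n))) k) (p k))"
      by (simp add: b)
    finally show ?case by (intro exI[of _ "b(n := coeff q n / lead_coeff (p n))"])
  qed simp
  then obtain b where b: "q = (\<Sum>k<n. smult (b k) (p k))" using assms by blast
  have "inner_product E \<mu> (poly q) (poly (p k)) = b k" if "k < n" for k
  proof -
    have "inner_product E \<mu> (poly q) (poly (p k)) = inner_product E \<mu> (\<lambda>z. \<Sum>i\<in>{..<n}. b i * poly (p i) z) (poly (p k))"
    proof -
      have "poly q = (\<lambda>z. \<Sum>i\<in>{..<n}. b i * poly (p i) z)" by (rule ext, subst b) (simp add: poly_sum)
      then show ?thesis by simp
    qed
    also have "\<dots> = (\<Sum>i<n. b i * inner_product E \<mu> (poly (p i)) (poly (p k)))"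
      by (intro inner_product_sum_left continuous_intros) auto
    also have "\<dots> = b k" using that by (simp add: inner_product_p if_distrib sum.delta cong: if_cong)
    finally show ?thesis .
  qed
  then show ?thesis by (subst b) simp
qed

text \<open>Only the case of Cauchy-Schwarz with two unit vectors is required, and there
  \<open>a * b \<le> (a\<^sup>2 + b\<^sup>2) / 2\<close> suffices.\<close>

lemma norm_inner_product_le:
  assumes g: "continuous_on E g" and K: "0 \<le> K" and le: "\<And>z. z \<in> E \<Longrightarrow> cmod (g z) \<le> K * cmod (poly (p m) z)"
  shows "cmod (inner_product E \<mu> g (poly (p k))) \<le> K"
proof -
  have int1: "set_integrable \<mu> E (\<lambda>z. (cmod (poly (p i) z))\<^sup>2)" for i
    by (intro set_integrable_continuous continuous_intros)
  have sq: "(LINT z:E|\<mu>. (cmod (poly (p i) z))\<^sup>2) = 1" for i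
  proof -
    have "complex_of_real (LINT z:E|\<mu>. (cmod (poly (p i) z))\<^sup>2) = inner_product E \<mu> (poly (p i)) (poly (p i))"
      unfolding inner_product_def complex_norm_square[symmetric] by (rule set_integral_complex_of_real[symmetric])
    then show ?thesis by (simp add: inner_product_p)
  qed
  have "cmod (inner_product E \<mu> g (poly (p k))) \<le> (LINT z:E|\<mu>. cmod (g z * cnj (poly (p k) z)))"
    unfolding inner_product_def
    by (intro set_integral_norm_bound set_integrable_continuous continuous_intros g)
  also have "\<dots> \<le> (LINT z:E|\<mu>. K / 2 * ((cmod (poly (p m) z))\<^sup>2 + (cmod (poly (p k) z))\<^sup>2))"
  proof (rule set_integral_mono)
    fix z assume z: "z \<in> E"
    have "cmod (g z * cnj (poly (p k) z)) \<le> K * (cmod (poly (p m) z) * cmod (poly (p k) z))"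
      using mult_right_mono[OF le[OF z], of "cmod (poly (p k) z)"] by (simp add: norm_mult mult.assoc)
    also have "cmod (poly (p m) z) * cmod (poly (p k) z) \<le> ((cmod (poly (p m) z))\<^sup>2 + (cmod (poly (p k) z))\<^sup>2) / 2"
      using sum_squares_bound[of "cmod (poly (p m) z)" "cmod (poly (p k) z)"] by simp
    finally show "cmod (g z * cnj (poly (p k) z)) \<le> K / 2 * ((cmod (poly (p m) z))\<^sup>2 + (cmod (poly (p k) z))\<^sup>2)"
      using K by (simp add: mult_left_mono)
  qed (intro set_integrable_continuous continuous_intros g)+
  also have "\<dots> = K / 2 * ((LINT z:E|\<mu>. (cmod (poly (p m) z))\<^sup>2) + (LINT z:E|\<mu>. (cmod (poly (p k) z))\<^sup>2))"
    by (simp add: set_integral_add int1)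
  finally show ?thesis by (simp add: sq)
qed

lemma inner_product_poly_eq_0:
  assumes "degree q < n"
  shows "inner_product E \<mu> (poly q) (poly (p n)) = 0"
proof -
  define b where "b k = inner_product E \<mu> (poly q) (poly (p k))" for k
  have "poly q = (\<lambda>z. \<Sum>k\<in>{..<n}. b k * poly (p k) z)"
    by (rule ext, subst poly_expansion[OF assms]) (simp add: poly_sum b_def)
  then have "inner_product E \<mu> (poly q) (poly (p n)) = (\<Sum>k<n. b k * inner_product E \<mu> (poly (p k)) (poly (p n)))"
    by (simp only:) (intro inner_product_sum_left continuous_intros, auto)
  also have "\<dots> = 0" by (intro sum.neutral) (auto simp: inner_product_p)
  finally show ?thesis .
qed

end

text \<open>Identifies the polynomials hidden in the existential quantifier of
  \<open>szego_class\<close> with the given ones. Orthogonality makes \<open>p' n\<close> a multiple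
  of \<open>p n\<close>, the norm makes the factor unimodular, and the leading coefficients make it
  positive.\<close>

lemma orthonormal_polynomials_unique:
  assumes "compact E" "sets \<mu> = sets borel" "finite_measure \<mu>"
    and p: "orthonormal_polynomials E \<mu> p" and p': "orthonormal_polynomials E \<mu> p'"
  shows "p n = p' n"
proof -
  interpret P: orthonormal_system E \<mu> p
    by (intro orthonormal_system.intro compact_carrier_measure.intro orthonormal_system_axioms.intro assms)
  interpret P': orthonormal_system E \<mu> p'
    by (intro orthonormal_system.intro compact_carrier_measure.intro orthonormal_system_axioms.intro assms)
  have orth: "inner_product E \<mu> (poly (p' n)) (poly (p k)) = 0" if "k < n" for k
    using P'.inner_product_poly_eq_0[of "p k" n] that P.inner_product_commute[of "poly (p' n)" "poly (p k)"]
    by (simp add: P.degree_p)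
  define l where "l = inner_product E \<mu> (poly (p' n)) (poly (p n))"
  have eq: "p' n = smult l (p n)"
    using P.poly_expansion[of "p' n" "Suc n"] by (simp add: P'.degree_p orth l_def)
  obtain \<kappa> \<kappa>' :: real where k: "0 < \<kappa>" "lead_coeff (p n) = of_real \<kappa>" "0 < \<kappa>'" "lead_coeff (p' n) = of_real \<kappa>'"
    using P.lead_coeff_p[of n] P'.lead_coeff_p[of n] by blast
  have "of_real \<kappa>' = l * of_real \<kappa>" using k eq by (metis lead_coeff_smult)
  then have l: "l = of_real (\<kappa>' / \<kappa>)" using k by (simp add: field_simps)
  have "inner_product E \<mu> (poly (p' n)) (poly (p' n)) = inner_product E \<mu> (\<lambda>z. \<Sum>i\<in>{n}. l * poly (p i) z) (poly (p' n))"
    by (rule P.inner_product_cong) (simp add: eq)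
  also have "\<dots> = (\<Sum>i\<in>{n}. l * inner_product E \<mu> (poly (p i)) (poly (p' n)))"
    by (intro P.inner_product_sum_left continuous_intros) auto
  also have "inner_product E \<mu> (poly (p i)) (poly (p' n)) = cnj l" if "i = n" for i
    unfolding l_def that by (rule P.inner_product_commute)
  then have "(\<Sum>i\<in>{n}. l * inner_product E \<mu> (poly (p i)) (poly (p' n))) = l * cnj l" by simp
  finally have "l * cnj l = 1" by (simp add: P'.inner_product_p)
  then have "(\<kappa>' / \<kappa>)\<^sup>2 = 1"
    unfolding l complex_cnj_complex_of_real of_real_mult[symmetric] of_real_eq_1_iff power2_eq_square .
  moreover have "\<kappa>' / \<kappa> > 0" using k by simp
  ultimately have "\<kappa>' / \<kappa> = 1" unfolding power2_eq_1_iff by linarith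
  then show ?thesis using eq l by simp
qed

section \<open>Expansions with respect to measures with Szego asymptotics\<close>

context exterior_map
begin

text \<open>The constant depends on the radius only, so it serves for a whole sequence of
  integrands. It comes from the maximal speed of the curve.\<close>

lemma \<Psi>_circlepath_integral_bound:
  assumes r: "1 < r"
  obtains L where "0 \<le> L"
    "\<And>f i B. (f has_contour_integral i) (\<Psi> \<circ> circlepath 0 r) \<Longrightarrow> 0 \<le> B \<Longrightarrow>
      (\<And>w. cmod w = r \<Longrightarrow> cmod (f (\<Psi> w)) \<le> B) \<Longrightarrow> cmod i \<le> B * L"
proof -
  have "continuous_on (sphere 0 r) (deriv \<Psi>)"
    by (intro holomorphic_on_imp_continuous_on holomorphic_on_subset[OF holomorphic_deriv[OF holomorphic_\<Psi> open_exterior_disc]])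
       (use r in auto)
  from compact_imp_bounded[OF compact_continuous_image[OF this compact_sphere]]
  obtain M where M: "0 < M" "\<And>w. cmod w = r \<Longrightarrow> cmod (deriv \<Psi> w) \<le> M" unfolding bounded_pos by auto
  have vd: "cmod (vector_derivative (\<Psi> \<circ> circlepath 0 r) (at t)) \<le> 2 * pi * r * M" for t
  proof -
    have n: "cmod (circlepath 0 r t) = r" using r by (simp add: circlepath norm_mult)
    have "vector_derivative (\<Psi> \<circ> circlepath 0 r) (at t) = vector_derivative (circlepath 0 r) (at t) * deriv \<Psi> (circlepath 0 r t)"
    proof (rule vector_derivative_chain_at_general)
      show "circlepath 0 r differentiable at t"
        using has_vector_derivative_circlepath differentiableI_vector by blast
      show "\<Psi> field_differentiable at (circlepath 0 r t)"
        by (rule holomorphic_on_imp_differentiable_at[OF holomorphic_\<Psi> open_exterior_disc]) (use n r in simp)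
    qed
    then have "cmod (vector_derivative (\<Psi> \<circ> circlepath 0 r) (at t)) = 2 * pi * r * cmod (deriv \<Psi> (circlepath 0 r t))"
      using r by (simp add: norm_mult vector_derivative_circlepath)
    also have "\<dots> \<le> 2 * pi * r * M" using M(2)[OF n] r by (intro mult_left_mono) auto
    finally show ?thesis .
  qed
  show ?thesis
  proof (rule that)
    show "0 \<le> 2 * pi * r * M" using r M by simp
    fix f i B assume f: "(f has_contour_integral i) (\<Psi> \<circ> circlepath 0 r)" and B: "0 \<le> B"
      and le: "\<And>w. cmod w = r \<Longrightarrow> cmod (f (\<Psi> w)) \<le> B"
    have 1: "((\<lambda>x. f ((\<Psi> \<circ> circlepath 0 r) x) * vector_derivative (\<Psi> \<circ> circlepath 0 r) (at x)) has_integral i) (cbox 0 1)"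
        using f unfolding has_contour_integral by simp
    have 2: "cmod (f ((\<Psi> \<circ> circlepath 0 r) t) * vector_derivative (\<Psi> \<circ> circlepath 0 r) (at t)) \<le> B * (2 * pi * r * M)" for t
    proof -
      have "cmod (circlepath 0 r t) = r" using r by (simp add: circlepath norm_mult)
      from mult_mono[OF le[OF this] vd[of t] B] show ?thesis unfolding norm_mult by simp
    qed
    have "0 \<le> B * (2 * pi * r * M)" using B r M by simp
    from has_integral_bound[OF this 1 2] show "cmod i \<le> B * (2 * pi * r * M)" by simp
  qed
qed

end

locale szego_measure = exterior_map E \<Phi> \<Psi> + orthonormal_system E \<mu> p
  for E :: "complex set" and \<Phi> \<Psi> :: "complex \<Rightarrow> complex" and \<mu> :: "complex measure" and p :: "nat \<Rightarrow> complex poly" +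
  fixes c :: "nat \<Rightarrow> real" and S :: "complex option \<Rightarrow> complex"
  assumes c_pos: "\<And>n. 0 < c n"
    and holomorphic_S: "sphere_holomorphic_on S (- Some ` E)"
    and S_nonzero: "\<And>x. x \<in> - Some ` E \<Longrightarrow> S x \<noteq> 0"
    and asymptotics: "\<And>K. compactin riemann_sphere K \<Longrightarrow> K \<subseteq> - Some ` E \<Longrightarrow>
        uniform_limit K (\<lambda>n. extend_to_infinity (\<lambda>z. poly (p n) z / (complex_of_real (c n) * \<Phi> z ^ n)))
          S sequentially"
    and c_ratio: "(\<lambda>n. c n / c (Suc n)) \<longlonglongrightarrow> 1"
begin

section \<open>The Szego function and the normalised polynomials in the exterior disc\<close>

definition S\<Psi> :: "complex \<Rightarrow> complex" where
  "S\<Psi> w = S (Some (\<Psi> w))"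

lemma holomorphic_S_Some: "(\<lambda>z. S (Some z)) holomorphic_on (- E)"
proof -
  have "Some -` (- Some ` E) = - E" by auto
  then show ?thesis using holomorphic_S by (simp add: sphere_holomorphic_on_def o_def)
qed

lemma holomorphic_S\<Psi>: "S\<Psi> holomorphic_on {w. 1 < cmod w}"
  unfolding S\<Psi>_def
  by (rule holomorphic_on_compose_gen[OF holomorphic_\<Psi> holomorphic_S_Some, unfolded o_def]) auto

lemma S\<Psi>_nonzero: "1 < cmod w \<Longrightarrow> S\<Psi> w \<noteq> 0"
  unfolding S\<Psi>_def by (intro S_nonzero) auto

text \<open>Continuity of \<open>S\<close> in the chart at infinity. As \<open>S None\<close> is
  nonzero, this bounds \<open>S\<Psi>\<close> away from 0 near infinity, which controls the growth
  of \<open>P k\<close> there.\<close>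

lemma S\<Psi>_at_infinity: "(S\<Psi> \<longlongrightarrow> S None) at_infinity"
proof -
  define X where "X = chart_at_infinity -` (- Some ` E)"
  obtain B where B: "E \<subseteq> ball 0 B" "0 < B"
    using bounded_subset_ballD[OF compact_imp_bounded[OF compact_E], of 0] by auto
  have sub: "ball 0 (1 / B) \<subseteq> X"
  proof
    fix z :: complex assume z: "z \<in> ball 0 (1 / B)"
    have "inverse z \<notin> E" if "z \<noteq> 0"
    proof
      assume "inverse z \<in> E"
      then have "cmod (inverse z) < B" using B by auto
      then show False using z that B by (simp add: norm_divide inverse_eq_divide field_simps)
    qed
    then show "z \<in> X" by (auto simp: X_def chart_at_infinity_def)
  qed
  have "continuous_on X (S \<circ> chart_at_infinity)"
    using holomorphic_S unfolding sphere_holomorphic_on_def X_def by (intro holomorphic_on_imp_continuous_on) auto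
  then have "continuous_on (ball 0 (1 / B)) (S \<circ> chart_at_infinity)" by (rule continuous_on_subset[OF _ sub])
  then have "isCont (S \<circ> chart_at_infinity) 0"
    by (rule continuous_on_interior) (use B(2) in simp)
  then have "((S \<circ> chart_at_infinity) \<longlongrightarrow> (S \<circ> chart_at_infinity) 0) (nhds 0)"
    unfolding isCont_def tendsto_at_iff_tendsto_nhds .
  then have "((S \<circ> chart_at_infinity) \<longlongrightarrow> S None) (nhds 0)"
    by (simp add: chart_at_infinity_def)
  moreover have "((\<lambda>w. inverse (\<Psi> w)) \<longlongrightarrow> 0) at_infinity"
    by (rule filterlim_compose[OF tendsto_inverse_0 filterlim_\<Psi>])
  ultimately have "((\<lambda>w. (S \<circ> chart_at_infinity) (inverse (\<Psi> w))) \<longlongrightarrow> S None) at_infinity"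
    by (rule filterlim_compose)
  moreover have "\<forall>\<^sub>F w in at_infinity. (S \<circ> chart_at_infinity) (inverse (\<Psi> w)) = S\<Psi> w"
  proof -
    have "\<forall>\<^sub>F w in at_infinity. \<Psi> w \<noteq> 0"
      by (rule filterlim_at_infinity_imp_eventually_ne[OF filterlim_\<Psi>])
    then show ?thesis by eventually_elim (simp add: chart_at_infinity_def S\<Psi>_def)
  qed
  ultimately show ?thesis by (subst (asm) tendsto_cong)
qed

lemma S\<Psi>_bounds:
  assumes r: "1 < r"
  obtains m M where "0 < m" "0 < M" "\<And>w. cmod w = r \<Longrightarrow> m \<le> cmod (S\<Psi> w) \<and> cmod (S\<Psi> w) \<le> M"
proof -
  have cont: "continuous_on (sphere 0 r) (\<lambda>w. cmod (S\<Psi> w))"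
    by (intro continuous_on_norm holomorphic_on_imp_continuous_on holomorphic_on_subset[OF holomorphic_S\<Psi>])
       (use r in auto)
  have ne: "sphere (0 :: complex) r \<noteq> {}" using r by simp
  obtain w0 where w0: "w0 \<in> sphere 0 r" "\<And>w. w \<in> sphere 0 r \<Longrightarrow> cmod (S\<Psi> w0) \<le> cmod (S\<Psi> w)"
    using continuous_attains_inf[OF compact_sphere ne cont] by blast
  obtain w1 where w1: "w1 \<in> sphere 0 r" "\<And>w. w \<in> sphere 0 r \<Longrightarrow> cmod (S\<Psi> w) \<le> cmod (S\<Psi> w1)"
    using continuous_attains_sup[OF compact_sphere ne cont] by blast
  have pos: "0 < cmod (S\<Psi> w0)" "0 < cmod (S\<Psi> w1)" using S\<Psi>_nonzero w0(1) w1(1) r by auto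
  show ?thesis
  proof (rule that[OF pos])
    fix w :: complex assume "cmod w = r"
    then have "w \<in> sphere 0 r" by simp
    then show "cmod (S\<Psi> w0) \<le> cmod (S\<Psi> w) \<and> cmod (S\<Psi> w) \<le> cmod (S\<Psi> w1)" using w0 w1 by blast
  qed
qed

definition P :: "nat \<Rightarrow> complex \<Rightarrow> complex" where
  "P n w = poly (p n) (\<Psi> w) / (of_real (c n) * S\<Psi> w)"

text \<open>The image of the circle is compact in the sphere minus \<open>E\<close>, so the assumed
  convergence is uniform on it. The positive lower bound \<open>m\<close> of \<open>S\<Psi>\<close>
  turns the absolute error \<open>e * m\<close> into the relative error \<open>e\<close>.\<close>

lemma P_asymptotics:
  assumes r: "1 < r" and e: "0 < e"
  shows "\<forall>\<^sub>F n in sequentially. \<forall>w. cmod w = r \<longrightarrow> cmod (P n w - w ^ n) \<le> e * r ^ n"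
proof -
  obtain m M where m: "0 < m" "0 < M" "\<And>w. cmod w = r \<Longrightarrow> m \<le> cmod (S\<Psi> w) \<and> cmod (S\<Psi> w) \<le> M" by (rule S\<Psi>_bounds[OF r]) blast
  have "compact (\<Psi> ` sphere 0 r)"
    by (intro compact_continuous_image continuous_on_subset[OF continuous_on_\<Psi>[OF r]]) auto
  then have "compactin riemann_sphere (Some ` \<Psi> ` sphere 0 r)"
    unfolding riemann_sphere_def by (intro image_compactin[OF _ continuous_map_Some]) (simp add: compactin_euclidean_iff)
  moreover have "Some ` \<Psi> ` sphere 0 r \<subseteq> - Some ` E" using r by auto
  ultimately have "uniform_limit (Some ` \<Psi> ` sphere 0 r)
     (\<lambda>n. extend_to_infinity (\<lambda>z. poly (p n) z / (complex_of_real (c n) * \<Phi> z ^ n))) S sequentially"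
    by (rule asymptotics)
  then have "\<forall>\<^sub>F n in sequentially. \<forall>x\<in>Some ` \<Psi> ` sphere 0 r.
      dist (extend_to_infinity (\<lambda>z. poly (p n) z / (complex_of_real (c n) * \<Phi> z ^ n)) x) (S x) < e * m"
    unfolding uniform_limit_iff using e m by simp
  then show ?thesis
  proof eventually_elim
    case (elim n)
    show ?case
    proof (intro allI impI)
      fix w :: complex assume w: "cmod w = r"
      then have w1: "1 < cmod w" "w \<noteq> 0" using r by auto
      have S0: "S\<Psi> w \<noteq> 0" by (rule S\<Psi>_nonzero[OF w1(1)])
      have "Some (\<Psi> w) \<in> Some ` \<Psi> ` sphere 0 r" using w by simp
      from bspec[OF elim this] have dist: "dist (poly (p n) (\<Psi> w) / (of_real (c n) * w ^ n)) (S\<Psi> w) < e * m"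
        by (simp add: extend_to_infinity_def S\<Psi>_def w1)
      then have d: "cmod (poly (p n) (\<Psi> w) / (of_real (c n) * w ^ n) - S\<Psi> w) \<le> e * cmod (S\<Psi> w)"
      proof -
        have "e * m \<le> e * cmod (S\<Psi> w)" using m(3)[OF w] e by (intro mult_left_mono) auto
        with dist show ?thesis by (simp add: dist_norm)
      qed
      have "P n w - w ^ n = (poly (p n) (\<Psi> w) / (of_real (c n) * w ^ n) - S\<Psi> w) * w ^ n / S\<Psi> w"
        using S0 w1 c_pos[of n] by (simp add: P_def field_simps)
      also have "cmod \<dots> = cmod (poly (p n) (\<Psi> w) / (of_real (c n) * w ^ n) - S\<Psi> w) * r ^ n / cmod (S\<Psi> w)"
        by (simp add: norm_mult norm_divide norm_power w)
      also have "\<dots> \<le> e * cmod (S\<Psi> w) * r ^ n / cmod (S\<Psi> w)"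
        by (intro divide_right_mono mult_right_mono d) (use r in auto)
      also have "\<dots> = e * r ^ n" using S0 by simp
      finally show "cmod (P n w - w ^ n) \<le> e * r ^ n" .
    qed
  qed
qed

lemma poly_p_eq_P: "1 < cmod w \<Longrightarrow> poly (p n) (\<Psi> w) = of_real (c n) * S\<Psi> w * P n w"
  using S\<Psi>_nonzero[of w] c_pos[of n] by (simp add: P_def)

lemma holomorphic_P: "P n holomorphic_on {w. 1 < cmod w}"
  unfolding P_def[abs_def]
  by (intro holomorphic_intros holomorphic_on_compose_gen[OF holomorphic_\<Psi>, of "poly (p n)" UNIV, unfolded o_def] holomorphic_S\<Psi>)
     (use S\<Psi>_nonzero c_pos[of n] in auto)

text \<open>Keeps the zeros of \<open>p n\<close> off the level curve for large \<open>n\<close>, so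
  that it can serve as a denominator in contour integrals.\<close>

lemma poly_p_lower_bound:
  assumes r: "1 < r"
  obtains m where "0 < m" "\<forall>\<^sub>F n in sequentially. \<forall>w. cmod w = r \<longrightarrow> m * (c n * r ^ n) \<le> cmod (poly (p n) (\<Psi> w))"
proof -
  obtain m M where m: "0 < m" "0 < M" "\<And>w. cmod w = r \<Longrightarrow> m \<le> cmod (S\<Psi> w) \<and> cmod (S\<Psi> w) \<le> M" by (rule S\<Psi>_bounds[OF r]) blast
  have "\<forall>\<^sub>F n in sequentially. \<forall>w. cmod w = r \<longrightarrow> m / 2 * (c n * r ^ n) \<le> cmod (poly (p n) (\<Psi> w))"
    using P_asymptotics[OF r half_gt_zero[OF zero_less_one]]
  proof eventually_elim
    case (elim n)
    show ?case
    proof (intro allI impI)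
      fix w :: complex assume w: "cmod w = r"
      have "r ^ n - cmod (P n w) \<le> cmod (P n w - w ^ n)"
        using norm_triangle_ineq2[of "w ^ n" "P n w"] by (simp add: norm_power w norm_minus_commute)
      moreover have "cmod (P n w - w ^ n) \<le> 1 / 2 * r ^ n" using elim w by blast
      ultimately have "1 / 2 * r ^ n \<le> cmod (P n w)" by linarith
      then have "m * (1 / 2 * r ^ n) \<le> cmod (S\<Psi> w) * cmod (P n w)"
        using m(1) m(3)[OF w] r by (intro mult_mono) auto
      then have "c n * (m * (1 / 2 * r ^ n)) \<le> c n * (cmod (S\<Psi> w) * cmod (P n w))"
        using c_pos[of n] by (intro mult_left_mono) auto
      then show "m / 2 * (c n * r ^ n) \<le> cmod (poly (p n) (\<Psi> w))"
        using poly_p_eq_P[of w n] w r c_pos[of n] by (simp add: norm_mult mult_ac)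
    qed
  qed
  then show ?thesis using that[of "m / 2"] m(1) by simp
qed

lemma P_upper_bound:
  assumes r: "1 < r"
  obtains M where "0 < M" "\<And>n w. cmod w = r \<Longrightarrow> cmod (P n w) \<le> M * r ^ n"
proof -
  obtain N where N: "\<And>n w. n \<ge> N \<Longrightarrow> cmod w = r \<Longrightarrow> cmod (P n w - w ^ n) \<le> 1 * r ^ n"
    using P_asymptotics[OF r, of 1] unfolding eventually_sequentially by auto
  have "\<exists>B. \<forall>w. cmod w = r \<longrightarrow> cmod (P n w) \<le> B" for n
  proof -
    have "continuous_on (sphere 0 r) (P n)"
      by (intro holomorphic_on_imp_continuous_on holomorphic_on_subset[OF holomorphic_P]) (use r in auto)
    from compact_imp_bounded[OF compact_continuous_image[OF this compact_sphere]] show ?thesis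
      unfolding bounded_iff by (metis image_eqI mem_sphere_0)
  qed
  then obtain B where B: "\<And>n w. cmod w = r \<Longrightarrow> cmod (P n w) \<le> B n" by metis
  define M where "M = 2 + (\<Sum>n<N. \<bar>B n\<bar>)"
  show ?thesis
  proof (rule that)
    show "0 < M" unfolding M_def by (intro add_pos_nonneg sum_nonneg) auto
    fix n and w :: complex assume w: "cmod w = r"
    have r1: "1 \<le> r ^ n" using r by (intro one_le_power) simp
    show "cmod (P n w) \<le> M * r ^ n"
    proof (cases "n < N")
      case True
      have "cmod (P n w) \<le> \<bar>B n\<bar>" using B[OF w, of n] by linarith
      also have "\<dots> \<le> (\<Sum>n<N. \<bar>B n\<bar>)" using True by (intro member_le_sum) auto
      finally have "cmod (P n w) \<le> M" by (simp add: M_def)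
      also have "\<dots> \<le> M * r ^ n" using \<open>0 < M\<close> r1 by simp
      finally show ?thesis .
    next
      case False
      have "cmod (P n w) \<le> cmod (P n w - w ^ n) + cmod (w ^ n)" by (metis diff_add_cancel norm_triangle_ineq)
      also have "\<dots> \<le> 2 * r ^ n" using N[of n w] False w by (simp add: norm_power)
      also have "\<dots> \<le> M * r ^ n" using r1 by (intro mult_right_mono) (auto simp: M_def sum_nonneg)
      finally show ?thesis .
    qed
  qed
qed

text \<open>Interpolating \<open>g\<close> at the zeros of \<open>p n\<close> gives geometric approximation by polynomials of degree
  less than \<open>n\<close>, with an error that is controlled by \<open>p n\<close> itself and hence well adapted to \<open>\<mu>\<close>.\<close>

lemma polynomial_approximation:
  assumes g: "g holomorphic_on dom \<rho>" and r: "1 < \<sigma>" "\<sigma> < r" "r < \<rho>"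
  obtains C where "0 \<le> C" "\<forall>\<^sub>F n in sequentially. \<exists>q. degree q < n \<and>
    (\<forall>z. (z \<in> E \<or> cmod (\<Phi> z) \<le> \<sigma>) \<longrightarrow> cmod (g z - poly q z) \<le> C / (c n * r ^ n) * cmod (poly (p n) z))"
proof -
  have r1: "1 < r" using r by simp
  define \<gamma> where "\<gamma> = \<Psi> \<circ> circlepath 0 r"
  note path = valid_path_\<Psi>_circlepath[OF r1, folded \<gamma>_def]
  obtain L where L: "0 \<le> L" "\<And>f i B. (f has_contour_integral i) \<gamma> \<Longrightarrow> 0 \<le> B \<Longrightarrow>
      (\<And>w. cmod w = r \<Longrightarrow> cmod (f (\<Psi> w)) \<le> B) \<Longrightarrow> cmod i \<le> B * L"
    by (rule \<Psi>_circlepath_integral_bound[OF r1, folded \<gamma>_def]) blast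
  obtain m where m: "0 < m" "\<forall>\<^sub>F n in sequentially. \<forall>w. cmod w = r \<longrightarrow> m * (c n * r ^ n) \<le> cmod (poly (p n) (\<Psi> w))"
    by (rule poly_p_lower_bound[OF r1]) blast
  have T: "compact (\<Psi> ` sphere 0 r)"
    by (intro compact_continuous_image continuous_on_subset[OF continuous_on_\<Psi>[OF r1]]) auto
  have Tdom: "\<Psi> ` sphere 0 r \<subseteq> dom \<rho>" using r by (auto simp: \<Psi>_in_dom_iff)
  obtain G where G: "0 < G" "\<And>w. cmod w = r \<Longrightarrow> cmod (g (\<Psi> w)) \<le> G"
  proof -
    have "continuous_on (\<Psi> ` sphere 0 r) g"
      using continuous_on_subset[OF holomorphic_on_imp_continuous_on[OF g] Tdom] .
    from compact_imp_bounded[OF compact_continuous_image[OF this T]] show ?thesis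
      using that unfolding bounded_pos by auto
  qed
  \<comment> \<open>The distance from the level curve of radius \<open>r\<close> to the closed set
    consisting of \<open>E\<close> and the points with
    \<open>cmod (\<Phi> z) \<le> \<sigma>\<close>.\<close>
  obtain d where d: "0 < d" "\<And>w z. cmod w = r \<Longrightarrow> z \<in> E \<or> cmod (\<Phi> z) \<le> \<sigma> \<Longrightarrow> d \<le> cmod (\<Psi> w - z)"
  proof -
    have disj: "\<Psi> ` sphere 0 r \<inter> - {z \<in> - E. \<sigma> < cmod (\<Phi> z)} = {}" using r by auto
    have "closed (- {z \<in> - E. \<sigma> < cmod (\<Phi> z)})" using open_exterior_level by (simp add: closed_Compl)
    from separate_compact_closed[OF T this disj] obtain d where d: "d > 0"
      "\<forall>x\<in>\<Psi> ` sphere 0 r. \<forall>y\<in>- {z \<in> - E. \<sigma> < cmod (\<Phi> z)}. d \<le> dist x y" by blast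
    show ?thesis
    proof (rule that[OF d(1)])
      fix w z assume "cmod w = r" "z \<in> E \<or> cmod (\<Phi> z) \<le> \<sigma>"
      then have "\<Psi> w \<in> \<Psi> ` sphere 0 r" "z \<in> - {z \<in> - E. \<sigma> < cmod (\<Phi> z)}" by auto
      then show "d \<le> cmod (\<Psi> w - z)" using d(2) unfolding dist_norm by blast
    qed
  qed
  define C where "C = G / (m * d) * L / (2 * pi)"
  show ?thesis
  proof (rule that)
    show "0 \<le> C" using G m d L by (simp add: C_def)
    show "\<forall>\<^sub>F n in sequentially. \<exists>q. degree q < n \<and>
      (\<forall>z. (z \<in> E \<or> cmod (\<Phi> z) \<le> \<sigma>) \<longrightarrow> cmod (g z - poly q z) \<le> C / (c n * r ^ n) * cmod (poly (p n) z))"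
      using m(2) eventually_gt_at_top[of 0]
    proof eventually_elim
      case (elim n)
      have cr: "0 < c n * r ^ n" using c_pos r1 by simp
      have low: "0 < m * (c n * r ^ n)" using m(1) cr by simp
      have nz: "poly (p n) (\<Psi> w) \<noteq> 0" if "cmod w = r" for w using elim(1) that low by fastforce
      \<comment> \<open>These are the coefficients, as a polynomial in \<open>z\<close> of degree
        less than \<open>n\<close>, of the divided difference of \<open>p n\<close> at
        \<open>z\<close> and \<open>t\<close>.\<close>
      define D where "D j t = (\<Sum>i=Suc j..n. coeff (p n) i * t ^ (i - j - 1))" for j t
      have poly_p: "poly (p n) x = (\<Sum>i\<le>n. coeff (p n) i * x ^ i)" for x
        using degree_p[of n] by (simp add: poly_altdef)
      have diff: "poly (p n) z - poly (p n) t = (z - t) * (\<Sum>j<n. D j t * z ^ j)" for z t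
        unfolding poly_p D_def using elim(2) by (intro polyfun_diff) simp
      define I where "I j = contour_integral \<gamma> (\<lambda>t. g t / poly (p n) t * D j t)" for j
      have I: "((\<lambda>t. g t / poly (p n) t * D j t) has_contour_integral I j) \<gamma>" for j
        unfolding I_def
      proof (rule has_contour_integral_integral, rule contour_integrable_holomorphic_simple[OF _ _ path(1)])
        have "p n \<noteq> 0" using nz[of "of_real r"] r1 by auto
        then show "open (dom \<rho> - {t. poly (p n) t = 0})"
          using open_dom[of \<rho>] r by (intro open_Diff finite_imp_closed poly_roots_finite) auto
        show "(\<lambda>t. g t / poly (p n) t * D j t) holomorphic_on dom \<rho> - {t. poly (p n) t = 0}"
          unfolding D_def by (intro holomorphic_intros holomorphic_on_subset[OF g]) auto
        show "path_image \<gamma> \<subseteq> dom \<rho> - {t. poly (p n) t = 0}"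
          using Tdom nz unfolding path by auto
      qed
      \<comment> \<open>The Hermite interpolant: the integral of \<open>g t / poly (p n) t\<close>
        times the divided difference, over \<open>2 * pi * \<i>\<close>. Subtracting it from
        Cauchy's formula leaves the integrand
        \<open>g t * poly (p n) z / (poly (p n) t * (t - z))\<close>.\<close>
      define q where "q = (\<Sum>j<n. monom (I j / (2 * pi * \<i>)) j)"
      have "degree q < n" unfolding q_def
        by (rule degree_sum_less) (use elim(2) in \<open>auto intro: le_less_trans[OF degree_monom_le]\<close>)
      moreover have "cmod (g z - poly q z) \<le> C / (c n * r ^ n) * cmod (poly (p n) z)" if z: "z \<in> E \<or> cmod (\<Phi> z) \<le> \<sigma>" for z
      proof -
        have zr: "z \<in> dom r" using z r by (auto simp: dom_def)
        have "((\<lambda>t. g t / (t - z) - (\<Sum>j<n. g t / poly (p n) t * D j t * z ^ j)) has_contour_integral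
            2 * pi * \<i> * g z - (\<Sum>j<n. I j * z ^ j)) \<gamma>"
          unfolding \<gamma>_def by (intro has_contour_integral_diff Cauchy_formula_dom[OF g r1 r(3) zr]
             has_contour_integral_sum has_contour_integral_rmul I[unfolded \<gamma>_def]) auto
        then have "cmod (2 * pi * \<i> * g z - (\<Sum>j<n. I j * z ^ j)) \<le> G / (m * (c n * r ^ n) * d) * cmod (poly (p n) z) * L"
        proof (rule L(2))
          show "0 \<le> G / (m * (c n * r ^ n) * d) * cmod (poly (p n) z)" using G low d by simp
          fix w assume w: "cmod w = r"
          define t where "t = \<Psi> w"
          have dt: "d \<le> cmod (t - z)" using d(2)[OF w z] by (simp add: t_def)
          then have tz: "t \<noteq> z" using d(1) by auto
          have pt: "poly (p n) t \<noteq> 0" using nz[OF w] by (simp add: t_def)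
          have "(\<Sum>j<n. g t / poly (p n) t * D j t * z ^ j) = g t / poly (p n) t * (\<Sum>j<n. D j t * z ^ j)"
            by (simp add: sum_distrib_left mult.assoc)
          also have "(\<Sum>j<n. D j t * z ^ j) = (poly (p n) t - poly (p n) z) / (t - z)"
            using diff[of z t] tz by (simp add: field_simps)
          finally have "g t / (t - z) - (\<Sum>j<n. g t / poly (p n) t * D j t * z ^ j) =
              g t / (t - z) - g t / poly (p n) t * ((poly (p n) t - poly (p n) z) / (t - z))" by (rule arg_cong)
          also have "\<dots> = g t / (poly (p n) t * (t - z)) * poly (p n) z"
          proof -
            have "a / u - a / v * ((v - y) / u) = a / (v * u) * y" if "u \<noteq> 0" "v \<noteq> 0" for a u v y :: complex
              using that by (simp add: field_simps)
            then show ?thesis using tz pt by simp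
          qed
          finally have "g t / (t - z) - (\<Sum>j<n. g t / poly (p n) t * D j t * z ^ j) = g t / (poly (p n) t * (t - z)) * poly (p n) z" .
          moreover have "cmod (g t) / (cmod (poly (p n) t) * cmod (t - z)) \<le> G / (m * (c n * r ^ n) * d)"
            using G(2)[OF w] elim(1) w dt low d(1) G(1) by (intro frac_le mult_mono) (auto simp: t_def)
          ultimately show "cmod (g (\<Psi> w) / (\<Psi> w - z) - (\<Sum>j<n. g (\<Psi> w) / poly (p n) (\<Psi> w) * D j (\<Psi> w) * z ^ j))
              \<le> G / (m * (c n * r ^ n) * d) * cmod (poly (p n) z)"
            unfolding t_def[symmetric] by (simp only: norm_mult norm_divide) (intro mult_right_mono, auto)
        qed
        moreover have "2 * pi * \<i> * g z - (\<Sum>j<n. I j * z ^ j) = 2 * pi * \<i> * (g z - poly q z)"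
          by (simp add: q_def poly_sum poly_monom right_diff_distrib sum_distrib_left)
        ultimately have "2 * pi * cmod (g z - poly q z) \<le> G / (m * (c n * r ^ n) * d) * cmod (poly (p n) z) * L"
          by (simp add: norm_mult)
        then have "cmod (g z - poly q z) \<le> G / (m * (c n * r ^ n) * d) * cmod (poly (p n) z) * L / (2 * pi)"
          by (subst pos_le_divide_eq) (auto simp: mult_ac)
        then show ?thesis by (simp add: C_def field_simps)
      qed
      ultimately show ?case by blast
    qed
  qed
qed

section \<open>Decay of the coefficients and convergence of the orthogonal expansion\<close>

abbreviation coefficient :: "(complex \<Rightarrow> complex) \<Rightarrow> nat \<Rightarrow> complex" where
  "coefficient g n \<equiv> inner_product E \<mu> g (poly (p n))"

lemma continuous_on_E: "g holomorphic_on dom \<rho> \<Longrightarrow> continuous_on E g"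
  using continuous_on_subset[OF holomorphic_on_imp_continuous_on E_subset_dom] .

text \<open>Subtracting the interpolant of degree less than \<open>n\<close> does not change the
  coefficient of index \<open>n\<close>, and the error is a small multiple of \<open>p n\<close> on
  \<open>E\<close>.\<close>

lemma coefficient_bound:
  assumes g: "g holomorphic_on dom \<rho>" and r: "1 < r" "r < \<rho>"
  obtains C where "\<forall>\<^sub>F n in sequentially. cmod (of_real (c n) * coefficient g n) * r ^ n \<le> C"
proof -
  obtain \<sigma> where \<sigma>: "1 < \<sigma>" "\<sigma> < r" using dense[OF r(1)] by blast
  obtain C where C: "0 \<le> C" "\<forall>\<^sub>F n in sequentially. \<exists>q. degree q < n \<and>
    (\<forall>z. (z \<in> E \<or> cmod (\<Phi> z) \<le> \<sigma>) \<longrightarrow> cmod (g z - poly q z) \<le> C / (c n * r ^ n) * cmod (poly (p n) z))"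
    by (rule polynomial_approximation[OF g \<sigma> r(2)]) blast
  have "\<forall>\<^sub>F n in sequentially. cmod (of_real (c n) * coefficient g n) * r ^ n \<le> C"
    using C(2)
  proof eventually_elim
    case (elim n)
    then obtain q where q: "degree q < n" "\<And>z. z \<in> E \<Longrightarrow> cmod (g z - poly q z) \<le> C / (c n * r ^ n) * cmod (poly (p n) z)" by blast
    have cont: "continuous_on E g" "continuous_on E (poly q)" "continuous_on E (poly (p n))"
      using continuous_on_E[OF g] by (auto intro: continuous_intros)
    have cr: "0 < c n * r ^ n" using c_pos r by simp
    have "cmod (inner_product E \<mu> (\<lambda>z. g z - poly q z) (poly (p n))) \<le> C / (c n * r ^ n)"
      by (rule norm_inner_product_le[OF _ _ q(2)]) (use cont C(1) cr in \<open>auto intro: continuous_intros\<close>)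
    then have "cmod (coefficient g n) \<le> C / (c n * r ^ n)"
      using inner_product_diff_left[OF cont] inner_product_poly_eq_0[OF q(1)] by simp
    then show ?case using cr c_pos[of n] by (simp add: norm_mult pos_le_divide_eq mult_ac)
  qed
  then show ?thesis by (rule that)
qed

text \<open>The quotients satisfy \<open>x (Suc n) = c n / c (Suc n) / r * x n + (\<sigma> / r) ^
  Suc n\<close>. With \<open>\<theta>\<close> above both \<open>1 / r\<close> and
  \<open>\<sigma> / r\<close> this gives the bound \<open>(K + n) * \<theta> ^ n\<close>.\<close>

lemma c_weighted_sum_tendsto_0:
  assumes r: "0 < \<sigma>" "\<sigma> < r" "1 < r"
  shows "(\<lambda>n. (\<Sum>k\<le>n. c k * \<sigma> ^ k) / (c n * r ^ n)) \<longlonglongrightarrow> 0"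
proof -
  define x where "x n = (\<Sum>k\<le>n. c k * \<sigma> ^ k) / (c n * r ^ n)" for n
  obtain \<theta> where \<theta>: "max (\<sigma> / r) (1 / r) < \<theta>" "\<theta> < 1"
    using dense[of "max (\<sigma> / r) (1 / r)" 1] r by auto
  have \<theta>0: "0 < \<theta>" using \<theta>(1) r by (smt (verit) divide_pos_pos max_less_iff_conj)
  have "(\<lambda>n. c n / c (Suc n) / r) \<longlonglongrightarrow> 1 / r" by (intro tendsto_divide c_ratio tendsto_const) (use r in auto)
  then have "\<forall>\<^sub>F n in sequentially. c n / c (Suc n) / r < \<theta>" using \<theta> by (intro order_tendstoD) auto
  then obtain N where N: "\<And>n. n \<ge> N \<Longrightarrow> c n / c (Suc n) / r < \<theta>" unfolding eventually_sequentially by blast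
  have x0: "0 \<le> x n" for n unfolding x_def
    using r c_pos by (intro divide_nonneg_pos sum_nonneg mult_nonneg_nonneg mult_pos_pos zero_le_power zero_less_power) (auto simp: less_imp_le)
  have rec: "x (Suc n) \<le> \<theta> * x n + \<theta> ^ Suc n" if "n \<ge> N" for n
  proof -
    have "x (Suc n) = c n / c (Suc n) / r * x n + (\<sigma> / r) ^ Suc n"
      using c_pos[of n] c_pos[of "Suc n"] r by (simp add: x_def field_simps power_divide)
    also have "\<dots> \<le> \<theta> * x n + \<theta> ^ Suc n"
      using N[OF that] x0[of n] r \<theta> by (intro add_mono mult_right_mono power_mono) auto
    finally show ?thesis .
  qed
  define K where "K = x N / \<theta> ^ N"
  have bound: "x n \<le> (K + real n) * \<theta> ^ n" if "n \<ge> N" for n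
    using that
  proof (induction n rule: dec_induct)
    case base
    show ?case using \<theta>0 by (simp add: K_def field_simps)
  next
    case (step n)
    have "x (Suc n) \<le> \<theta> * ((K + real n) * \<theta> ^ n) + \<theta> ^ Suc n"
      using rec[of n] step mult_left_mono[OF step.IH, of \<theta>] \<theta>0 by linarith
    then show ?case by (simp add: algebra_simps)
  qed
  have "(\<lambda>n. K * \<theta> ^ n + real n * \<theta> ^ n) \<longlonglongrightarrow> K * 0 + 0"
  proof (intro tendsto_add tendsto_mult tendsto_const)
    show "(\<lambda>n. \<theta> ^ n) \<longlonglongrightarrow> 0" using \<theta> \<theta>0 by (intro LIMSEQ_power_zero) auto
    show "(\<lambda>n. real n * \<theta> ^ n) \<longlonglongrightarrow> 0" using \<theta> \<theta>0 powser_times_n_limit_0[of \<theta>] by simp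
  qed
  then have lim: "(\<lambda>n. (K + real n) * \<theta> ^ n) \<longlonglongrightarrow> 0" by (simp add: distrib_right)
  have "x \<longlonglongrightarrow> 0"
    by (rule tendsto_sandwich[OF _ _ tendsto_const lim])
       (use x0 bound in \<open>auto simp: eventually_sequentially\<close>)
  then show ?thesis by (simp add: x_def[abs_def])
qed

text \<open>A polynomial \<open>q\<close> of degree less than \<open>n\<close> is reproduced by the
  partial sum, so only \<open>g - q\<close> matters. Its bound on \<open>E\<close> controls the
  coefficients, and its bound on the level curve controls the values. Both carry the factor
  \<open>1 / (c n * r ^ n)\<close> against terms of size \<open>c k * \<sigma> ^ k\<close>.\<close>

lemma orthogonal_expansion:
  assumes g: "g holomorphic_on dom \<rho>" and \<sigma>: "1 < \<sigma>" "\<sigma> < \<rho>"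
  shows "uniform_limit (sphere 0 \<sigma>) (\<lambda>n w. \<Sum>k<n. coefficient g k * poly (p k) (\<Psi> w)) (\<lambda>w. g (\<Psi> w)) sequentially"
proof -
  obtain r where r: "\<sigma> < r" "r < \<rho>" using dense[OF \<sigma>(2)] by blast
  obtain C where C: "0 \<le> C" "\<forall>\<^sub>F n in sequentially. \<exists>q. degree q < n \<and>
    (\<forall>z. (z \<in> E \<or> cmod (\<Phi> z) \<le> \<sigma>) \<longrightarrow> cmod (g z - poly q z) \<le> C / (c n * r ^ n) * cmod (poly (p n) z))"
    by (rule polynomial_approximation[OF g \<sigma>(1) r]) blast
  obtain M where M: "0 < M" "\<And>n w. cmod w = \<sigma> \<Longrightarrow> cmod (P n w) \<le> M * \<sigma> ^ n" by (rule P_upper_bound[OF \<sigma>(1)]) blast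
  obtain m B where B: "0 < m" "0 < B" "\<And>w. cmod w = \<sigma> \<Longrightarrow> m \<le> cmod (S\<Psi> w) \<and> cmod (S\<Psi> w) \<le> B"
    by (rule S\<Psi>_bounds[OF \<sigma>(1)]) blast
  have pB: "cmod (poly (p k) (\<Psi> w)) \<le> B * M * (c k * \<sigma> ^ k)" if w: "cmod w = \<sigma>" for w k
  proof -
    have "cmod (S\<Psi> w) * cmod (P k w) \<le> B * (M * \<sigma> ^ k)" using B(2,3) M w by (intro mult_mono) auto
    from mult_left_mono[OF this, of "c k"] show ?thesis
      using poly_p_eq_P[of w k] w \<sigma> c_pos[of k] by (simp add: norm_mult mult_ac)
  qed
  define x where "x n = (\<Sum>k\<le>n. c k * \<sigma> ^ k) / (c n * r ^ n)" for n
  have x: "x \<longlonglongrightarrow> 0" unfolding x_def[abs_def] using \<sigma> r by (intro c_weighted_sum_tendsto_0) auto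
  have main: "\<forall>\<^sub>F n in sequentially. \<forall>w\<in>sphere 0 \<sigma>.
      cmod ((\<Sum>k<n. coefficient g k * poly (p k) (\<Psi> w)) - g (\<Psi> w)) \<le> C * B * M * x n"
    using C(2)
  proof eventually_elim
    case (elim n)
    define K where "K = C / (c n * r ^ n)"
    obtain q where q: "degree q < n" "\<And>z. z \<in> E \<or> cmod (\<Phi> z) \<le> \<sigma> \<Longrightarrow> cmod (g z - poly q z) \<le> K * cmod (poly (p n) z)"
      using elim unfolding K_def by blast
    have cont: "continuous_on E g" "continuous_on E (poly q)" "\<And>k. continuous_on E (poly (p k))"
      using continuous_on_E[OF g] by (auto intro: continuous_intros)
    have K: "0 \<le> K" using C(1) c_pos[of n] r \<sigma> by (auto simp: K_def)
    have diff: "cmod (coefficient g k - coefficient (poly q) k) \<le> K" for k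
      unfolding inner_product_diff_left[OF cont(1,2,3), symmetric]
      by (rule norm_inner_product_le[of _ _ n]) (use cont K q(2) in \<open>auto intro!: continuous_intros\<close>)
    show ?case
    proof
      fix w :: complex assume "w \<in> sphere 0 \<sigma>"
      then have w: "cmod w = \<sigma>" by simp
      have "poly q (\<Psi> w) = (\<Sum>k<n. coefficient (poly q) k * poly (p k) (\<Psi> w))"
        by (subst poly_expansion[OF q(1)]) (simp add: poly_sum)
      then have "(\<Sum>k<n. coefficient g k * poly (p k) (\<Psi> w)) - g (\<Psi> w) =
         (\<Sum>k<n. (coefficient g k - coefficient (poly q) k) * poly (p k) (\<Psi> w)) - (g (\<Psi> w) - poly q (\<Psi> w))"
        by (simp add: left_diff_distrib sum_subtractf)
      also have "cmod \<dots> \<le> (\<Sum>k<n. K * (B * M * (c k * \<sigma> ^ k))) + K * (B * M * (c n * \<sigma> ^ n))"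
      proof (rule order_trans[OF norm_triangle_ineq4], rule add_mono)
        show "cmod (\<Sum>k<n. (coefficient g k - coefficient (poly q) k) * poly (p k) (\<Psi> w)) \<le> (\<Sum>k<n. K * (B * M * (c k * \<sigma> ^ k)))"
          unfolding norm_mult by (rule sum_norm_le) (use diff pB[OF w] K in \<open>auto simp: norm_mult intro!: mult_mono\<close>)
        have "cmod (g (\<Psi> w) - poly q (\<Psi> w)) \<le> K * cmod (poly (p n) (\<Psi> w))" using q(2) w \<sigma> by simp
        also have "\<dots> \<le> K * (B * M * (c n * \<sigma> ^ n))" by (intro mult_left_mono pB w K)
        finally show "cmod (g (\<Psi> w) - poly q (\<Psi> w)) \<le> K * (B * M * (c n * \<sigma> ^ n))" .
      qed
      also have "\<dots> = K * (B * M) * (\<Sum>k\<le>n. c k * \<sigma> ^ k)"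
        by (simp add: lessThan_Suc_atMost[symmetric] sum_distrib_left algebra_simps)
      also have "\<dots> = C * B * M * x n" by (simp add: K_def x_def)
      finally show "cmod ((\<Sum>k<n. coefficient g k * poly (p k) (\<Psi> w)) - g (\<Psi> w)) \<le> C * B * M * x n" .
    qed
  qed
  show ?thesis
    unfolding uniform_limit_iff
  proof (intro allI impI)
    fix e :: real assume "0 < e"
    have "(\<lambda>n. C * B * M * x n) \<longlonglongrightarrow> 0" using tendsto_mult_right_zero[OF x] .
    then have "\<forall>\<^sub>F n in sequentially. C * B * M * x n < e" using \<open>0 < e\<close> by (rule order_tendstoD)
    with main show "\<forall>\<^sub>F n in sequentially. \<forall>w\<in>sphere 0 \<sigma>. dist (\<Sum>k<n. coefficient g k * poly (p k) (\<Psi> w)) (g (\<Psi> w)) < e"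
      by eventually_elim (auto simp: dist_norm intro: le_less_trans)
  qed
qed

end

section \<open>Laurent coefficients\<close>

definition laurent_coeff :: "real \<Rightarrow> (complex \<Rightarrow> complex) \<Rightarrow> nat \<Rightarrow> complex" where
  "laurent_coeff r f m = contour_integral (circlepath 0 r) (\<lambda>w. f w / w ^ Suc m) / (2 * of_real pi * \<i>)"

text \<open>For \<open>w\<close> outside the circle this is the part of the Laurent expansion with
  negative powers, kept as a Cauchy integral; the sign comes from the inner circle being traversed
  backwards in Cauchy's formula for an annulus.\<close>

definition principal_part :: "real \<Rightarrow> (complex \<Rightarrow> complex) \<Rightarrow> complex \<Rightarrow> complex" where
  "principal_part r f w = - contour_integral (circlepath 0 r) (\<lambda>u. f u / (u - w)) / (2 * of_real pi * \<i>)"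

lemma contour_integral_circlepath_annulus:
  assumes "f holomorphic_on X" "open X" "cball 0 R - ball 0 r \<subseteq> X" "0 < r" "r \<le> R"
  shows "contour_integral (circlepath 0 r) f = contour_integral (circlepath 0 R) f"
  by (rule Cauchy_theorem_homotopic_loops[OF homotopic_loops_circlepath assms(2,1)]) (use assms in auto)

lemma laurent_coeff_bound:
  assumes f: "continuous_on (sphere 0 r) f" and r: "0 < r" and B: "\<And>w. cmod w = r \<Longrightarrow> cmod (f w) \<le> B"
  shows "cmod (laurent_coeff r f m) \<le> B / r ^ m"
proof -
  have B0: "0 \<le> B" using B[of "of_real r"] r norm_ge_zero[of "f (of_real r)"] by (simp del: norm_ge_zero)
  have "continuous_on (sphere 0 r) (\<lambda>w. f w / w ^ Suc m)" using r f by (intro continuous_intros) auto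
  then have "(\<lambda>w. f w / w ^ Suc m) contour_integrable_on circlepath 0 r"
    using r by (intro contour_integrable_continuous_circlepath) auto
  then have "cmod (contour_integral (circlepath 0 r) (\<lambda>w. f w / w ^ Suc m)) \<le> B / r ^ Suc m * (2 * pi * r)"
    by (intro has_contour_integral_bound_circlepath[OF has_contour_integral_integral])
       (use r B B0 in \<open>auto simp: norm_divide norm_mult norm_power intro!: divide_right_mono\<close>)
  then show ?thesis using r by (simp add: laurent_coeff_def norm_divide norm_mult field_simps)
qed

lemma laurent_coeff_power:
  assumes "0 < r" "m \<le> k"
  shows "laurent_coeff r (\<lambda>w. w ^ k) m = (if k = m then 1 else 0)"
proof (cases "k = m")
  case True
  have "contour_integral (circlepath 0 r) (\<lambda>w. w ^ k / w ^ Suc m) = contour_integral (circlepath 0 r) (\<lambda>w. 1 / (w - 0))"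
    using assms True by (intro contour_integral_cong) auto
  then show ?thesis using assms True by (simp only: laurent_coeff_def contour_integral_circlepath) simp
next
  case False
  have "contour_integral (circlepath 0 r) (\<lambda>w. w ^ k / w ^ Suc m) = contour_integral (circlepath 0 r) (\<lambda>w. w ^ (k - Suc m))"
    using assms False by (intro contour_integral_cong) (auto simp: power_diff)
  also have "\<dots> = 0"
    by (rule contour_integral_unique, rule Cauchy_theorem_disc_simple[of _ 0 "r + 1"])
       (use assms in \<open>auto intro!: holomorphic_intros\<close>)
  finally show ?thesis using False by (simp add: laurent_coeff_def)
qed

text \<open>Cauchy's formula in an annulus expresses \<open>f w\<close> as the difference of the
  integrals over an outer circle and the circle of radius \<open>\<sigma>\<close>. The outer
  integrand is expanded in powers of \<open>w / u\<close>; its coefficients may be computed on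
  either circle.\<close>

lemma laurent_split:
  assumes f: "f holomorphic_on {w. s0 < cmod w \<and> cmod w < s1}" and s: "0 < s0" "s0 < \<sigma>"
    and w: "\<sigma> < cmod w" "cmod w < s1"
  shows "(\<lambda>m. laurent_coeff \<sigma> f m * w ^ m) sums (f w - principal_part \<sigma> f w)"
proof -
  define A where "A = {w. s0 < cmod w \<and> cmod w < s1}"
  obtain r where r: "cmod w < r" "r < s1" using dense[OF w(2)] by blast
  have pos: "0 < \<sigma>" "0 < r" "\<sigma> \<le> r" using s r w by linarith+
  have openA: "open A" unfolding A_def by (intro open_Collect_conj open_Collect_less continuous_intros)
  have ann: "cball 0 r - ball 0 \<sigma> \<subseteq> A" using s r by (auto simp: A_def)
  have sph: "sphere 0 r \<subseteq> A" "sphere 0 \<sigma> \<subseteq> A" using s r w by (auto simp: A_def)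
  have fA: "f holomorphic_on A" using f by (simp add: A_def)
  have contf: "continuous_on A f" using holomorphic_on_imp_continuous_on[OF fA] .
  note cint = contour_integrable_continuous_circlepath
  have "laurent_coeff \<sigma> f m = laurent_coeff r f m" for m
  proof -
    have "(\<lambda>w. f w / w ^ Suc m) holomorphic_on A"
      by (intro holomorphic_on_divide holomorphic_on_power holomorphic_on_ident fA) (use s in \<open>auto simp: A_def\<close>)
    from contour_integral_circlepath_annulus[OF this openA ann pos(1,3)] show ?thesis
      unfolding laurent_coeff_def by (rule arg_cong)
  qed
  note coeff = this
  define K where "K t = contour_integral (circlepath 0 t) (\<lambda>u. f u / (u - w))" for t
  have cauchy: "K r - K \<sigma> = 2 * of_real pi * \<i> * f w"
  proof -
    \<comment> \<open>The difference quotient with its singularity removed is holomorphic on the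
      annulus, so its integrals over both circles agree; this yields Cauchy's formula there.\<close>
    define h where "h u = (if u = w then deriv f w else (f u - f w) / (u - w))" for u
    have "h holomorphic_on A" unfolding h_def by (rule pole_lemma_open[OF fA openA])
    then have eq: "contour_integral (circlepath 0 \<sigma>) h = contour_integral (circlepath 0 r) h"
      by (rule contour_integral_circlepath_annulus[OF _ openA ann pos(1,3)])
    have h: "contour_integral (circlepath 0 t) h = K t - f w * contour_integral (circlepath 0 t) (\<lambda>u. 1 / (u - w))"
      if t: "t = r \<or> t = \<sigma>" for t
    proof -
      have ne: "u \<noteq> w" if "u \<in> sphere 0 t" for u using that t r w by auto
      have tp: "0 < t" and tA: "sphere 0 t \<subseteq> A" using t pos sph by auto
      have i1: "(\<lambda>u. f u / (u - w)) contour_integrable_on circlepath 0 t"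
        by (rule cint) (use ne tp continuous_on_subset[OF contf tA] in \<open>auto intro!: continuous_intros\<close>)
      have i2: "(\<lambda>u. 1 / (u - w)) contour_integrable_on circlepath 0 t"
        by (rule cint) (use ne tp in \<open>auto intro!: continuous_intros\<close>)
      have "contour_integral (circlepath 0 t) h = contour_integral (circlepath 0 t) (\<lambda>u. f u / (u - w) - f w * (1 / (u - w)))"
        using ne tp by (intro contour_integral_cong) (auto simp: h_def diff_divide_distrib)
      also have "\<dots> = K t - f w * contour_integral (circlepath 0 t) (\<lambda>u. 1 / (u - w))"
        unfolding contour_integral_diff[OF i1 contour_integrable_lmul[OF i2]] contour_integral_lmul[OF i2] K_def ..
      finally show ?thesis .
    qed
    have "contour_integral (circlepath 0 r) (\<lambda>u. 1 / (u - w)) = 2 * of_real pi * \<i>"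
      using Cauchy_integral_circlepath[of 0 r "\<lambda>_. 1" w] r by (intro contour_integral_unique) auto
    moreover have "contour_integral (circlepath 0 \<sigma>) (\<lambda>u. 1 / (u - w)) = 0"
      by (rule contour_integral_unique, rule Cauchy_theorem_disc_simple[of _ 0 "cmod w"])
         (use w pos in \<open>auto intro!: holomorphic_intros\<close>)
    ultimately show ?thesis using eq h[of r] h[of \<sigma>] by simp
  qed
  obtain B where B: "0 < B" "\<And>u. u \<in> sphere 0 r \<Longrightarrow> cmod (f u) \<le> B"
    using compact_imp_bounded[OF compact_continuous_image[OF continuous_on_subset[OF contf sph(1)] compact_sphere]]
    unfolding bounded_pos by auto
  define d where "d = r - cmod w"
  have d: "0 < d" using r by (simp add: d_def)
  have r0: "cmod w / r < 1" using r pos by simp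
  define T where "T n u = (\<Sum>m<n. w ^ m * (f u / u ^ Suc m))" for n u
  have uni: "uniform_limit (sphere 0 r) T (\<lambda>u. f u / (u - w)) sequentially"
    unfolding uniform_limit_iff
  proof (intro allI impI)
    fix e :: real assume "0 < e"
    have "(\<lambda>n. B / d * (cmod w / r) ^ n) \<longlonglongrightarrow> B / d * 0"
      using r0 pos by (intro tendsto_mult tendsto_const LIMSEQ_power_zero) auto
    then have "\<forall>\<^sub>F n in sequentially. B / d * (cmod w / r) ^ n < e"
      using \<open>0 < e\<close> by (intro order_tendstoD) auto
    then show "\<forall>\<^sub>F n in sequentially. \<forall>u\<in>sphere 0 r. dist (T n u) (f u / (u - w)) < e"
    proof eventually_elim
      case (elim n)
      show ?case
      proof
        fix u :: complex assume u: "u \<in> sphere 0 r"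
        then have ur: "cmod u = r" by simp
        have u0: "u \<noteq> 0" "u \<noteq> w" using ur pos r by auto
        have "T n u = f u / u * (\<Sum>m<n. (w / u) ^ m)"
          by (simp add: T_def sum_distrib_left power_divide mult_ac)
        also have "(\<Sum>m<n. (w / u) ^ m) = ((w / u) ^ n - 1) / (w / u - 1)"
          using u0 by (intro geometric_sum) auto
        finally have T: "T n u = f u / u * (((w / u) ^ n - 1) / (w / u - 1))" .
        have "w / u - 1 = (w - u) / u" using u0 by (simp add: field_simps)
        then have "T n u = f u * ((w / u) ^ n - 1) / (w - u)" using T u0 by simp
        also have "\<dots> = f u / (u - w) - f u * (w / u) ^ n / (u - w)"
        proof -
          have "a * (q - 1) / (w - u) = a / (u - w) - a * q / (u - w)" for a q
            by (metis diff_divide_distrib minus_diff_eq minus_divide_divide mult_minus_right mult.right_neutral right_diff_distrib)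
          then show ?thesis .
        qed
        finally have "T n u - f u / (u - w) = - (f u * (w / u) ^ n / (u - w))" by simp
        then have "dist (T n u) (f u / (u - w)) = cmod (f u) * (cmod w / r) ^ n / cmod (u - w)"
          by (simp add: dist_norm norm_mult norm_divide norm_power ur power_divide)
        also have "\<dots> \<le> B * (cmod w / r) ^ n / d"
        proof (rule frac_le)
          show "d \<le> cmod (u - w)" using norm_triangle_ineq2[of u w] ur by (simp add: d_def)
        qed (use B u d pos in \<open>auto intro!: mult_right_mono\<close>)
        finally show "dist (T n u) (f u / (u - w)) < e" using elim by simp
      qed
    qed
  qed
  have int: "((\<lambda>u. w ^ m * (f u / u ^ Suc m)) has_contour_integral w ^ m * (laurent_coeff \<sigma> f m * (2 * of_real pi * \<i>))) (circlepath 0 r)" for m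
  proof -
    have "continuous_on (sphere 0 r) (\<lambda>u. f u / u ^ Suc m)"
      using pos by (intro continuous_intros continuous_on_subset[OF contf sph(1)]) auto
    then have "(\<lambda>u. f u / u ^ Suc m) contour_integrable_on circlepath 0 r" using pos by (intro cint) auto
    then have "((\<lambda>u. f u / u ^ Suc m) has_contour_integral laurent_coeff \<sigma> f m * (2 * of_real pi * \<i>)) (circlepath 0 r)"
      unfolding coeff unfolding laurent_coeff_def by (simp add: has_contour_integral_integral)
    then show ?thesis by (rule has_contour_integral_lmul)
  qed
  have intT: "(T n has_contour_integral (\<Sum>m<n. w ^ m * (laurent_coeff \<sigma> f m * (2 * of_real pi * \<i>)))) (circlepath 0 r)" for n
    unfolding T_def by (intro has_contour_integral_sum int) auto
  have "(\<lambda>n. contour_integral (circlepath 0 r) (T n)) \<longlonglongrightarrow> K r"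
    unfolding K_def
    by (rule contour_integral_uniform_limit_circlepath[OF _ uni]) (use intT pos in \<open>auto simp: contour_integrable_on_def intro!: always_eventually\<close>)
  then have "(\<lambda>n. (\<Sum>m<n. w ^ m * (laurent_coeff \<sigma> f m * (2 * of_real pi * \<i>)))) \<longlonglongrightarrow> K r"
    using contour_integral_unique[OF intT] by simp
  then have "(\<lambda>m. w ^ m * (laurent_coeff \<sigma> f m * (2 * of_real pi * \<i>))) sums K r" by (simp add: sums_def)
  from sums_divide[OF this, of "2 * of_real pi * \<i>"]
  have "(\<lambda>m. laurent_coeff \<sigma> f m * w ^ m) sums (K r / (2 * of_real pi * \<i>))" by (simp add: mult.commute)
  also have "K r / (2 * of_real pi * \<i>) = f w - principal_part \<sigma> f w"
  proof -
    have "K r = 2 * of_real pi * \<i> * f w + K \<sigma>" unfolding cauchy[symmetric] by simp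
    then show ?thesis by (simp add: principal_part_def K_def[symmetric] add_divide_distrib)
  qed
  finally show ?thesis .
qed

text \<open>Differentiation under the integral sign, for a density that is merely continuous on the
  circle.\<close>

lemma holomorphic_principal_part:
  assumes f: "continuous_on (sphere 0 \<sigma>) f" and \<sigma>: "0 < \<sigma>"
  shows "principal_part \<sigma> f holomorphic_on {w. \<sigma> < cmod w}"
proof -
  have op: "open {w :: complex. \<sigma> < cmod w}" by (intro open_Collect_less continuous_intros)
  have "(\<lambda>w. contour_integral (circlepath 0 \<sigma>) (\<lambda>u. f u / (u - w))) holomorphic_on {w. \<sigma> < cmod w}"
    unfolding holomorphic_on_open[OF op]
  proof safe
    fix w :: complex assume w: "\<sigma> < cmod w"
    have "((\<lambda>w. contour_integral (circlepath 0 \<sigma>) (\<lambda>u. f u / (u - w))) has_field_derivative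
        of_nat 1 * contour_integral (circlepath 0 \<sigma>) (\<lambda>u. f u / (u - w) ^ Suc 1)) (at w)"
    proof (rule Cauchy_next_derivative(2)[where S = "{w. \<sigma> < cmod w}" and B = "2 * pi * \<sigma>"])
      show "((\<lambda>u. f u / (u - v) ^ 1) has_contour_integral contour_integral (circlepath 0 \<sigma>) (\<lambda>u. f u / (u - v))) (circlepath 0 \<sigma>)"
        if "v \<in> {w. \<sigma> < cmod w} - path_image (circlepath 0 \<sigma>)" for v
      proof -
        have "(\<lambda>u. f u / (u - v)) contour_integrable_on circlepath 0 \<sigma>"
          by (rule contour_integrable_continuous_circlepath) (use that f \<sigma> in \<open>auto intro!: continuous_intros\<close>)
        then show ?thesis by (simp add: has_contour_integral_integral)
      qed
    qed (use w f \<sigma> op in \<open>auto simp: vector_derivative_circlepath norm_mult\<close>)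
    then show "\<exists>f'. ((\<lambda>w. contour_integral (circlepath 0 \<sigma>) (\<lambda>u. f u / (u - w))) has_field_derivative f') (at w)" by blast
  qed
  then show ?thesis unfolding principal_part_def[abs_def] by (intro holomorphic_intros) auto
qed

lemma uniform_limit_divide_const_bound:
  fixes f :: "nat \<Rightarrow> complex \<Rightarrow> complex"
  assumes f: "uniform_limit X f l sequentially" and b: "0 < b" "\<And>x. x \<in> X \<Longrightarrow> b \<le> cmod (h x)"
  shows "uniform_limit X (\<lambda>n x. f n x / h x) (\<lambda>x. l x / h x) sequentially"
  unfolding uniform_limit_iff
proof (intro allI impI)
  fix e :: real assume "0 < e"
  then have "\<forall>\<^sub>F n in sequentially. \<forall>x\<in>X. dist (f n x) (l x) < e * b"
    using f b unfolding uniform_limit_iff by simp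
  then show "\<forall>\<^sub>F n in sequentially. \<forall>x\<in>X. dist (f n x / h x) (l x / h x) < e"
  proof eventually_elim
    case (elim n)
    show ?case
    proof
      fix x assume x: "x \<in> X"
      have "0 < cmod (h x)" using b(1) b(2)[OF x] by linarith
      have "cmod (f n x - l x) < e * b" using elim x by (simp add: dist_norm)
      also have "\<dots> \<le> e * cmod (h x)" using b(2)[OF x] \<open>0 < e\<close> by (intro mult_left_mono) auto
      finally have "cmod (f n x - l x) < e * cmod (h x)" .
      then show "dist (f n x / h x) (l x / h x) < e"
        using \<open>0 < cmod (h x)\<close> by (simp add: dist_norm diff_divide_distrib[symmetric] norm_divide pos_divide_less_eq)
    qed
  qed
qed

section \<open>Laurent coefficients of the transported orthogonal expansion\<close>

context szego_measure
begin

text \<open>\<open>P k\<close> grows at most like \<open>cmod w ^ k\<close> at infinity, so moving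
  the contour outwards bounds the coefficient by \<open>C / R\<close> for every large
  \<open>R\<close>.\<close>

lemma laurent_coeff_P_eq_0:
  assumes \<sigma>: "1 < \<sigma>" and km: "k < m"
  shows "laurent_coeff \<sigma> (P k) m = 0"
proof -
  obtain b :: real where b: "0 < b" "((\<lambda>w. \<Psi> w / w) \<longlongrightarrow> of_real b) at_infinity" using \<Psi>_over_ident by blast
  have "\<forall>\<^sub>F w in at_infinity. cmod (\<Psi> w / w) < b + 1"
    using tendsto_norm[OF b(2)] b(1) by (intro order_tendstoD) auto
  then obtain R1 where R1: "\<And>w. R1 \<le> cmod w \<Longrightarrow> cmod (\<Psi> w / w) < b + 1" unfolding eventually_at_infinity by blast
  define l where "l = cmod (S None)"
  have l: "0 < l" using S_nonzero[of None] by (auto simp: l_def)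
  have "\<forall>\<^sub>F w in at_infinity. l / 2 < cmod (S\<Psi> w)"
    using tendsto_norm[OF S\<Psi>_at_infinity] l unfolding l_def[symmetric] by (intro order_tendstoD) auto
  then obtain R2 where R2: "\<And>w. R2 \<le> cmod w \<Longrightarrow> l / 2 < cmod (S\<Psi> w)" unfolding eventually_at_infinity by blast
  define D where "D = (\<Sum>i\<le>k. cmod (coeff (p k) i) * (b + 1) ^ i)"
  have D: "0 \<le> D" unfolding D_def using b by (intro sum_nonneg) auto
  define C where "C = D / (c k * (l / 2))"
  have C: "0 \<le> C" using D c_pos[of k] l by (simp add: C_def)
  define R0 where "R0 = max (max R1 R2) \<sigma>"
  have Pk: "cmod (P k w) \<le> C * cmod w ^ k" if w: "R0 \<le> cmod w" for w
  proof -
    have w1: "R1 \<le> cmod w" "R2 \<le> cmod w" "1 < cmod w" using w \<sigma> by (auto simp: R0_def)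
    have "cmod (\<Psi> w) \<le> (b + 1) * cmod w"
    proof -
      have "cmod (\<Psi> w) / cmod w < b + 1" using R1[OF w1(1)] by (simp add: norm_divide)
      then have "cmod (\<Psi> w) < (b + 1) * cmod w" using w1(3) by (subst (asm) pos_divide_less_eq) auto
      then show ?thesis by simp
    qed
    then have i: "cmod (\<Psi> w) ^ i \<le> (b + 1) ^ i * cmod w ^ k" if "i \<le> k" for i
    proof -
      have "cmod (\<Psi> w) ^ i \<le> ((b + 1) * cmod w) ^ i" using \<open>cmod (\<Psi> w) \<le> (b + 1) * cmod w\<close> by (intro power_mono) auto
      also have "\<dots> = (b + 1) ^ i * cmod w ^ i" by (simp add: power_mult_distrib)
      also have "\<dots> \<le> (b + 1) ^ i * cmod w ^ k" using w1 b that by (intro mult_left_mono power_increasing) auto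
      finally show ?thesis .
    qed
    have "cmod (poly (p k) (\<Psi> w)) \<le> (\<Sum>i\<le>k. cmod (coeff (p k) i) * ((b + 1) ^ i * cmod w ^ k))"
      unfolding poly_altdef degree_p
      by (rule sum_norm_le) (use i in \<open>auto simp: norm_mult norm_power intro!: mult_left_mono\<close>)
    also have "\<dots> = D * cmod w ^ k" by (simp add: D_def sum_distrib_right mult.assoc)
    finally have "cmod (P k w) \<le> D * cmod w ^ k / (c k * (l / 2))"
      unfolding P_def norm_divide norm_mult using c_pos[of k] l R2[OF w1(2)] D
      by (intro frac_le mult_mono) auto
    then show ?thesis by (simp add: C_def mult_ac)
  qed
  have bound: "cmod (laurent_coeff \<sigma> (P k) m) \<le> C / R" if R: "R0 \<le> R" for R
  proof -
    have R1: "1 < R" "\<sigma> \<le> R" using R \<sigma> by (auto simp: R0_def)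
    have hol: "(\<lambda>w. P k w / w ^ Suc m) holomorphic_on {w. 1 < cmod w}"
      by (intro holomorphic_intros holomorphic_P) auto
    have "laurent_coeff \<sigma> (P k) m = laurent_coeff R (P k) m"
      unfolding laurent_coeff_def
      by (subst contour_integral_circlepath_annulus[OF hol open_exterior_disc _ _ R1(2)]) (use \<sigma> R1 in auto)
    also have "cmod \<dots> \<le> C * R ^ k / R ^ m"
      by (rule laurent_coeff_bound)
         (use Pk R R1 in \<open>auto intro!: holomorphic_on_imp_continuous_on holomorphic_on_subset[OF holomorphic_P]\<close>)
    also have "\<dots> \<le> C / R"
    proof -
      have "R ^ k * R \<le> R ^ m" using R1 km power_increasing[of "Suc k" m R] by (simp add: mult.commute)
      then have "C * (R ^ k * R) \<le> C * R ^ m" using C by (intro mult_left_mono) auto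
      then show ?thesis using R1 by (simp add: field_simps)
    qed
    finally show ?thesis .
  qed
  have "((\<lambda>R. C / R) \<longlongrightarrow> 0) at_top" by real_asymp
  moreover have "\<forall>\<^sub>F R in at_top. cmod (laurent_coeff \<sigma> (P k) m) \<le> C / R"
    using eventually_ge_at_top[of R0] by eventually_elim (rule bound)
  ultimately have "cmod (laurent_coeff \<sigma> (P k) m) \<le> 0" by (intro tendsto_lowerbound) auto
  then show ?thesis by simp
qed

lemma continuous_on_P: "1 < r \<Longrightarrow> continuous_on (sphere 0 r) (P k)"
  by (intro holomorphic_on_imp_continuous_on holomorphic_on_subset[OF holomorphic_P]) auto

text \<open>The orthogonal expansion converges uniformly on the circle, where
  \<open>S\<Psi> w * w ^ Suc m\<close> is bounded away from 0. Hence it may be divided by this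
  function and integrated term by term.\<close>

lemma laurent_coeff_sums:
  assumes g: "g holomorphic_on dom \<rho>" and \<sigma>: "1 < \<sigma>" "\<sigma> < \<rho>"
  shows "(\<lambda>k. of_real (c k) * coefficient g k * laurent_coeff \<sigma> (P k) m) sums laurent_coeff \<sigma> (\<lambda>w. g (\<Psi> w) / S\<Psi> w) m"
proof -
  obtain l M where l: "0 < l" "0 < M" "\<And>w. cmod w = \<sigma> \<Longrightarrow> l \<le> cmod (S\<Psi> w) \<and> cmod (S\<Psi> w) \<le> M" by (rule S\<Psi>_bounds[OF \<sigma>(1)]) blast
  define T where "T n w = (\<Sum>k<n. coefficient g k * poly (p k) (\<Psi> w)) / (S\<Psi> w * w ^ Suc m)" for n w
  have uni: "uniform_limit (sphere 0 \<sigma>) T (\<lambda>w. g (\<Psi> w) / (S\<Psi> w * w ^ Suc m)) sequentially"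
    unfolding T_def
  proof (rule uniform_limit_divide_const_bound[OF orthogonal_expansion[OF g \<sigma>]])
    show "0 < l * \<sigma> ^ Suc m" using l \<sigma> by simp
    show "l * \<sigma> ^ Suc m \<le> cmod (S\<Psi> w * w ^ Suc m)" if "w \<in> sphere 0 \<sigma>" for w
      using that l \<sigma> by (auto simp: norm_mult norm_power intro!: mult_right_mono)
  qed
  have int: "((\<lambda>w. P k w / w ^ Suc m) has_contour_integral laurent_coeff \<sigma> (P k) m * (2 * of_real pi * \<i>)) (circlepath 0 \<sigma>)" for k
  proof -
    have "(\<lambda>w. P k w / w ^ Suc m) contour_integrable_on circlepath 0 \<sigma>"
      by (rule contour_integrable_continuous_circlepath)
         (use \<sigma> in \<open>auto intro!: continuous_on_divide continuous_on_mult continuous_on_power continuous_on_id continuous_on_P\<close>)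
    then show ?thesis unfolding laurent_coeff_def by (simp add: has_contour_integral_integral)
  qed
  have intT: "(T n has_contour_integral (\<Sum>k<n. of_real (c k) * coefficient g k * (laurent_coeff \<sigma> (P k) m * (2 * of_real pi * \<i>)))) (circlepath 0 \<sigma>)" for n
  proof (rule has_contour_integral_eq)
    show "((\<lambda>w. \<Sum>k<n. of_real (c k) * coefficient g k * (P k w / w ^ Suc m)) has_contour_integral
       (\<Sum>k<n. of_real (c k) * coefficient g k * (laurent_coeff \<sigma> (P k) m * (2 * of_real pi * \<i>)))) (circlepath 0 \<sigma>)"
      by (intro has_contour_integral_sum has_contour_integral_lmul int) auto
    fix w :: complex assume "w \<in> path_image (circlepath 0 \<sigma>)"
    then have w: "1 < cmod w" using \<sigma> by auto
    show "(\<Sum>k<n. of_real (c k) * coefficient g k * (P k w / w ^ Suc m)) = T n w"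
      unfolding T_def sum_divide_distrib
    proof (rule sum.cong)
      fix k
      show "of_real (c k) * coefficient g k * (P k w / w ^ Suc m) = coefficient g k * poly (p k) (\<Psi> w) / (S\<Psi> w * w ^ Suc m)"
        using S\<Psi>_nonzero[OF w] by (simp add: poly_p_eq_P[OF w])
    qed simp
  qed
  have "(\<lambda>n. contour_integral (circlepath 0 \<sigma>) (T n)) \<longlonglongrightarrow> contour_integral (circlepath 0 \<sigma>) (\<lambda>w. g (\<Psi> w) / (S\<Psi> w * w ^ Suc m))"
    by (rule contour_integral_uniform_limit_circlepath[OF _ uni])
       (use intT \<sigma> in \<open>auto simp: contour_integrable_on_def intro!: always_eventually\<close>)
  then have "(\<lambda>k. of_real (c k) * coefficient g k * (laurent_coeff \<sigma> (P k) m * (2 * of_real pi * \<i>))) sums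
      contour_integral (circlepath 0 \<sigma>) (\<lambda>w. g (\<Psi> w) / (S\<Psi> w * w ^ Suc m))"
    unfolding contour_integral_unique[OF intT] sums_def .
  from sums_divide[OF this, of "2 * of_real pi * \<i>"] show ?thesis
    unfolding laurent_coeff_def by (simp add: mult.assoc)
qed

text \<open>The matrix with entries \<open>laurent_coeff \<sigma> (P k) m\<close> is triangular and asymptotically the identity, so it does
  not change the leading behaviour of a sequence whose quotients converge.\<close>

lemma laurent_coeff_asymptotics:
  assumes g: "g holomorphic_on dom \<rho>" and \<sigma>: "1 < \<sigma>" "\<sigma> < \<rho>" "\<sigma> < cmod \<tau>"
    and nz: "\<forall>\<^sub>F n in sequentially. coefficient g n \<noteq> 0"
    and lim: "(\<lambda>n. of_real (c n) * coefficient g n / (of_real (c (Suc n)) * coefficient g (Suc n))) \<longlonglongrightarrow> \<tau>"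
  shows "(\<lambda>m. laurent_coeff \<sigma> (\<lambda>w. g (\<Psi> w) / S\<Psi> w) m / (of_real (c m) * coefficient g m)) \<longlonglongrightarrow> 1"
proof -
  define a where "a n = of_real (c n) * coefficient g n" for n
  define b where "b = laurent_coeff \<sigma> (\<lambda>w. g (\<Psi> w) / S\<Psi> w)"
  obtain t where t: "\<sigma> < t" "t < cmod \<tau>" using dense[OF \<sigma>(3)] by blast
  \<comment> \<open>From \<open>N\<close> on the quotients of \<open>a\<close> exceed
    \<open>t\<close> in modulus, so the numbers \<open>cmod (a n) * \<sigma> ^ n\<close> decay
    geometrically with ratio \<open>\<theta>\<close>.\<close>
  define \<theta> where "\<theta> = \<sigma> / t"
  have \<theta>: "0 < \<theta>" "\<theta> < 1" using t \<sigma> by (auto simp: \<theta>_def)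
  have "\<forall>\<^sub>F n in sequentially. t < cmod (a n / a (Suc n))"
    using tendsto_norm[OF lim] t(2) unfolding a_def by (rule order_tendstoD)
  then obtain N where N: "\<And>n. n \<ge> N \<Longrightarrow> t < cmod (a n / a (Suc n)) \<and> coefficient g n \<noteq> 0"
    using nz unfolding eventually_sequentially by (metis nat_le_linear order_trans)
  have decay: "cmod (a (i + m)) * \<sigma> ^ (i + m) \<le> cmod (a m) * \<sigma> ^ m * \<theta> ^ i" if "m \<ge> N" for i m
  proof (induction i)
    case (Suc i)
    have "t < cmod (a (i + m)) / cmod (a (Suc (i + m)))" using N[of "i + m"] that by (simp add: norm_divide)
    moreover have "0 < cmod (a (Suc (i + m)))" using N[of "Suc (i + m)"] that c_pos[of "Suc (i + m)"] by (simp add: a_def)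
    ultimately have "t * cmod (a (Suc (i + m))) \<le> cmod (a (i + m))" by (simp add: pos_less_divide_eq)
    then have "cmod (a (Suc (i + m))) \<le> cmod (a (i + m)) / t" using t \<sigma> by (simp add: field_simps)
    then have "cmod (a (Suc (i + m))) * (\<sigma> ^ (i + m) * \<sigma>) \<le> cmod (a (i + m)) / t * (\<sigma> ^ (i + m) * \<sigma>)"
      using \<sigma> by (intro mult_right_mono) auto
    also have "\<dots> = cmod (a (i + m)) * \<sigma> ^ (i + m) * \<theta>" by (simp add: \<theta>_def)
    also have "\<dots> \<le> cmod (a m) * \<sigma> ^ m * \<theta> ^ i * \<theta>" using Suc.IH \<theta> by (intro mult_right_mono) auto
    finally show ?case by (simp add: mult_ac)
  qed simp
  have key: "\<forall>\<^sub>F m in sequentially. cmod (b m - a m) \<le> cmod (a m) * (e / (1 - \<theta>))" if e: "0 < e" for e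
  proof -
    obtain K where K: "\<And>n w. n \<ge> K \<Longrightarrow> cmod w = \<sigma> \<Longrightarrow> cmod (P n w - w ^ n) \<le> e * \<sigma> ^ n"
      using P_asymptotics[OF \<sigma>(1) e] unfolding eventually_sequentially by auto
    show ?thesis
      using eventually_ge_at_top[of "max N K"]
    proof eventually_elim
      case (elim m)
      \<comment> \<open>The \<open>k\<close>-th contribution to \<open>b m - a m\<close>:
        \<open>a k\<close> times the deviation of the matrix from the identity. It vanishes for
        \<open>k < m\<close>. Otherwise the deviation is at most
        \<open>e * \<sigma> ^ k / \<sigma> ^ m\<close>, and \<open>decay\<close> leaves a geometric
        series.\<close>
      define x where "x k = a k * laurent_coeff \<sigma> (P k) m - (if k = m then a m else 0)" for k
      have x: "x sums (b m - a m)"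
        unfolding x_def a_def b_def
        by (intro sums_diff laurent_coeff_sums[OF g \<sigma>(1,2)] sums_single[of m "\<lambda>_. of_real (c m) * coefficient g m", simplified])
      have x0: "x k = 0" if "k < m" for k
        using that laurent_coeff_P_eq_0[OF \<sigma>(1) that] by (simp add: x_def)
      then have xs: "(\<lambda>i. x (i + m)) sums (b m - a m)" using x sums_zero_iff_shift[of m x] by blast
      have le: "cmod (x (i + m)) \<le> cmod (a m) * e * \<theta> ^ i" for i
      proof -
        define k where "k = i + m"
        have k: "m \<le> k" "K \<le> k" using elim by (auto simp: k_def)
        have "laurent_coeff \<sigma> (P k) m - (if k = m then 1 else 0) = laurent_coeff \<sigma> (\<lambda>w. P k w - w ^ k) m"
        proof -
          have "(\<lambda>w. P k w / w ^ Suc m) contour_integrable_on circlepath 0 \<sigma>" "(\<lambda>w. w ^ k / w ^ Suc m) contour_integrable_on circlepath 0 \<sigma>"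
            using \<sigma> by (auto intro!: contour_integrable_continuous_circlepath continuous_on_divide continuous_on_mult
                continuous_on_power continuous_on_id continuous_on_P)
          then have "laurent_coeff \<sigma> (\<lambda>w. P k w - w ^ k) m = laurent_coeff \<sigma> (P k) m - laurent_coeff \<sigma> (\<lambda>w. w ^ k) m"
            unfolding laurent_coeff_def by (simp only: contour_integral_diff diff_divide_distrib)
          then show ?thesis using laurent_coeff_power[of \<sigma> m k] k \<sigma> by simp
        qed
        moreover have "cmod (laurent_coeff \<sigma> (\<lambda>w. P k w - w ^ k) m) \<le> e * \<sigma> ^ k / \<sigma> ^ m"
          by (rule laurent_coeff_bound)
             (use \<sigma> K k in \<open>auto intro!: continuous_on_diff continuous_on_power continuous_on_id continuous_on_P\<close>)
        ultimately have l: "cmod (laurent_coeff \<sigma> (P k) m - (if k = m then 1 else 0)) \<le> e * \<sigma> ^ k / \<sigma> ^ m" by simp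
        have "x k = a k * (laurent_coeff \<sigma> (P k) m - (if k = m then 1 else 0))" by (simp add: x_def algebra_simps)
        then have "cmod (x k) \<le> cmod (a k) * (e * \<sigma> ^ k / \<sigma> ^ m)" using l by (simp only: norm_mult) (intro mult_left_mono, auto)
        also have "\<dots> = cmod (a k) * \<sigma> ^ k * (e / \<sigma> ^ m)" by simp
        also have "\<dots> \<le> cmod (a m) * \<sigma> ^ m * \<theta> ^ i * (e / \<sigma> ^ m)"
          unfolding k_def using decay[of m i] elim e \<sigma> by (intro mult_right_mono) auto
        also have "\<dots> = cmod (a m) * e * \<theta> ^ i" using \<sigma> by simp
        finally show ?thesis by (simp add: k_def)
      qed
      have "(\<lambda>i. cmod (a m) * e * \<theta> ^ i) sums (cmod (a m) * e * (1 / (1 - \<theta>)))"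
        using \<theta> by (intro sums_mult geometric_sums) auto
      then show ?case using norm_sums_le[OF xs _ le] by simp
    qed
  qed
  show ?thesis
    unfolding tendsto_iff
  proof (intro allI impI)
    fix e :: real assume e: "0 < e"
    define e' where "e' = e / 2 * (1 - \<theta>)"
    have e': "0 < e'" "e' / (1 - \<theta>) < e"
  proof -
    show "0 < e'" using e \<theta> by (simp add: e'_def)
    have "1 - \<theta> \<noteq> 0" using \<theta> by simp
    then have "e' / (1 - \<theta>) = e / 2" unfolding e'_def by (rule nonzero_mult_div_cancel_right)
    then show "e' / (1 - \<theta>) < e" using e by simp
  qed
    have "\<forall>\<^sub>F m in sequentially. dist (b m / a m) 1 < e"
      using key[OF e'(1)] nz
    proof eventually_elim
      case (elim m)
      have am: "a m \<noteq> 0" using elim(2) c_pos[of m] by (simp add: a_def)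
      then have "b m / a m - 1 = (b m - a m) / a m" by (simp add: field_simps)
      then have "dist (b m / a m) 1 = cmod (b m - a m) / cmod (a m)" by (simp add: dist_norm norm_divide)
      also have "\<dots> \<le> e' / (1 - \<theta>)" using elim(1) am by (simp add: pos_divide_le_eq mult.commute)
      also have "\<dots> < e" by (rule e')
      finally show ?case .
    qed
    then show "\<forall>\<^sub>F m in sequentially. dist (laurent_coeff \<sigma> (\<lambda>w. g (\<Psi> w) / S\<Psi> w) m / (of_real (c m) * coefficient g m)) 1 < e"
      by (simp add: a_def b_def)
  qed
qed

end

section \<open>The inverse theorem\<close>

context szego_measure
begin

text \<open>If the radius were larger, the coefficients would decay at least like
  \<open>1 / r ^ n\<close> and at most like \<open>1 / q ^ n\<close> with
  \<open>q < r\<close>.\<close>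

lemma extension_radius_le:
  assumes g: "g holomorphic_on dom \<rho>" and \<rho>: "1 < \<rho>"
    and nz: "\<forall>\<^sub>F n in sequentially. coefficient g n \<noteq> 0"
    and lim: "(\<lambda>n. of_real (c n) * coefficient g n / (of_real (c (Suc n)) * coefficient g (Suc n))) \<longlonglongrightarrow> \<tau>"
  shows "\<rho> \<le> cmod \<tau>"
proof (rule ccontr)
  assume "\<not> \<rho> \<le> cmod \<tau>"
  then obtain r where r: "max 1 (cmod \<tau>) < r" "r < \<rho>" using dense[of "max 1 (cmod \<tau>)" \<rho>] \<rho> by auto
  obtain q where q: "max 1 (cmod \<tau>) < q" "q < r" using dense[OF r(1)] by blast
  have pos: "1 < r" "1 < q" "cmod \<tau> < q" using r q by auto
  define a where "a n = of_real (c n) * coefficient g n" for n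
  obtain C where C: "\<forall>\<^sub>F n in sequentially. cmod (a n) * r ^ n \<le> C"
    unfolding a_def by (rule coefficient_bound[OF g pos(1) r(2)])
  have "\<forall>\<^sub>F n in sequentially. a n \<noteq> 0"
    using nz by eventually_elim (use c_pos in \<open>simp add: a_def less_imp_neq[THEN not_sym]\<close>)
  then obtain b where b: "0 < b" "\<forall>\<^sub>F n in sequentially. b \<le> cmod (a n) * q ^ n"
    using ratio_limit_lower_bound[of a \<tau> q] lim pos(3) unfolding a_def by blast
  obtain N where N: "C / b < (r / q) ^ N" using real_arch_pow[of "r / q" "C / b"] q pos by auto
  have "\<forall>\<^sub>F n in sequentially. False"
    using C b(2) eventually_ge_at_top[of N]
  proof eventually_elim
    case (elim n)
    have "C / b < (r / q) ^ n"
    proof -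
      have "1 \<le> r / q" using q pos by (simp add: field_simps)
      from power_increasing[OF elim(3) this] N show ?thesis by linarith
    qed
    then have "C < b * (r / q) ^ n" using b(1) by (simp add: pos_divide_less_eq mult.commute)
    also have "\<dots> \<le> cmod (a n) * q ^ n * (r / q) ^ n"
      using elim(2) q pos by (intro mult_right_mono) auto
    also have "\<dots> = cmod (a n) * r ^ n" using pos by (simp add: power_divide)
    finally show ?case using elim(1) by simp
  qed
  then show False by simp
qed

lemma \<Psi>_in_frontier_dom:
  assumes \<tau>: "1 < cmod \<tau>"
  shows "\<Psi> \<tau> \<in> frontier (dom (cmod \<tau>))"
proof -
  \<comment> \<open>\<open>\<tau>\<close> is approached radially from inside; this \<open>e\<close>
    keeps \<open>cmod (u n)\<close> above 1, where \<open>\<Psi>\<close> inverts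
    \<open>\<Phi>\<close>, because \<open>n + 2\<close> exceeds 1.\<close>
  define e where "e = 1 - 1 / cmod \<tau>"
  have \<tau>0: "0 < cmod \<tau>" using \<tau> by linarith
  have e: "0 < e" "e < 1" "(1 - e) * cmod \<tau> = 1"
    using \<tau> \<tau>0 by (auto simp: e_def)
  define u where "u n = of_real (1 - e / real (n + 2)) * \<tau>" for n
  have cu: "1 < cmod (u n)" "cmod (u n) < cmod \<tau>" for n
  proof -
    have "e * 1 < e * real (n + 2)" using e by (intro mult_strict_left_mono) auto
    then have "e / real (n + 2) < e" by (subst pos_divide_less_eq) auto
    moreover have "0 < e / real (n + 2)" using e by simp
    ultimately have x: "1 - e < 1 - e / real (n + 2)" "1 - e / real (n + 2) < 1" "0 < 1 - e / real (n + 2)" using e by linarith+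
    have "cmod (u n) = (1 - e / real (n + 2)) * cmod \<tau>" unfolding u_def norm_mult norm_of_real using x by simp
    then show "1 < cmod (u n)" "cmod (u n) < cmod \<tau>"
      using mult_strict_right_mono[OF x(1) \<tau>0] mult_strict_right_mono[OF x(2) \<tau>0] e(3) by simp_all
  qed
  have "(\<lambda>n. 1 - e / real (n + 2)) \<longlonglongrightarrow> 1" by real_asymp
  then have "(\<lambda>n. of_real (1 - e / real (n + 2)) * \<tau>) \<longlonglongrightarrow> of_real 1 * \<tau>" by (intro tendsto_intros)
  then have "u \<longlonglongrightarrow> \<tau>" by (simp add: u_def[abs_def])
  moreover have "isCont \<Psi> \<tau>"
    using holomorphic_on_imp_differentiable_at[OF holomorphic_\<Psi> open_exterior_disc, of \<tau>] \<tau>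
    by (simp add: field_differentiable_imp_continuous_at)
  ultimately have "(\<lambda>n. \<Psi> (u n)) \<longlonglongrightarrow> \<Psi> \<tau>" by (rule isCont_tendsto_compose[rotated])
  moreover have "\<Psi> (u n) \<in> dom (cmod \<tau>)" for n using cu[of n] by (simp add: \<Psi>_in_dom_iff)
  ultimately have "\<Psi> \<tau> \<in> closure (dom (cmod \<tau>))" unfolding closure_sequential by (intro exI[of _ "\<lambda>n. \<Psi> (u n)"]) blast
  moreover have "\<Psi> \<tau> \<notin> dom (cmod \<tau>)" using \<tau> by (simp add: \<Psi>_in_dom_iff)
  ultimately show ?thesis using open_dom[OF \<tau>] by (simp add: frontier_def interior_open)
qed

lemma singularity_of_ratio_limit:
  assumes F: "F analytic_on E"
    and nz: "\<forall>\<^sub>F n in sequentially. coefficient F n \<noteq> 0"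
    and lim0: "(\<lambda>n. coefficient F n / coefficient F (Suc n)) \<longlonglongrightarrow> \<tau>"
  shows "singularity E \<Phi> F (\<Psi> \<tau>) \<and> rho0 E \<Phi> F = ereal (cmod \<tau>)"
proof -
  have lim: "(\<lambda>n. of_real (c n) * coefficient F n / (of_real (c (Suc n)) * coefficient F (Suc n))) \<longlonglongrightarrow> \<tau>"
    using tendsto_mult[OF tendsto_of_real[OF c_ratio] lim0] by (simp add: times_divide_times_eq)
  obtain U where U: "open U" "E \<subseteq> U" "F holomorphic_on U" using F unfolding analytic_on_holomorphic by blast
  obtain \<rho> where \<rho>: "1 < \<rho>" "dom \<rho> \<subseteq> U" using dom_subset_nbhd[OF U(1,2)] by blast
  have F\<rho>: "F holomorphic_on dom \<rho>" using holomorphic_on_subset[OF U(3) \<rho>(2)] .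
  have \<rho>\<tau>: "\<rho> \<le> cmod \<tau>" by (rule extension_radius_le[OF F\<rho> \<rho>(1) nz lim])
  then have \<tau>1: "1 < cmod \<tau>" using \<rho> by linarith
  \<comment> \<open>Laurent coefficients are taken at radius \<open>\<sigma>\<close>; the smaller
    \<open>s0\<close> leaves an open annulus around that circle on which \<open>f\<close> is
    holomorphic.\<close>
  obtain \<sigma> where \<sigma>: "1 < \<sigma>" "\<sigma> < \<rho>" using dense[OF \<rho>(1)] by blast
  obtain s0 where s0: "1 < s0" "s0 < \<sigma>" using dense[OF \<sigma>(1)] by blast
  define f where "f w = F (\<Psi> w) / S\<Psi> w" for w
  define b where "b = laurent_coeff \<sigma> f"
  define f_minus where "f_minus = principal_part \<sigma> f"
  define f_plus where "f_plus w = (\<Sum>m. b m * w ^ m)" for w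

  have holf: "f holomorphic_on {w. s0 < cmod w \<and> cmod w < \<rho>}"
    unfolding f_def
  proof (intro holomorphic_on_divide holomorphic_on_compose_gen[OF _ F\<rho>, unfolded o_def])
    show "\<Psi> holomorphic_on {w. s0 < cmod w \<and> cmod w < \<rho>}" "S\<Psi> holomorphic_on {w. s0 < cmod w \<and> cmod w < \<rho>}"
      using s0 by (auto intro: holomorphic_on_subset[OF holomorphic_\<Psi>] holomorphic_on_subset[OF holomorphic_S\<Psi>])
  qed (use s0 S\<Psi>_nonzero in \<open>auto simp: \<Psi>_in_dom_iff\<close>)
  have split: "(\<lambda>m. b m * w ^ m) sums (f w - f_minus w)" if "\<sigma> < cmod w" "cmod w < \<rho>" for w
    unfolding b_def f_minus_def by (rule laurent_split[OF holf]) (use s0 that in auto)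
  have "sphere 0 \<sigma> \<subseteq> {w. s0 < cmod w \<and> cmod w < \<rho>}" using s0 \<sigma> by auto
  then have hol_minus: "f_minus holomorphic_on {w. \<sigma> < cmod w}"
    unfolding f_minus_def using \<sigma>
    by (intro holomorphic_principal_part holomorphic_on_imp_continuous_on holomorphic_on_subset[OF holf]) auto

  have ba: "(\<lambda>m. b m / (of_real (c m) * coefficient F m)) \<longlonglongrightarrow> 1"
    unfolding b_def f_def by (rule laurent_coeff_asymptotics[OF F\<rho> \<sigma> _ nz lim]) (use \<sigma> \<rho>\<tau> in linarith)
  have b_nz: "\<forall>\<^sub>F m in sequentially. b m \<noteq> 0"
    using tendsto_imp_eventually_ne[OF ba one_neq_zero] by eventually_elim auto
  have b_lim: "(\<lambda>m. b m / b (Suc m)) \<longlonglongrightarrow> \<tau>"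
  proof -
    define a where "a n = of_real (c n) * coefficient F n" for n
    have "(\<lambda>m. (b m / a m) / (b (Suc m) / a (Suc m)) * (a m / a (Suc m))) \<longlonglongrightarrow> 1 / 1 * \<tau>"
      unfolding a_def by (intro tendsto_mult tendsto_divide ba LIMSEQ_Suc[OF ba] lim) auto
    moreover have "\<forall>\<^sub>F m in sequentially. a m \<noteq> 0"
      using nz by eventually_elim (use c_pos in \<open>simp add: a_def less_imp_neq[THEN not_sym]\<close>)
    then have "\<forall>\<^sub>F m in sequentially. (b m / a m) / (b (Suc m) / a (Suc m)) * (a m / a (Suc m)) = b m / b (Suc m)"
      using eventually_sequentially_Suc[of "\<lambda>m. a m \<noteq> 0", THEN iffD2, OF \<open>\<forall>\<^sub>F m in sequentially. a m \<noteq> 0\<close>]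
      by eventually_elim simp
    ultimately show ?thesis by (subst (asm) tendsto_cong) simp_all
  qed
  have plus_sums: "(\<lambda>m. b m * w ^ m) sums f_plus w" if "cmod w < cmod \<tau>" for w
    using ratio_limit_summable[OF b_lim that] unfolding f_plus_def by (rule summable_sums)
  have hol_plus: "f_plus holomorphic_on ball 0 (cmod \<tau>)"
    by (rule power_series_holomorphic[where a = b]) (use plus_sums in auto)

  \<comment> \<open>Outside \<open>dom \<rho>\<close> the function is rebuilt from the Laurent
    splitting: \<open>f_plus\<close> converges up to radius \<open>cmod \<tau>\<close>, and
    \<open>f_minus\<close> is holomorphic beyond radius \<open>\<sigma>\<close>. By
    \<open>G_eq\<close> the two formulas agree on the overlap.\<close>
  define G where "G z = (if z \<in> dom \<rho> then F z else S (Some z) * (f_plus (\<Phi> z) + f_minus (\<Phi> z)))" for z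
  have G_eq: "G z = S (Some z) * (f_plus (\<Phi> z) + f_minus (\<Phi> z))" if z: "z \<notin> E" "\<sigma> < cmod (\<Phi> z)" for z
  proof (cases "z \<in> dom \<rho>")
    case True
    then have "cmod (\<Phi> z) < \<rho>" using z by (simp add: in_dom_iff)
    then have "f_plus (\<Phi> z) = f (\<Phi> z) - f_minus (\<Phi> z)"
      using split[OF z(2)] plus_sums[of "\<Phi> z"] \<rho>\<tau> sums_unique2 by fastforce
    moreover have "S (Some z) \<noteq> 0" using z by (intro S_nonzero) auto
    ultimately show ?thesis using True z by (simp add: G_def f_def S\<Psi>_def \<Psi>_\<Phi>)
  qed (simp add: G_def)
  define X where "X = {z \<in> - E. \<sigma> < cmod (\<Phi> z)} \<inter> dom (cmod \<tau>)"
  have X: "open X" "X \<subseteq> - E" "\<And>z. z \<in> X \<Longrightarrow> \<sigma> < cmod (\<Phi> z) \<and> cmod (\<Phi> z) < cmod \<tau>"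
    unfolding X_def using open_exterior_level open_dom[OF \<tau>1] by (auto simp: in_dom_iff)
  have holG: "G holomorphic_on dom (cmod \<tau>)"
  proof -
    have \<Phi>X: "\<Phi> holomorphic_on X" by (rule holomorphic_on_subset[OF holomorphic_\<Phi> X(2)])
    have "(\<lambda>z. S (Some z) * (f_plus (\<Phi> z) + f_minus (\<Phi> z))) holomorphic_on X"
      by (intro holomorphic_on_mult holomorphic_on_add holomorphic_on_subset[OF holomorphic_S_Some X(2)]
          holomorphic_on_compose_gen[OF \<Phi>X hol_plus, unfolded o_def] holomorphic_on_compose_gen[OF \<Phi>X hol_minus, unfolded o_def])
         (use X(3) in auto)
    then have 1: "G holomorphic_on X"
      by (rule holomorphic_transform) (use X G_eq in auto)
    have 2: "G holomorphic_on dom \<rho>"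
      by (rule holomorphic_transform[OF F\<rho>]) (simp add: G_def)
    have "dom (cmod \<tau>) = dom \<rho> \<union> X"
      using \<sigma> \<rho>\<tau> dom_mono[OF \<rho>\<tau>] by (auto simp: X_def dom_def)
    then show ?thesis using holomorphic_on_Un[OF 2 1 open_dom[OF \<rho>(1)] X(1)] by simp
  qed
  have extG: "holomorphic_extension E F (canonical_domain E \<Phi> (cmod \<tau>)) G"
    unfolding holomorphic_extension_def canonical_domain_eq_dom[OF \<tau>1]
    using holG open_dom[OF \<rho>(1)] E_subset_dom[of \<rho>] by (auto simp: G_def intro!: exI[of _ "dom \<rho>"])

  have rho0: "rho0 E \<Phi> F = ereal (cmod \<tau>)"
    unfolding rho0_def
  proof (rule Sup_eqI)
    fix y assume "y \<in> {ereal \<rho> |\<rho>. 1 < \<rho> \<and> (\<exists>G. holomorphic_extension E F (canonical_domain E \<Phi> \<rho>) G)}"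
    then obtain \<rho>' g where y: "y = ereal \<rho>'" "1 < \<rho>'" "holomorphic_extension E F (canonical_domain E \<Phi> \<rho>') g" by blast
    then have g: "g holomorphic_on dom \<rho>'" and gF: "\<And>z. z \<in> E \<Longrightarrow> g z = F z"
      unfolding holomorphic_extension_def canonical_domain_eq_dom[OF y(2)] by blast+
    \<comment> \<open>Any extension agrees with \<open>F\<close> on \<open>E\<close> and so has the
      same coefficients, whose quotients limit its radius.\<close>
    have "coefficient g n = coefficient F n" for n by (rule inner_product_cong) (rule gF)
    then have "\<rho>' \<le> cmod \<tau>" using extension_radius_le[OF g y(2)] nz lim by simp
    then show "y \<le> ereal (cmod \<tau>)" using y by simp
  next
    fix y assume "\<And>z. z \<in> {ereal \<rho> |\<rho>. 1 < \<rho> \<and> (\<exists>G. holomorphic_extension E F (canonical_domain E \<Phi> \<rho>) G)} \<Longrightarrow> z \<le> y"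
    then show "ereal (cmod \<tau>) \<le> y" using extG \<tau>1 by blast
  qed

  have "\<not> (\<exists>V H. open V \<and> \<Psi> \<tau> \<in> V \<and> H holomorphic_on V \<and> (\<forall>z \<in> V \<inter> dom (cmod \<tau>). H z = G z))"
  proof
    assume "\<exists>V H. open V \<and> \<Psi> \<tau> \<in> V \<and> H holomorphic_on V \<and> (\<forall>z \<in> V \<inter> dom (cmod \<tau>). H z = G z)"
    then obtain V H where V: "open V" "\<Psi> \<tau> \<in> V" "H holomorphic_on V" "\<And>z. z \<in> V \<Longrightarrow> z \<in> dom (cmod \<tau>) \<Longrightarrow> H z = G z" by blast
    define W where "W = {w. \<sigma> < cmod w} \<inter> \<Psi> -` V"
    have sub: "{w. \<sigma> < cmod w} \<subseteq> {w. 1 < cmod w}" using \<sigma> by auto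
    have "open W" unfolding W_def
      by (rule continuous_open_preimage[OF holomorphic_on_imp_continuous_on[OF holomorphic_on_subset[OF holomorphic_\<Psi> sub]]
            open_exterior_disc V(1)])
    moreover have "\<tau> \<in> W" using V \<sigma> \<rho>\<tau> by (simp add: W_def)
    ultimately obtain \<epsilon> where \<epsilon>: "0 < \<epsilon>" "ball \<tau> \<epsilon> \<subseteq> W" unfolding open_contains_ball by blast
    have W: "1 < cmod w" "\<sigma> < cmod w" "\<Psi> w \<in> V" if "w \<in> ball \<tau> \<epsilon>" for w
      using that \<epsilon>(2) \<sigma> by (auto simp: W_def)
    show False
    proof (rule fabry_quotient[OF b_nz b_lim _ \<epsilon>(1)])
      show "\<tau> \<noteq> 0" using \<tau>1 by auto
      have sub: "\<Psi> holomorphic_on ball \<tau> \<epsilon>" "S\<Psi> holomorphic_on ball \<tau> \<epsilon>" "f_minus holomorphic_on ball \<tau> \<epsilon>"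
        using W by (auto intro: holomorphic_on_subset[OF holomorphic_\<Psi>] holomorphic_on_subset[OF holomorphic_S\<Psi>] holomorphic_on_subset[OF hol_minus])
      \<comment> \<open>A local extension \<open>H\<close> of \<open>G\<close> at
        \<open>\<Psi> \<tau>\<close>, transported by \<open>\<Psi>\<close> and freed of
        \<open>f_minus\<close>, would continue the power series \<open>f_plus\<close> across
        \<open>\<tau>\<close>.\<close>
      show "(\<lambda>w. H (\<Psi> w) / S\<Psi> w - f_minus w) holomorphic_on ball \<tau> \<epsilon>"
        by (intro holomorphic_on_diff holomorphic_on_divide sub holomorphic_on_compose_gen[OF sub(1) V(3), unfolded o_def])
           (use W S\<Psi>_nonzero in auto)
      fix w assume w: "w \<in> ball \<tau> \<epsilon>" "cmod w < cmod \<tau>"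
      note W = W[OF w(1)]
      have "H (\<Psi> w) = G (\<Psi> w)" using V(4)[OF W(3)] w W by (simp add: \<Psi>_in_dom_iff)
      also have "\<dots> = S\<Psi> w * (f_plus w + f_minus w)" using G_eq[of "\<Psi> w"] W by (simp add: S\<Psi>_def)
      finally have "H (\<Psi> w) / S\<Psi> w - f_minus w = f_plus w" using S\<Psi>_nonzero[OF W(1)] by simp
      then show "(\<lambda>n. b n * w ^ n) sums (H (\<Psi> w) / S\<Psi> w - f_minus w)" using plus_sums[OF w(2)] by simp
    qed
  qed
  then have "singularity E \<Phi> F (\<Psi> \<tau>)"
    unfolding singularity_def
    using rho0 \<tau>1 extG \<Psi>_in_frontier_dom[OF \<tau>1] canonical_domain_eq_dom[OF \<tau>1] by (intro exI[of _ "cmod \<tau>"]) auto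
  then show ?thesis using rho0 by simp
qed

end

text \<open>The convergence of the quotients presupposes nonzero denominators for large
  \<open>n\<close>. Since division by zero yields 0 here, this is stated as a separate
  assumption.\<close>

theorem theorem2:
  fixes E :: "complex set" and \<Phi> \<Psi> F :: "complex \<Rightarrow> complex"
    and \<mu> :: "complex measure" and p :: "nat \<Rightarrow> complex poly" and \<tau> :: complex
  assumes "admissible E \<Phi> \<Psi>"
    and "F analytic_on E"
    and "\<mu> \<in> szego_class E \<Phi>"
    and "orthonormal_polynomials E \<mu> p"
    and "\<forall>\<^sub>F n in sequentially. inner_product E \<mu> F (poly (p n)) \<noteq> 0"
    and "(\<lambda>n. inner_product E \<mu> F (poly (p n)) / inner_product E \<mu> F (poly (p (Suc n)))) \<longlonglongrightarrow> \<tau>"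
  shows "singularity E \<Phi> F (\<Psi> \<tau>) \<and> rho0 E \<Phi> F = ereal (cmod \<tau>)"
proof -
  have E: "compact E" "exterior_conformal_map E \<Phi>" "\<And>z. z \<notin> E \<Longrightarrow> \<Psi> (\<Phi> z) = z"
    using assms(1) by (auto simp: admissible_def)
  have \<mu>: "sets \<mu> = sets borel" "finite_measure \<mu>"
    using assms(3) unfolding szego_class_def measures_on_def by blast+
  obtain p' c S where S: "orthonormal_polynomials E \<mu> p'" "\<And>n. 0 < c n" "sphere_holomorphic_on S (- Some ` E)"
     "\<And>x. x \<in> - Some ` E \<Longrightarrow> S x \<noteq> 0"
     "\<And>K. compactin riemann_sphere K \<Longrightarrow> K \<subseteq> - Some ` E \<Longrightarrow>
        uniform_limit K (\<lambda>n. extend_to_infinity (\<lambda>z. poly (p' n) z / (complex_of_real (c n) * \<Phi> z ^ n))) S sequentially"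
     "(\<lambda>n. c n / c (Suc n)) \<longlonglongrightarrow> 1"
    using assms(3) unfolding szego_class_def by blast
  have "p' = p"
    by (rule ext) (rule orthonormal_polynomials_unique[OF E(1) \<mu> S(1) assms(4)])
  interpret szego_measure E \<Phi> \<Psi> \<mu> p c S
    by (intro szego_measure.intro exterior_map.intro orthonormal_system.intro compact_carrier_measure.intro
        orthonormal_system_axioms.intro szego_measure_axioms.intro E \<mu> assms(4) S(2-4,6) S(5)[unfolded \<open>p' = p\<close>])
  show ?thesis by (rule singularity_of_ratio_limit[OF assms(2,5,6)])
qed

end
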